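(* Let $r_t$, $P_t^0$, $Q_t^0$ satisfy (R0), (S1), (S2), (H0)–(H4) as stated in the context, and let $P_t$, $P_{t,\varepsilon}$ be the operators defined there. Suppose that (L0), (L1), (L3), (H5) and (H6) hold. Then for all $t\in(0,1]$ and $f\in\mathcal D\cap C_0(\mathbb R^d)$, $$P_tf(x)-f(x)=\int_0^tP_sLf(x)\,ds,\qquad x\in\mathbb R^d.$$
   Context: $B_b(\mathbb R^d)$ is the space of bounded Borel functions and $C_0(\mathbb R^d)$ the space of continuous functions vanishing at infinity, both with the supremum norm $\|\cdot\|_\infty$. Standing assumptions: (R0) $t\mapsto r_t$ is a non-negative, non-decreasing function such that $r_{\lambda t}\le\sqrt\lambda\,r_t$ for all $t\in(0,1]$, $0<\lambda\le1$. (S1) For $t\in(0,1]$, $P_t^0,Q_t^0:B_b(\mathbb R^d)\to B_b(\mathbb R^d)$ are linear operators. (S2) For $t\in(0,1]$, $P_t^0$ and $Q_t^0$ map $C_0(\mathbb R^d)$ into $C_0(\mathbb R^d)$. (H0) $\lim_{t\to0^+}\|P_t^0f-f\|_\infty=0$ for all $f\in C_0(\mathbb R^d)$. (H1) There is $C_1>0$ with $\|P_t^0f\|_\infty\le C_1\|f\|_\infty$ for all $t\in(0,1]$, $f\in B_b(\mathbb R^d)$. (H2) $\lim_{s\to t}\|P_s^0f-P_t^0f\|_\infty=0$ for all $t\in(0,1]$, $f\in B_b(\mathbb R^d)$. (H3) There are $C_3,\varepsilon_0>0$ with $\|Q_t^0f\|_\infty\le C_3t^{-1}r_t^{\varepsilon_0}\|f\|_\infty$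 for all $t\in(0,1]$, $f\in B_b(\mathbb R^d)$. (H4) $\lim_{s\to t}\|Q_s^0f-Q_t^0f\|_\infty=0$ for all $t\in(0,1]$, $f\in B_b(\mathbb R^d)$. Under these assumptions the following are well defined (Bochner integrals, absolutely convergent series) for $t\in(0,1]$: $$Q_t^nf=\int_{0<s_1<\dots<s_n<t}Q_{t-s_n}^0Q^0_{s_n-s_{n-1}}\cdots Q_{s_2-s_1}^0Q_{s_1}^0f\,ds_1\cdots ds_n,\quad Q_tf=Q_t^0f+\sum_{n=1}^\infty Q_t^nf,\quad P_tf=P_t^0f+\int_0^tP_{t-s}^0Q_sf\,ds,$$ and for $t,\varepsilon\ge0$, $0<t+\varepsilon\le1$, $f\in C_0(\mathbb R^d)$, $P_{t,\varepsilon}f=P_{t+\varepsilon}^0f+\int_0^tP_{t-s+\varepsilon}^0Q_sf\,ds$. Further hypotheses ($L_x$ means $L$ acting in the variable $x$): (L0) $L$ is a linear operator defined on a linear subspace $D(L)$ of the space of real-valued functions on $\mathbb R^d$, with values in real-valued functions on $\mathbb R^d$. (L1) Positive maximum principle: if $f\in D(L)$ satisfies $f(x_0)=\sup_{x\in\mathbb R^d}f(x)\ge0$, then $Lf(x_0)\le0$. (L3) $\mathcal D\subseteq D(L)$ is such that $Lf\in C_0(\mathbb R^d)$ for every $f\in\mathcal D$. (H5) For all $t,\varepsilon>0$ with $t+\varepsilon\le1$, $x\in\mathbb R^d$ and $f\in C_0(\mathbb R^d)$: $t\mapsto P_{t,\varepsilon}f(x)$ is differentiable, $P_{t,\varepsilon}f\in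 D(L)$, and $$(\partial_t-L_x)P_{t,\varepsilon}f(x)=P_\varepsilon^0Q_tf(x)-Q_{t+\varepsilon}^0f(x)-\int_0^tQ_{t-s+\varepsilon}^0Q_sf(x)\,ds.$$ (H6) For all $t,\varepsilon>0$ with $t+\varepsilon\le1$, $x\in\mathbb R^d$ and $f\in C_0(\mathbb R^d)$: $t\mapsto P_{t,\varepsilon}f(x)$ is differentiable, both $P_{t,\varepsilon}f$ and $\int_0^tP_{s,\varepsilon}f\,ds$ belong to $D(L)$, the integrands below are measurable, and $$\int_0^{1-\varepsilon}|\partial_sP_{s,\varepsilon}f(x)|ds<\infty,\quad\int_0^{1-\varepsilon}|L_xP_{s,\varepsilon}f(x)|ds<\infty,\quad L_x\int_0^tP_{s,\varepsilon}f(x)\,ds=\int_0^tL_xP_{s,\varepsilon}f(x)\,ds.$$ *)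

theory Defs
  imports "HOL-Analysis.Analysis"
begin

section \<open>The Banach space of bounded Borel functions\<close>

typedef (overloaded) 'a bborel =
  "{f :: 'a::topological_space \<Rightarrow> real. f \<in> borel_measurable borel \<and> bounded (range f)}"
  morphisms bb_fun Bborel
  by (rule exI[of _ "\<lambda>_. 0"]) auto

setup_lifting type_definition_bborel

lemma bb_fun_measurable [measurable, simp]: "bb_fun f \<in> borel_measurable borel"
  using bb_fun[of f] by simp

lemma bb_fun_bounded [simp]: "bounded (range (bb_fun f))"
  using bb_fun[of f] by simp

lemma bborel_eqI: "(\<And>x. bb_fun f x = bb_fun g x) \<Longrightarrow> f = g"
  by (metis bb_fun_inject ext)

instantiation bborel :: (topological_space) real_vector
begin

lift_definition zero_bborel :: "'a bborel" is "\<lambda>_. 0" by auto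

lift_definition uminus_bborel :: "'a bborel \<Rightarrow> 'a bborel" is "\<lambda>f x. - f x"
  by (auto simp: bounded_iff)

lift_definition plus_bborel :: "'a bborel \<Rightarrow> 'a bborel \<Rightarrow> 'a bborel" is "\<lambda>f g x. f x + g x"
  by (auto intro: bounded_plus_comp)

lift_definition minus_bborel :: "'a bborel \<Rightarrow> 'a bborel \<Rightarrow> 'a bborel" is "\<lambda>f g x. f x - g x"
  by (auto intro: bounded_minus_comp)

lift_definition scaleR_bborel :: "real \<Rightarrow> 'a bborel \<Rightarrow> 'a bborel" is "\<lambda>c f x. c * f x"
  by (auto intro: bounded_scaleR_comp[where 'b = real, unfolded real_scaleR_def])

instance
  by standard (transfer; auto simp: algebra_simps)+

end

instantiation bborel :: (topological_space) real_normed_vector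
begin

lift_definition norm_bborel :: "'a bborel \<Rightarrow> real" is "\<lambda>f. (SUP x. \<bar>f x\<bar>)" .

definition "dist_bborel (f :: 'a bborel) g = norm (f - g)"

definition "sgn_bborel (f :: 'a bborel) = f /\<^sub>R norm f"

definition uniformity_bborel :: "('a bborel \<times> 'a bborel) filter"
  where "uniformity_bborel = (INF e\<in>{0<..}. principal {(x, y). dist x y < e})"

definition open_bborel :: "'a bborel set \<Rightarrow> bool"
  where "open_bborel S = (\<forall>x\<in>S. \<forall>\<^sub>F (x', y) in uniformity. x' = x \<longrightarrow> y \<in> S)"

lemma abs_bb_fun_le_norm: "\<bar>bb_fun f x\<bar> \<le> norm f" for f :: "'a bborel"
proof transfer
  fix f :: "'a \<Rightarrow> real" and x
  assume "f \<in> borel_measurable borel \<and> bounded (range f)"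
  then obtain B where "\<And>y. \<bar>f y\<bar> \<le> B" by (auto simp: bounded_iff)
  then show "\<bar>f x\<bar> \<le> (SUP x. \<bar>f x\<bar>)" by (intro cSUP_upper bdd_aboveI2[where M = B]) auto
qed

lemma norm_bborel_le: "(\<And>x. \<bar>bb_fun f x\<bar> \<le> B) \<Longrightarrow> norm f \<le> B" for f :: "'a bborel"
  by transfer (auto intro: cSUP_least)

instance
proof
  fix f g :: "'a bborel" and c :: real
  show "norm f = 0 \<longleftrightarrow> f = 0"
  proof
    assume "norm f = 0"
    then have "bb_fun f x = 0" for x using abs_bb_fun_le_norm[of f x] by simp
    then show "f = 0" by (intro bborel_eqI) (simp add: zero_bborel.rep_eq)
  next
    assume "f = 0"
    then show "norm f = 0" by (simp add: norm_bborel.rep_eq zero_bborel.rep_eq)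
  qed
  show "norm (f + g) \<le> norm f + norm g"
  proof (rule norm_bborel_le)
    fix x show "\<bar>bb_fun (f + g) x\<bar> \<le> norm f + norm g"
      using abs_bb_fun_le_norm[of f x] abs_bb_fun_le_norm[of g x]
      by (simp add: plus_bborel.rep_eq)
  qed
  have le: "norm (c *\<^sub>R f) \<le> \<bar>c\<bar> * norm f" for c and f :: "'a bborel"
    by (rule norm_bborel_le)
      (auto simp: scaleR_bborel.rep_eq abs_mult intro: mult_left_mono abs_bb_fun_le_norm)
  show "norm (c *\<^sub>R f) = \<bar>c\<bar> * norm f"
  proof (cases "c = 0")
    case True
    then show ?thesis by (simp add: norm_bborel.rep_eq zero_bborel.rep_eq)
  next
    case False
    have "norm f \<le> \<bar>inverse c\<bar> * norm (c *\<^sub>R f)"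
      using le[of "inverse c" "c *\<^sub>R f"] False by simp
    then have "\<bar>c\<bar> * norm f \<le> norm (c *\<^sub>R f)"
      using False by (simp add: field_simps)
    with le[of c f] show ?thesis by simp
  qed
qed (rule dist_bborel_def sgn_bborel_def uniformity_bborel_def open_bborel_def)+

end

instance bborel :: (topological_space) banach
proof
  fix X :: "nat \<Rightarrow> 'a bborel"
  assume X: "Cauchy X"
  have diff: "\<bar>bb_fun (X m) x - bb_fun (X n) x\<bar> \<le> dist (X m) (X n)" for m n x
    using abs_bb_fun_le_norm[of "X m - X n" x] by (simp add: dist_bborel_def minus_bborel.rep_eq)
  have "Cauchy (\<lambda>n. bb_fun (X n) x)" for x
    using X unfolding Cauchy_def dist_real_def by (meson diff le_less_trans)
  then have "\<exists>l. (\<lambda>n. bb_fun (X n) x) \<longlonglongrightarrow> l" for x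
    by (simp add: Cauchy_convergent_iff convergent_def)
  then obtain g where g: "\<And>x. (\<lambda>n. bb_fun (X n) x) \<longlonglongrightarrow> g x" by metis
  have unif: "\<exists>N. \<forall>n\<ge>N. \<forall>x. \<bar>bb_fun (X n) x - g x\<bar> \<le> e" if e: "e > 0" for e
  proof -
    obtain N where N: "\<And>m n. m \<ge> N \<Longrightarrow> n \<ge> N \<Longrightarrow> dist (X m) (X n) < e"
      using X e unfolding Cauchy_def by blast
    have "\<bar>bb_fun (X n) x - g x\<bar> \<le> e" if "n \<ge> N" for n x
    proof (rule LIMSEQ_le_const2)
      show "(\<lambda>m. \<bar>bb_fun (X n) x - bb_fun (X m) x\<bar>) \<longlonglongrightarrow> \<bar>bb_fun (X n) x - g x\<bar>"
        by (intro tendsto_intros g)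
      show "\<exists>M. \<forall>m\<ge>M. \<bar>bb_fun (X n) x - bb_fun (X m) x\<bar> \<le> e"
        using diff N that by (meson le_less_trans less_imp_le)
    qed
    then show ?thesis by blast
  qed
  have meas: "g \<in> borel_measurable borel"
    by (rule borel_measurable_LIMSEQ_real[where u = "\<lambda>n. bb_fun (X n)"]) (use g in auto)
  obtain N where N: "\<And>x. \<bar>bb_fun (X N) x - g x\<bar> \<le> 1" using unif[of 1] by auto
  have "\<bar>g x\<bar> \<le> norm (X N) + 1" for x
    using N[of x] abs_bb_fun_le_norm[of "X N" x] by linarith
  then have "bounded (range g)" by (auto simp: bounded_iff)
  with meas have G: "bb_fun (Bborel g) = g" by (simp add: Bborel_inverse)
  have "X \<longlonglongrightarrow> Bborel g"
  proof (rule LIMSEQ_I)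
    fix e :: real assume "e > 0"
    then obtain N where N: "\<And>n x. n \<ge> N \<Longrightarrow> \<bar>bb_fun (X n) x - g x\<bar> \<le> e / 2"
      using unif[of "e / 2"] by auto
    have "norm (X n - Bborel g) \<le> e / 2" if "n \<ge> N" for n
      using N that by (intro norm_bborel_le) (simp add: minus_bborel.rep_eq G)
    moreover have "e / 2 < e" using \<open>e > 0\<close> by simp
    ultimately show "\<exists>N. \<forall>n\<ge>N. norm (X n - Bborel g) < e"
      by (blast intro: le_less_trans)
  qed
  then show "convergent X" by (rule convergentI)
qed

definition C0 :: "('a::real_normed_vector \<Rightarrow> real) set" where
  "C0 = {f. continuous_on UNIV f \<and> (f \<longlongrightarrow> 0) at_infinity}"


section \<open>The Bochner integral in a general Banach space\<close>

text \<open>The library's \<^const>\<open>has_bochner_integral\<close> is restricted to second countable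
  spaces, which the space of bounded Borel functions is not. This is the same definition without that
  restriction; the approximation in L1 by simple functions forces \<open>f\<close> to be almost
  everywhere separably valued.\<close>

definition has_Bochner_integral ::
    "'a measure \<Rightarrow> ('a \<Rightarrow> 'b::real_normed_vector) \<Rightarrow> 'b \<Rightarrow> bool" where
  "has_Bochner_integral M f I \<longleftrightarrow>
     f \<in> borel_measurable M \<and>
     (\<exists>s. (\<forall>i. Bochner_Integration.simple_bochner_integrable M (s i)) \<and>
          (\<lambda>i. \<integral>\<^sup>+x. norm (f x - s i x) \<partial>M) \<longlonglongrightarrow> 0 \<and>
          (\<lambda>i. Bochner_Integration.simple_bochner_integral M (s i)) \<longlonglongrightarrow> I)"

definition Bochner_integral :: "'a measure \<Rightarrow> ('a \<Rightarrow> 'b::real_normed_vector) \<Rightarrow> 'b" where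
  "Bochner_integral M f =
     (if \<exists>I. has_Bochner_integral M f I then THE I. has_Bochner_integral M f I else 0)"

definition set_Bochner_integral ::
    "'a measure \<Rightarrow> 'a set \<Rightarrow> ('a \<Rightarrow> 'b::real_normed_vector) \<Rightarrow> 'b" where
  "set_Bochner_integral M A f = Bochner_integral M (\<lambda>x. indicat_real A x *\<^sub>R f x)"


section \<open>The parametrix construction\<close>

text \<open>Operator families are total functions of real time; only times in \<open>(0, 1]\<close>
  matter below.\<close>

type_synonym 'a op_family = "real \<Rightarrow> 'a bborel \<Rightarrow> 'a bborel"

definition time_simplex :: "nat \<Rightarrow> real \<Rightarrow> (nat \<Rightarrow> real) set" where
  "time_simplex n t = {s. 0 < s 1 \<and> (\<forall>i\<in>{1..<n}. s i < s (i + 1)) \<and> s n < t}"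

text \<open>\<open>Q_chain Q0 s n f\<close> is the product
  \<open>Q0 (s n - s (n-1)) \<dots> Q0 (s 2 - s 1) (Q0 (s 1) f)\<close>.\<close>

primrec Q_chain ::
    "'a::topological_space op_family \<Rightarrow> (nat \<Rightarrow> real) \<Rightarrow> nat \<Rightarrow> 'a bborel \<Rightarrow> 'a bborel" where
  "Q_chain Q0 s 0 f = f"
| "Q_chain Q0 s (Suc n) f = Q0 (s (Suc n) - (if n = 0 then 0 else s n)) (Q_chain Q0 s n f)"

definition Q_iter ::
    "'a::topological_space op_family \<Rightarrow> nat \<Rightarrow> 'a op_family" where
  "Q_iter Q0 n t f =
     set_Bochner_integral (\<Pi>\<^sub>M i\<in>{1..n}. lborel) (time_simplex n t)
       (\<lambda>s. Q0 (t - s n) (Q_chain Q0 s n f))"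

definition Q_sum :: "'a::topological_space op_family \<Rightarrow> 'a op_family" where
  "Q_sum Q0 t f = Q0 t f + (\<Sum>n. Q_iter Q0 (Suc n) t f)"

definition P_op ::
    "'a::topological_space op_family \<Rightarrow> 'a op_family \<Rightarrow> 'a op_family" where
  "P_op P0 Q0 t f =
     P0 t f + set_Bochner_integral lborel {0<..<t} (\<lambda>s. P0 (t - s) (Q_sum Q0 s f))"

definition P_eps ::
    "'a::topological_space op_family \<Rightarrow> 'a op_family \<Rightarrow> real \<Rightarrow> real \<Rightarrow> 'a bborel \<Rightarrow> 'a bborel" where
  "P_eps P0 Q0 t \<epsilon> f =
     P0 (t + \<epsilon>) f
     + set_Bochner_integral lborel {0<..<t} (\<lambda>s. P0 (t - s + \<epsilon>) (Q_sum Q0 s f))"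

text \<open>Since the construction only makes sense for \<open>t + \<epsilon> \<le> 1\<close>, the time derivative
  is one-sided at \<open>t = 1 - \<epsilon>\<close> and the usual one for \<open>0 < t < 1 - \<epsilon>\<close>.\<close>

definition P_eps_differentiable ::
    "'a::topological_space op_family \<Rightarrow> 'a op_family \<Rightarrow> real \<Rightarrow> real \<Rightarrow> 'a bborel \<Rightarrow> 'a \<Rightarrow> bool" where
  "P_eps_differentiable P0 Q0 t \<epsilon> f x \<longleftrightarrow>
     (\<lambda>u. bb_fun (P_eps P0 Q0 u \<epsilon> f) x) differentiable (at t within {0<..1-\<epsilon>})"

definition dt_P_eps ::
    "'a::topological_space op_family \<Rightarrow> 'a op_family \<Rightarrow> real \<Rightarrow> real \<Rightarrow> 'a bborel \<Rightarrow> 'a \<Rightarrow> real" where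
  "dt_P_eps P0 Q0 t \<epsilon> f x =
     vector_derivative (\<lambda>u. bb_fun (P_eps P0 Q0 u \<epsilon> f) x) (at t within {0<..1-\<epsilon>})"


section \<open>Linear operators on spaces of functions\<close>

definition function_subspace :: "('a \<Rightarrow> real) set \<Rightarrow> bool" where
  "function_subspace D \<longleftrightarrow>
     (\<lambda>_. 0) \<in> D \<and>
     (\<forall>f\<in>D. \<forall>g\<in>D. (\<lambda>x. f x + g x) \<in> D) \<and>
     (\<forall>c. \<forall>f\<in>D. (\<lambda>x. c * f x) \<in> D)"

definition linear_operator_on ::
    "('a \<Rightarrow> real) set \<Rightarrow> (('a \<Rightarrow> real) \<Rightarrow> 'a \<Rightarrow> real) \<Rightarrow> bool" where
  "linear_operator_on D L \<longleftrightarrow>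
     function_subspace D \<and>
     (\<forall>f\<in>D. \<forall>g\<in>D. L (\<lambda>x. f x + g x) = (\<lambda>x. L f x + L g x)) \<and>
     (\<forall>c. \<forall>f\<in>D. L (\<lambda>x. c * f x) = (\<lambda>x. c * L f x))"

definition positive_maximum_principle ::
    "('a \<Rightarrow> real) set \<Rightarrow> (('a \<Rightarrow> real) \<Rightarrow> 'a \<Rightarrow> real) \<Rightarrow> bool" where
  "positive_maximum_principle D L \<longleftrightarrow>
     (\<forall>f\<in>D. \<forall>x\<^sub>0. bdd_above (range f) \<and> f x\<^sub>0 = (SUP x. f x) \<and> f x\<^sub>0 \<ge> 0 \<longrightarrow> L f x\<^sub>0 \<le> 0)"

end

theory Submission
  imports Defs
begin

text \<open>Write \<open>P\<^sub>t\<^sub>,\<^sub>\<epsilon>\<close> for the regularized parametrix and, for \<open>f\<close> in the domain with image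
\<open>g = L f\<close>, consider the defect
\<open>u\<^sub>\<epsilon>(t) = P\<^sub>t\<^sub>,\<^sub>\<epsilon> f - f - \<integral>\<^sub>0\<^sup>t P\<^sub>s\<^sub>,\<^sub>\<epsilon> g ds\<close>. The goal is that \<open>u\<^sub>0\<close> vanishes. The idea is that
\<open>u\<^sub>\<epsilon>\<close> solves a parabolic equation with a small right-hand side and a small initial value, so that the
maximum principle makes \<open>u\<^sub>\<epsilon>\<close> itself small.

By hypothesis, \<open>(\<partial>\<^sub>t - L) P\<^sub>t\<^sub>,\<^sub>\<epsilon> f = R f t \<epsilon>\<close> with the residual
\<open>R f t \<epsilon> = P0\<^sub>\<epsilon> Q\<^sub>t f - Q0\<^sub>t\<^sub>+\<^sub>\<epsilon> f - \<integral>\<^sub>0\<^sup>t Q0\<^sub>t\<^sub>-\<^sub>s\<^sub>+\<^sub>\<epsilon> Q\<^sub>s f ds\<close>. Pulling \<open>L\<close> under the time integral and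
integrating \<open>\<partial>\<^sub>s P\<^sub>s\<^sub>,\<^sub>\<epsilon> g\<close> by the fundamental theorem of calculus gives (\<open>defect_evolution\<close>)
\<open>(\<partial>\<^sub>t - L) u\<^sub>\<epsilon>(t) = R f t \<epsilon> + (g - P0\<^sub>\<epsilon> g) - \<integral>\<^sub>0\<^sup>t R g s \<epsilon> ds\<close>.

At \<open>\<epsilon> = 0\<close> the residual is zero: this is exactly the Volterra equation
\<open>Q\<^sub>t = Q0\<^sub>t + \<integral>\<^sub>0\<^sup>t Q0\<^sub>t\<^sub>-\<^sub>s Q\<^sub>s ds\<close> (\<open>Volterra_equation\<close>), obtained by integrating the simplex integrals that define
\<open>Q\<^sub>t\<^sup>n\<close> over their last time variable (\<open>iterate_Suc\<close>) and summing. Since the residual is jointly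
continuous in \<open>(t, \<epsilon>)\<close>, it tends to zero uniformly for \<open>t\<close> in a compact subinterval of \<open>(0, 1)\<close>, and an integrable bound
of order \<open>t\<^sup>\<delta>\<^sup>-\<^sup>1\<close> takes care of its time integral. The parabolic maximum principle
(\<open>parabolic_norm_estimate\<close>) then yields, as \<open>\<epsilon>\<close> tends to zero, that the norm of \<open>u\<^sub>0(T)\<close> is at most the
norm of \<open>u\<^sub>0(\<tau>)\<close> for \<open>0 < \<tau> \<le> T < 1\<close>. Because \<open>u\<^sub>0(\<tau>)\<close> tends to zero with \<open>\<tau>\<close>, \<open>u\<^sub>0\<close> vanishes on
\<open>(0, 1)\<close>, and by continuity also at time one.

All estimates rest on the bound of \<open>Q0\<^sub>t\<close> by a multiple of \<open>t\<^sup>\<delta>\<^sup>-\<^sup>1\<close> with \<open>0 < \<delta> \<le> 1\<close>. The series of iterated convolutions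
is summed with an exponential time weight: for a large rate \<open>l\<close>, convolution
with \<open>e\<^sup>-\<^sup>l\<^sup>t t\<^sup>\<delta>\<^sup>-\<^sup>1\<close> maps \<open>t\<^sup>\<delta>\<^sup>-\<^sup>1\<close> to a small multiple of itself (\<open>kernel_convolution\<close>), so the bound on the iterates is halved
in each step. The Bochner integrals take values in a nonseparable space; identities between them are
verified pointwise, since evaluation at a point is a bounded linear functional and commutes with the integral
(\<open>bb_fun_Bochner_integral\<close>).\<close>

section \<open>Existence and uniqueness of the Bochner integral\<close>

abbreviation "simple_integrable \<equiv> Bochner_Integration.simple_bochner_integrable"
abbreviation "simple_Bochner_integral \<equiv> Bochner_Integration.simple_bochner_integral"

text \<open>In a nonseparable space the difference of two measurable functions need not be measurable; if one of
them takes only finitely many values, it is measurable on each level set.\<close>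

lemma borel_measurable_norm_diff_simple:
  fixes f s :: "'a \<Rightarrow> 'b::real_normed_vector"
  assumes f: "f \<in> borel_measurable M" and s: "simple_function M s"
  shows "(\<lambda>x. norm (f x - s x)) \<in> borel_measurable M"
proof (rule measurable_compose_countable'[where f = "\<lambda>v x. norm (f x - v :: 'b)" and I = "s ` space M"])
  fix v :: 'b
  have "continuous_on UNIV (\<lambda>w. norm (w - v))" by (intro continuous_intros)
  then show "(\<lambda>x. norm (f x - v)) \<in> borel_measurable M"
    using f borel_measurable_continuous_onI measurable_compose by blast
next
  show "s \<in> measurable M (count_space (s ` space M))"
    using measurable_simple_function[OF s]
    by (rule measurable_count_space_extend[OF subset_UNIV, rotated]) simp
  show "countable (s ` space M)"
    using s by (auto simp: simple_function_def intro: countable_finite)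
qed

text \<open>The estimate behind both existence and uniqueness of the integral: simple functions that are close in
\<open>L\<^sup>1\<close> to a common function have close integrals.\<close>

lemma simple_integral_diff_le:
  fixes f s t :: "'a \<Rightarrow> 'b::real_normed_vector"
  assumes f: "f \<in> borel_measurable M"
    and s: "simple_integrable M s" and t: "simple_integrable M t"
  shows "ennreal (norm (simple_Bochner_integral M s - simple_Bochner_integral M t)) \<le>
    (\<integral>\<^sup>+x. norm (f x - s x) \<partial>M) + (\<integral>\<^sup>+x. norm (f x - t x) \<partial>M)"
proof -
  have [simp]: "simple_function M s" "simple_function M t"
    using s t by (auto elim: simple_bochner_integrable.cases)
  have "ennreal (norm (simple_Bochner_integral M s - simple_Bochner_integral M t))
      = norm (simple_Bochner_integral M (\<lambda>x. s x - t x))"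
    using s t by (subst simple_bochner_integral_diff) auto
  also have "\<dots> \<le> simple_Bochner_integral M (\<lambda>x. norm (s x - t x))"
    using simple_bochner_integrable_compose2[of "(-)" M "s" "t"] s t
    by (auto intro!: simple_bochner_integral_norm_bound)
  also have "\<dots> = (\<integral>\<^sup>+x. norm (s x - t x) \<partial>M)"
    using simple_bochner_integrable_compose2[of "\<lambda>x y. norm (x - y)" M "s" "t"] s t
    by (auto intro!: simple_bochner_integral_eq_nn_integral)
  also have "\<dots> \<le> (\<integral>\<^sup>+x. ennreal (norm (f x - s x)) + ennreal (norm (f x - t x)) \<partial>M)"
  proof (rule nn_integral_mono)
    fix x show "ennreal (norm (s x - t x)) \<le> ennreal (norm (f x - s x)) + ennreal (norm (f x - t x))"
      using norm_triangle_ineq4[of "f x - t x" "f x - s x"]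
      by (simp add: ennreal_leI add.commute flip: ennreal_plus)
  qed
  also have "\<dots> = (\<integral>\<^sup>+x. norm (f x - s x) \<partial>M) + (\<integral>\<^sup>+x. norm (f x - t x) \<partial>M)"
    by (intro nn_integral_add measurable_compose[OF _ measurable_ennreal]
        borel_measurable_norm_diff_simple f) simp_all
  finally show ?thesis .
qed

lemma has_Bochner_integral_unique:
  assumes "has_Bochner_integral M f I" "has_Bochner_integral M f J"
  shows "I = J"
proof -
  obtain s where f: "f \<in> borel_measurable M" and s: "\<And>i. simple_integrable M (s i)"
    and s0: "(\<lambda>i. \<integral>\<^sup>+x. norm (f x - s i x) \<partial>M) \<longlonglongrightarrow> 0"
    and sI: "(\<lambda>i. simple_Bochner_integral M (s i)) \<longlonglongrightarrow> I"
    using assms(1) unfolding has_Bochner_integral_def by blast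
  obtain t where t: "\<And>i. simple_integrable M (t i)"
    and t0: "(\<lambda>i. \<integral>\<^sup>+x. norm (f x - t i x) \<partial>M) \<longlonglongrightarrow> 0"
    and tJ: "(\<lambda>i. simple_Bochner_integral M (t i)) \<longlonglongrightarrow> J"
    using assms(2) unfolding has_Bochner_integral_def by blast
  have "(\<lambda>i. ennreal (norm (simple_Bochner_integral M (s i) - simple_Bochner_integral M (t i)))) \<longlonglongrightarrow> ennreal (norm (I - J))"
    by (intro tendsto_intros sI tJ)
  moreover have "(\<lambda>i. ennreal (norm (simple_Bochner_integral M (s i) - simple_Bochner_integral M (t i)))) \<longlonglongrightarrow> 0"
  proof (rule tendsto_sandwich[OF _ _ tendsto_const])
    show "(\<lambda>i. (\<integral>\<^sup>+x. norm (f x - s i x) \<partial>M) + (\<integral>\<^sup>+x. norm (f x - t i x) \<partial>M)) \<longlonglongrightarrow> 0"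
      using tendsto_add[OF s0 t0] by simp
  qed (auto intro: always_eventually simple_integral_diff_le[OF f s t])
  ultimately have "ennreal (norm (I - J)) = 0" by (rule LIMSEQ_unique)
  then show ?thesis by simp
qed

lemma Bochner_integral_eq:
  assumes "has_Bochner_integral M f I"
  shows "Bochner_integral M f = I"
  using assms has_Bochner_integral_unique[of M f]
  unfolding Bochner_integral_def by (metis the_equality)

text \<open>The right notion of measurability for values in a nonseparable space: it is stable under algebraic
operations, while Borel measurability is not.\<close>

definition strongly_measurable :: "'a measure \<Rightarrow> ('a \<Rightarrow> 'b::topological_space) \<Rightarrow> bool" where
  "strongly_measurable M f \<longleftrightarrow>
     (\<exists>s. (\<forall>i. simple_function M (s i)) \<and> (\<forall>x\<in>space M. (\<lambda>i. s i x) \<longlonglongrightarrow> f x))"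

definition Bochner_integrable :: "'a measure \<Rightarrow> ('a \<Rightarrow> 'b::real_normed_vector) \<Rightarrow> bool" where
  "Bochner_integrable M f \<longleftrightarrow> strongly_measurable M f \<and> (\<integral>\<^sup>+x. norm (f x) \<partial>M) < \<infinity>"

lemma strongly_measurable_borel:
  fixes f :: "'a \<Rightarrow> 'b::metric_space"
  assumes "strongly_measurable M f"
  shows "f \<in> borel_measurable M"
  using assms unfolding strongly_measurable_def
  by (metis borel_measurable_LIMSEQ_metric borel_measurable_simple_function)

lemma strongly_measurable_separable:
  fixes f :: "'a \<Rightarrow> 'b::{metric_space, second_countable_topology}"
  assumes "f \<in> borel_measurable M"
  shows "strongly_measurable M f"
  using borel_measurable_implies_sequence_metric[OF assms] unfolding strongly_measurable_def by blast

lemma strongly_measurable_const [simp]: "strongly_measurable M (\<lambda>x. c)"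
  unfolding strongly_measurable_def by (rule exI[of _ "\<lambda>_ _. c"]) auto

lemma strongly_measurable_compose2:
  assumes "strongly_measurable M f" "strongly_measurable M g"
    and "continuous_on UNIV (\<lambda>p. h (fst p) (snd p))"
  shows "strongly_measurable M (\<lambda>x. h (f x) (g x))"
proof -
  obtain s t where s: "\<And>i. simple_function M (s i)" "\<And>x. x \<in> space M \<Longrightarrow> (\<lambda>i. s i x) \<longlonglongrightarrow> f x"
    and t: "\<And>i. simple_function M (t i)" "\<And>x. x \<in> space M \<Longrightarrow> (\<lambda>i. t i x) \<longlonglongrightarrow> g x"
    using assms(1,2) unfolding strongly_measurable_def by metis
  have "(\<lambda>i. h (s i x) (t i x)) \<longlonglongrightarrow> h (f x) (g x)" if "x \<in> space M" for x
    using continuous_on_tendsto_compose[OF assms(3), of "\<lambda>i. (s i x, t i x)" "(f x, g x)" sequentially]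
      tendsto_Pair[OF s(2)[OF that] t(2)[OF that]] by simp
  then show ?thesis
    unfolding strongly_measurable_def using s t
    by (intro exI[of _ "\<lambda>i x. h (s i x) (t i x)"]) (auto intro: simple_function_compose2)
qed

lemma strongly_measurable_diff:
  fixes f g :: "'a \<Rightarrow> 'b::real_normed_vector"
  assumes "strongly_measurable M f" "strongly_measurable M g"
  shows "strongly_measurable M (\<lambda>x. f x - g x)"
  by (rule strongly_measurable_compose2[OF assms]) (intro continuous_intros)

lemma strongly_measurable_scaleR:
  fixes g :: "'a \<Rightarrow> 'b::real_normed_vector"
  assumes "f \<in> borel_measurable M" "strongly_measurable M g"
  shows "strongly_measurable M (\<lambda>x. f x *\<^sub>R g x)"
  by (rule strongly_measurable_compose2[OF strongly_measurable_separable[OF assms(1)] assms(2)])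
    (intro continuous_intros)

lemma strongly_measurable_norm:
  fixes f :: "'a \<Rightarrow> 'b::real_normed_vector"
  assumes "strongly_measurable M f"
  shows "(\<lambda>x. norm (f x)) \<in> borel_measurable M"
  using borel_measurable_norm_diff_simple[OF strongly_measurable_borel[OF assms], of "\<lambda>_. 0"] by simp

text \<open>Measurability of all integrands below comes from this lemma: \<open>h\<close> is a strongly continuous operator
family on times in \<open>(0, 1]\<close>, applied at a measurable time to a strongly measurable curve. Approximating time and curve
simultaneously by simple functions suffices, by joint continuity.\<close>

lemma strongly_measurable_time_family:
  fixes h :: "real \<Rightarrow> 'b::metric_space \<Rightarrow> 'c::real_normed_vector"
  assumes u [measurable]: "u \<in> borel_measurable M" and f: "strongly_measurable M f"
    and h: "continuous_on ({0<..1} \<times> UNIV) (\<lambda>p. h (fst p) (snd p))"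
    and S [measurable]: "{x \<in> space M. x \<in> S} \<in> sets M" and uS: "\<And>x. x \<in> space M \<Longrightarrow> x \<in> S \<Longrightarrow> u x \<in> {0<..1}"
  shows "strongly_measurable M (\<lambda>x. indicator S x *\<^sub>R h (u x) (f x))"
proof -
  obtain s t where s: "\<And>i. simple_function M (s i)" "\<And>x. x \<in> space M \<Longrightarrow> (\<lambda>i. s i x) \<longlonglongrightarrow> u x"
    and t: "\<And>i. simple_function M (t i)" "\<And>x. x \<in> space M \<Longrightarrow> (\<lambda>i. t i x) \<longlonglongrightarrow> f x"
    using strongly_measurable_separable[OF u] f unfolding strongly_measurable_def by metis
  have S': "simple_function M (indicator S :: 'a \<Rightarrow> real)"
    by (subst simple_function_cong[where g = "indicator {x \<in> space M. x \<in> S}"])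
       (auto simp: indicator_def)
  \<comment> \<open>The approximating times are eventually positive; the cap at one keeps them in the set where \<open>h\<close> is continuous.\<close>
  let ?F = "\<lambda>i x. indicator S x *\<^sub>R h (min (s i x) 1) (t i x)"
  have "(\<lambda>i. ?F i x) \<longlonglongrightarrow> indicator S x *\<^sub>R h (u x) (f x)" if x: "x \<in> space M" for x
  proof (cases "x \<in> S")
    case True
    have "(\<lambda>i. h (fst (min (s i x) 1, t i x)) (snd (min (s i x) 1, t i x))) \<longlonglongrightarrow> h (fst (u x, f x)) (snd (u x, f x))"
    proof (rule continuous_on_tendsto_compose[OF h])
      have "(\<lambda>i. min (s i x) 1) \<longlonglongrightarrow> min (u x) 1" by (intro tendsto_intros s x)
      then show "(\<lambda>i. (min (s i x) 1, t i x)) \<longlonglongrightarrow> (u x, f x)"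
        using uS[OF x True] by (intro tendsto_Pair t x) auto
      have "eventually (\<lambda>i. s i x > 0) sequentially"
        using s(2)[OF x] uS[OF x True] by (auto dest: order_tendstoD(1))
      then show "\<forall>\<^sub>F i in sequentially. (min (s i x) 1, t i x) \<in> {0<..1} \<times> UNIV"
        by eventually_elim auto
    qed (use uS[OF x True] in auto)
    with True show ?thesis by simp
  qed simp
  moreover have "simple_function M (?F i)" for i
    using simple_function_compose2[OF S' simple_function_compose2[OF s(1) t(1),
          of "\<lambda>a b. h (min a 1) b"], of "(*\<^sub>R)"] .
  ultimately show ?thesis unfolding strongly_measurable_def by (intro exI[of _ ?F]) auto
qed

text \<open>Truncating the simple approximants where they exceed twice the norm of the limit makes them dominated, so they converge
in \<open>L\<^sup>1\<close> and their integrals form a Cauchy sequence.\<close>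

lemma Bochner_integrable_has_integral:
  fixes f :: "'a \<Rightarrow> 'b::banach"
  assumes "Bochner_integrable M f"
  shows "has_Bochner_integral M f (Bochner_integral M f)"
proof -
  have sm: "strongly_measurable M f" and fin: "(\<integral>\<^sup>+x. norm (f x) \<partial>M) < \<infinity>"
    using assms by (auto simp: Bochner_integrable_def)
  have nf [measurable]: "(\<lambda>x. norm (f x)) \<in> borel_measurable M"
    by (rule strongly_measurable_norm[OF sm])
  have f: "f \<in> borel_measurable M" by (rule strongly_measurable_borel[OF sm])
  obtain s where s: "\<And>i. simple_function M (s i)" "\<And>x. x \<in> space M \<Longrightarrow> (\<lambda>i. s i x) \<longlonglongrightarrow> f x"
    using sm unfolding strongly_measurable_def by metis
  define S where "S i = {x\<in>space M. norm (s i x) \<le> 2 * norm (f x)}" for i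
  have ns [measurable]: "(\<lambda>x. norm (s i x)) \<in> borel_measurable M" for i
    using s(1)[of i] borel_measurable_simple_function simple_function_compose1 by blast
  have [measurable]: "S i \<in> sets M" for i unfolding S_def by measurable
  define t where "t i x = indicat_real (S i) x *\<^sub>R s i x" for i x
  have t: "simple_function M (t i)" for i
    unfolding t_def
    by (rule simple_function_compose2[where h = "(*\<^sub>R)"]) (auto intro: s simple_function_indicator)
  have tb: "norm (t i x) \<le> 2 * norm (f x)" for i x
    unfolding t_def S_def by (auto simp: indicator_def)
  have tl: "(\<lambda>i. t i x) \<longlonglongrightarrow> f x" if x: "x \<in> space M" for x
  proof (cases "f x = 0")
    case True
    then have "t i x = 0" for i using tb[of i x] by simp
    then show ?thesis using True by simp
  next
    case False
    then have "eventually (\<lambda>i. norm (s i x) < 2 * norm (f x)) sequentially"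
      by (intro order_tendstoD(2)[OF tendsto_norm[OF s(2)[OF x]]]) simp
    then have "eventually (\<lambda>i. s i x = t i x) sequentially"
      by eventually_elim (use x in \<open>auto simp: t_def S_def\<close>)
    then show ?thesis by (rule Lim_transform_eventually[OF s(2)[OF x]])
  qed
  have l1: "(\<lambda>i. \<integral>\<^sup>+x. norm (f x - t i x) \<partial>M) \<longlonglongrightarrow> (\<integral>\<^sup>+x. 0 \<partial>M)"
  proof (rule nn_integral_dominated_convergence[where w = "\<lambda>x. ennreal (3 * norm (f x))"])
    show "(\<lambda>x. ennreal (norm (f x - t i x))) \<in> borel_measurable M" for i
      by (intro measurable_compose[OF _ measurable_ennreal] borel_measurable_norm_diff_simple f t)
    show "AE x in M. ennreal (norm (f x - t i x)) \<le> ennreal (3 * norm (f x))" for i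
    proof (rule AE_I2, rule ennreal_leI)
      fix x show "norm (f x - t i x) \<le> 3 * norm (f x)"
        using norm_triangle_ineq4[of "f x" "t i x"] tb[of i x] by linarith
    qed
    have "(\<integral>\<^sup>+x. ennreal (3 * norm (f x)) \<partial>M) = 3 * (\<integral>\<^sup>+x. norm (f x) \<partial>M)"
      by (subst nn_integral_cmult[symmetric]) (auto simp: ennreal_mult)
    then show "(\<integral>\<^sup>+x. ennreal (3 * norm (f x)) \<partial>M) < \<infinity>"
      using fin by (simp add: ennreal_mult_less_top)
    show "AE x in M. (\<lambda>i. ennreal (norm (f x - t i x))) \<longlonglongrightarrow> 0"
    proof (rule AE_I2)
      fix x assume "x \<in> space M"
      from tl[OF this] have "(\<lambda>i. norm (f x - t i x)) \<longlonglongrightarrow> 0"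
        using tendsto_norm[OF tendsto_diff[OF tendsto_const[of "f x"]]] by fastforce
      then show "(\<lambda>i. ennreal (norm (f x - t i x))) \<longlonglongrightarrow> 0"
        using tendsto_ennrealI by fastforce
    qed
  qed auto
  then have l1: "(\<lambda>i. \<integral>\<^sup>+x. norm (f x - t i x) \<partial>M) \<longlonglongrightarrow> 0" by simp
  have ti: "simple_integrable M (t i)" for i
  proof (rule simple_bochner_integrableI_bounded[OF t])
    have "(\<integral>\<^sup>+x. norm (t i x) \<partial>M) \<le> (\<integral>\<^sup>+x. 2 * ennreal (norm (f x)) \<partial>M)"
      using tb[of i] by (intro nn_integral_mono) (simp add: ennreal_mult'[symmetric] ennreal_leI flip: ennreal_numeral)
    also have "\<dots> = 2 * (\<integral>\<^sup>+x. norm (f x) \<partial>M)" by (rule nn_integral_cmult) auto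
    also have "\<dots> < \<infinity>" using fin by (simp add: ennreal_mult_less_top)
    finally show "(\<integral>\<^sup>+x. norm (t i x) \<partial>M) < \<infinity>" .
  qed
  have "Cauchy (\<lambda>i. simple_Bochner_integral M (t i))"
  proof (rule metric_CauchyI)
    fix e :: real assume e: "e > 0"
    have "eventually (\<lambda>i. (\<integral>\<^sup>+x. norm (f x - t i x) \<partial>M) < ennreal (e / 2)) sequentially"
      using l1 e by (intro order_tendstoD(2)) auto
    then obtain N where N: "\<And>i. i \<ge> N \<Longrightarrow> (\<integral>\<^sup>+x. norm (f x - t i x) \<partial>M) < ennreal (e / 2)"
      by (auto simp: eventually_sequentially)
    have "dist (simple_Bochner_integral M (t i)) (simple_Bochner_integral M (t j)) < e" if "i \<ge> N" "j \<ge> N" for i j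
    proof -
      have "ennreal (norm (simple_Bochner_integral M (t i) - simple_Bochner_integral M (t j))) < ennreal (e/2) + ennreal (e/2)"
        using simple_integral_diff_le[OF f ti ti] add_strict_mono[OF N[OF that(1)] N[OF that(2)]]
        by (rule le_less_trans)
      also have "\<dots> = ennreal e" using e by (simp flip: ennreal_plus)
      finally show ?thesis using e by (simp add: dist_norm ennreal_less_iff)
    qed
    then show "\<exists>N. \<forall>i\<ge>N. \<forall>j\<ge>N. dist (simple_Bochner_integral M (t i)) (simple_Bochner_integral M (t j)) < e" by blast
  qed
  then obtain I where "(\<lambda>i. simple_Bochner_integral M (t i)) \<longlonglongrightarrow> I"
    using Cauchy_convergent_iff convergent_def by blast
  then have "has_Bochner_integral M f I"
    unfolding has_Bochner_integral_def using f ti l1 by blast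
  then show ?thesis using Bochner_integral_eq by metis
qed

lemma has_Bochner_integral_bounded_linear:
  fixes T :: "'b::real_normed_vector \<Rightarrow> real"
  assumes "has_Bochner_integral M f I" and T: "bounded_linear T"
  shows "has_bochner_integral M (\<lambda>x. T (f x)) (T I)"
proof -
  interpret T: bounded_linear T by fact
  obtain K where K: "K > 0" "\<And>x. norm (T x) \<le> norm x * K" using T.pos_bounded by blast
  obtain s where f: "f \<in> borel_measurable M" and s: "\<And>i. simple_integrable M (s i)"
    and s0: "(\<lambda>i. \<integral>\<^sup>+x. norm (f x - s i x) \<partial>M) \<longlonglongrightarrow> 0"
    and sI: "(\<lambda>i. simple_Bochner_integral M (s i)) \<longlonglongrightarrow> I"
    using assms(1) unfolding has_Bochner_integral_def by blast
  have ss: "simple_function M (s i)" for i using s[of i] by (auto elim: simple_bochner_integrable.cases)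
  have m: "(\<lambda>x. norm (f x - s i x)) \<in> borel_measurable M" for i
    by (rule borel_measurable_norm_diff_simple[OF f ss])
  show ?thesis
  proof (rule has_bochner_integral.intros)
    have "T \<in> borel_measurable borel"
      by (intro borel_measurable_continuous_onI linear_continuous_on T)
    then show "(\<lambda>x. T (f x)) \<in> borel_measurable M" using f measurable_compose by blast
    show "simple_integrable M (\<lambda>x. T (s i x))" for i
      using simple_bochner_integrable_compose2[of "\<lambda>a b. T a" M "s i" "s i"] s by (simp add: T.zero)
    show "(\<lambda>i. \<integral>\<^sup>+x. norm (T (f x) - T (s i x)) \<partial>M) \<longlonglongrightarrow> 0"
    proof (rule tendsto_sandwich[OF _ _ tendsto_const])
      show "(\<lambda>i. ennreal K * (\<integral>\<^sup>+x. norm (f x - s i x) \<partial>M)) \<longlonglongrightarrow> 0"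
        using ennreal_tendsto_cmult[OF _ s0, of K] by simp
      show "\<forall>\<^sub>F i in sequentially. (\<integral>\<^sup>+x. norm (T (f x) - T (s i x)) \<partial>M) \<le> ennreal K * (\<integral>\<^sup>+x. norm (f x - s i x) \<partial>M)"
      proof (rule always_eventually, rule allI)
        fix i
        have "(\<integral>\<^sup>+x. norm (T (f x) - T (s i x)) \<partial>M) \<le> (\<integral>\<^sup>+x. ennreal K * norm (f x - s i x) \<partial>M)"
          using K(1) K(2)
          by (intro nn_integral_mono)
            (simp add: T.diff[symmetric] ennreal_mult[symmetric] mult.commute[of K] ennreal_leI)
        also have "\<dots> = ennreal K * (\<integral>\<^sup>+x. norm (f x - s i x) \<partial>M)"
          by (intro nn_integral_cmult measurable_compose[OF m measurable_ennreal])
        finally show "(\<integral>\<^sup>+x. norm (T (f x) - T (s i x)) \<partial>M) \<le> ennreal K * (\<integral>\<^sup>+x. norm (f x - s i x) \<partial>M)" .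
      qed
    qed simp
    show "(\<lambda>i. simple_Bochner_integral M (\<lambda>x. T (s i x))) \<longlonglongrightarrow> T I"
      using T.tendsto[OF sI] simple_bochner_integral_linear[OF T.linear_axioms s] by simp
  qed
qed

text \<open>This reduces identities between vector-valued integrals to real Lebesgue integrals, for which Fubini, substitution and
dominated convergence are available.\<close>

lemma Bochner_integral_functional:
  fixes T :: "'b::banach \<Rightarrow> real"
  assumes "Bochner_integrable M f" and "bounded_linear T"
  shows "integrable M (\<lambda>x. T (f x))" "T (Bochner_integral M f) = (\<integral>x. T (f x) \<partial>M)"
  using has_Bochner_integral_bounded_linear[OF Bochner_integrable_has_integral[OF assms(1)] assms(2)]
  by (auto simp: has_bochner_integral_iff)

lemma norm_Bochner_integral_le:
  fixes f :: "'a \<Rightarrow> 'b::banach"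
  assumes bi: "Bochner_integrable M f"
  shows "norm (Bochner_integral M f) \<le> (\<integral>x. norm (f x) \<partial>M)"
proof -
  have sm: "strongly_measurable M f" and fin: "(\<integral>\<^sup>+x. norm (f x) \<partial>M) < \<infinity>"
    using assms by (auto simp: Bochner_integrable_def)
  obtain s where f: "f \<in> borel_measurable M" and s: "\<And>i. simple_integrable M (s i)"
    and s0: "(\<lambda>i. \<integral>\<^sup>+x. norm (f x - s i x) \<partial>M) \<longlonglongrightarrow> 0"
    and sI: "(\<lambda>i. simple_Bochner_integral M (s i)) \<longlonglongrightarrow> Bochner_integral M f"
    using Bochner_integrable_has_integral[OF bi] unfolding has_Bochner_integral_def by blast
  have nz: "simple_integrable M (\<lambda>x. 0::'b)"
    by (rule simple_bochner_integrableI_bounded) auto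
  have z: "simple_Bochner_integral M (\<lambda>x. 0::'b) = 0"
    by (simp add: simple_bochner_integral_def image_constant_conv)
  have "ennreal (norm (Bochner_integral M f)) \<le> 0 + (\<integral>\<^sup>+x. norm (f x) \<partial>M)"
  proof (rule LIMSEQ_le)
    show "(\<lambda>i. ennreal (norm (simple_Bochner_integral M (s i)))) \<longlonglongrightarrow> ennreal (norm (Bochner_integral M f))"
      by (intro tendsto_intros sI)
    show "(\<lambda>i. (\<integral>\<^sup>+x. norm (f x - s i x) \<partial>M) + (\<integral>\<^sup>+x. norm (f x) \<partial>M)) \<longlonglongrightarrow> 0 + (\<integral>\<^sup>+x. norm (f x) \<partial>M)"
      by (intro tendsto_add s0 tendsto_const)
    show "\<exists>N. \<forall>n\<ge>N. ennreal (norm (simple_Bochner_integral M (s n)))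
        \<le> (\<integral>\<^sup>+x. norm (f x - s n x) \<partial>M) + (\<integral>\<^sup>+x. norm (f x) \<partial>M)"
      using simple_integral_diff_le[OF f s nz] by (simp add: z)
  qed
  also have "\<dots> = ennreal (\<integral>x. norm (f x) \<partial>M)"
    using fin strongly_measurable_norm[OF sm]
    by (simp add: nn_integral_eq_integral integrableI_bounded)
  finally show ?thesis by (simp add: ennreal_le_iff)
qed

lemma Bochner_integrableI:
  assumes "strongly_measurable M f" "integrable M g" "\<And>x. x \<in> space M \<Longrightarrow> norm (f x) \<le> g x"
  shows "Bochner_integrable M f"
proof -
  have "(\<integral>\<^sup>+x. norm (f x) \<partial>M) \<le> (\<integral>\<^sup>+x. norm (g x) \<partial>M)"
    using assms(3) by (intro nn_integral_mono ennreal_leI) (use abs_ge_self order_trans in \<open>fastforce\<close>)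
  also have "\<dots> < \<infinity>" using assms(2) by (simp add: integrable_iff_bounded)
  finally show ?thesis using assms(1) by (simp add: Bochner_integrable_def)
qed

lemma Bochner_integrable_norm:
  assumes "Bochner_integrable M f"
  shows "integrable M (\<lambda>x. norm (f x))"
  using assms strongly_measurable_norm[of M f]
  by (auto simp: Bochner_integrable_def integrable_iff_bounded)

lemma Bochner_integrable_diff:
  assumes "Bochner_integrable M f" "Bochner_integrable M g"
  shows "Bochner_integrable M (\<lambda>x. f x - g x)"
proof (rule Bochner_integrableI)
  show "integrable M (\<lambda>x. norm (f x) + norm (g x))"
    using assms by (intro Bochner_Integration.integrable_add Bochner_integrable_norm)
qed (use assms in \<open>auto simp: Bochner_integrable_def strongly_measurable_diff norm_triangle_ineq4\<close>)

section \<open>The weakly singular convolution kernel\<close>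

lemma nn_integral_powr:
  assumes "0 < \<delta>" "0 \<le> c"
  shows "(\<integral>\<^sup>+s. ennreal (s powr (\<delta> - 1) * indicator {0<..<c} s) \<partial>lborel) = ennreal (c powr \<delta> / \<delta>)"
proof -
  have "((\<lambda>s. s powr (\<delta> - 1)) has_integral (c powr \<delta> / \<delta>)) {0..c}"
    using has_integral_powr_from_0[of "\<delta> - 1" c] assms by simp
  then have "((\<lambda>s. s powr (\<delta> - 1)) has_integral (c powr \<delta> / \<delta>)) {0<..<c}"
    by (simp add: has_integral_Icc_iff_Ioo)
  from nn_integral_has_integral_lebesgue'[OF _ this] show ?thesis
    by (simp add: ennreal_mult' ennreal_indicator mult.commute)
qed

lemma nn_integral_exp_le:
  assumes "0 < l" "0 < t"
  shows "(\<integral>\<^sup>+s. ennreal (exp (- l * (t - s)) * indicator {0<..<t} s) \<partial>lborel) \<le> ennreal (1 / l)"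
proof -
  have "((\<lambda>s. exp (- l * (t - s))) has_integral (exp (- l * (t - t)) / l - exp (- l * (t - 0)) / l)) {0..t}"
    using assms by (intro fundamental_theorem_of_calculus)
      (auto intro!: derivative_eq_intros simp: has_real_derivative_iff_has_vector_derivative[symmetric])
  then have "((\<lambda>s. exp (- l * (t - s))) has_integral (exp (- l * (t - t)) / l - exp (- l * (t - 0)) / l)) {0<..<t}"
    by (simp add: has_integral_Icc_iff_Ioo)
  from nn_integral_has_integral_lebesgue'[OF _ this]
  have "(\<integral>\<^sup>+s. ennreal (exp (- l * (t - s)) * indicator {0<..<t} s) \<partial>lborel) =
      ennreal (exp (- l * (t - t)) / l - exp (- l * (t - 0)) / l)"
    by (simp add: ennreal_mult' ennreal_indicator mult.commute)
  also have "\<dots> \<le> ennreal (1 / l)" using assms by (intro ennreal_leI) (simp add: field_simps)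
  finally show ?thesis .
qed

definition kernel_const :: "real \<Rightarrow> real" where
  "kernel_const \<delta> = 4 * (1 / \<delta> + 1)"

text \<open>One of the two times \<open>s\<close>, \<open>t - s\<close> is at least \<open>t / 2\<close>, which bounds the product of the two
singularities by a multiple of \<open>t\<^sup>\<delta>\<^sup>-\<^sup>1\<close> times their sum. Each single singularity is then split at the time scale
\<open>1 / l\<close> of the exponential weight: below it the weight is dropped, above it the power is bounded by its
value at \<open>1 / l\<close>.\<close>

lemma kernel_pointwise:
  fixes l s t \<delta> :: real
  assumes d: "0 < \<delta>" "\<delta> \<le> 1" and "0 < l" "0 < s" "s < t"
  shows "exp (- l * (t - s)) * ((t - s) powr (\<delta> - 1) * s powr (\<delta> - 1)) \<le>
    2 * t powr (\<delta> - 1) * ((t - s) powr (\<delta> - 1) * indicator {0<..<1/l} (t - s)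
      + s powr (\<delta> - 1) * indicator {0<..<1/l} s + 2 * (1/l) powr (\<delta> - 1) * exp (- l * (t - s)))"
proof -
  define e where "e = exp (- l * (t - s))"
  have e: "0 < e" "e \<le> 1" using assms by (auto simp: e_def)
  \<comment> \<open>Splitting one singularity at the time scale \<open>1 / l\<close>.\<close>
  have aux: "e * u powr (\<delta> - 1) \<le> u powr (\<delta> - 1) * indicator {0<..<1/l} u + (1/l) powr (\<delta> - 1) * e"
    if u: "0 < u" for u
  proof (cases "u < 1/l")
    case True
    then show ?thesis using e u mult_right_mono[of e 1 "u powr (\<delta> - 1)"] assms
      by (simp add: add_increasing2)
  next
    case False
    then have "u powr (\<delta> - 1) \<le> (1/l) powr (\<delta> - 1)"
      using assms by (intro powr_mono2') auto
    with False e show ?thesis by (simp add: mult.commute mult_left_mono)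
  qed
  have h: "(t/2) powr (\<delta> - 1) \<le> 2 * t powr (\<delta> - 1)"
  proof -
    have "(t/2) powr (\<delta> - 1) = t powr (\<delta> - 1) * 2 powr (1 - \<delta>)"
      using assms by (simp add: powr_divide powr_minus_divide[symmetric] divide_powr_uminus)
    also have "\<dots> \<le> t powr (\<delta> - 1) * 2 powr 1"
      using d by (intro mult_left_mono powr_mono) auto
    finally show ?thesis by simp
  qed
  have "(t - s) powr (\<delta> - 1) * s powr (\<delta> - 1) \<le>
      (t/2) powr (\<delta> - 1) * ((t - s) powr (\<delta> - 1) + s powr (\<delta> - 1))"
  proof (cases "s \<le> t / 2")
    case True
    then have "(t - s) powr (\<delta> - 1) \<le> (t/2) powr (\<delta> - 1)"
      using assms by (intro powr_mono2') auto
    from mult_right_mono[OF this, of "s powr (\<delta> - 1)"] show ?thesis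
      by (simp add: distrib_left add_increasing)
  next
    case False
    then have "s powr (\<delta> - 1) \<le> (t/2) powr (\<delta> - 1)"
      using assms by (intro powr_mono2') auto
    from mult_right_mono[OF this, of "(t - s) powr (\<delta> - 1)"] show ?thesis
      by (simp add: distrib_left add_increasing2 mult.commute)
  qed
  also have "\<dots> \<le> 2 * t powr (\<delta> - 1) * ((t - s) powr (\<delta> - 1) + s powr (\<delta> - 1))"
    using h by (intro mult_right_mono) auto
  finally have "e * ((t - s) powr (\<delta> - 1) * s powr (\<delta> - 1)) \<le>
      e * (2 * t powr (\<delta> - 1) * ((t - s) powr (\<delta> - 1) + s powr (\<delta> - 1)))"
    using e by (intro mult_left_mono) auto
  also have "\<dots> = 2 * t powr (\<delta> - 1) * (e * (t - s) powr (\<delta> - 1) + e * s powr (\<delta> - 1))"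
    by (simp add: algebra_simps)
  also have "\<dots> \<le> 2 * t powr (\<delta> - 1) * ((t - s) powr (\<delta> - 1) * indicator {0<..<1/l} (t - s)
      + s powr (\<delta> - 1) * indicator {0<..<1/l} s + 2 * (1/l) powr (\<delta> - 1) * e)"
    using aux[of s] aux[of "t - s"] assms by (intro mult_left_mono) auto
  finally show ?thesis by (simp only: e_def)
qed

text \<open>Integrating the pointwise bound: every term contributes at the scale \<open>l\<^sup>-\<^sup>\<delta>\<close>, which becomes small as \<open>l\<close> grows.\<close>

lemma kernel_convolution:
  assumes d: "0 < \<delta>" "\<delta> \<le> 1" and l: "0 < l" and t: "0 < t"
  shows "(\<integral>\<^sup>+s. ennreal (exp (- l * (t - s)) * ((t - s) powr (\<delta> - 1) * s powr (\<delta> - 1)) * indicator {0<..<t} s) \<partial>lborel)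
    \<le> ennreal (kernel_const \<delta> * l powr (- \<delta>) * t powr (\<delta> - 1))"
proof -
  let ?A = "\<lambda>s::real. s powr (\<delta> - 1) * indicator {0<..<1/l} s"
  let ?E = "\<lambda>s. exp (- l * (t - s)) * indicator {0<..<t} s"
  have "(\<integral>\<^sup>+s. ennreal (exp (- l * (t - s)) * ((t - s) powr (\<delta> - 1) * s powr (\<delta> - 1)) * indicator {0<..<t} s) \<partial>lborel)
    \<le> (\<integral>\<^sup>+s. ennreal (2 * t powr (\<delta> - 1)) * (ennreal (?A (t - s)) + ennreal (?A s)
          + ennreal (2 * (1/l) powr (\<delta> - 1)) * ennreal (?E s)) \<partial>lborel)"
  proof (rule nn_integral_mono)
    fix s :: real
    show "ennreal (exp (- l * (t - s)) * ((t - s) powr (\<delta> - 1) * s powr (\<delta> - 1)) * indicator {0<..<t} s)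
      \<le> ennreal (2 * t powr (\<delta> - 1)) * (ennreal (?A (t - s)) + ennreal (?A s)
          + ennreal (2 * (1/l) powr (\<delta> - 1)) * ennreal (?E s))"
    proof (cases "s \<in> {0<..<t}")
      case True
      then show ?thesis using kernel_pointwise[OF d l, of s t]
        by (simp add: ennreal_leI flip: ennreal_mult ennreal_plus)
    qed simp
  qed
  also have "\<dots> = ennreal (2 * t powr (\<delta> - 1)) * ((\<integral>\<^sup>+s. ennreal (?A (t - s)) \<partial>lborel) + (\<integral>\<^sup>+s. ennreal (?A s) \<partial>lborel)
      + ennreal (2 * (1/l) powr (\<delta> - 1)) * (\<integral>\<^sup>+s. ennreal (?E s) \<partial>lborel))"
    by (simp add: nn_integral_cmult nn_integral_add)
  also have "(\<integral>\<^sup>+s. ennreal (?A (t - s)) \<partial>lborel) = (\<integral>\<^sup>+s. ennreal (?A s) \<partial>lborel)"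
    by (subst (2) nn_integral_real_affine[where t = t and c = "-1"]) auto
  also have "(\<integral>\<^sup>+s. ennreal (?A s) \<partial>lborel) = ennreal ((1/l) powr \<delta> / \<delta>)"
    using d l by (intro nn_integral_powr) auto
  also have "ennreal (2 * t powr (\<delta> - 1)) * (ennreal ((1/l) powr \<delta> / \<delta>) + ennreal ((1/l) powr \<delta> / \<delta>)
      + ennreal (2 * (1/l) powr (\<delta> - 1)) * (\<integral>\<^sup>+s. ennreal (?E s) \<partial>lborel))
    \<le> ennreal (2 * t powr (\<delta> - 1)) * (ennreal ((1/l) powr \<delta> / \<delta>) + ennreal ((1/l) powr \<delta> / \<delta>)
      + ennreal (2 * (1/l) powr (\<delta> - 1)) * ennreal (1 / l))"
    by (intro mult_left_mono add_left_mono nn_integral_exp_le l t) auto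
  also have "\<dots> = ennreal (2 * t powr (\<delta> - 1) * ((1/l) powr \<delta> / \<delta> + (1/l) powr \<delta> / \<delta>
      + 2 * (1/l) powr (\<delta> - 1) * (1 / l)))"
    using d l by (simp flip: ennreal_mult ennreal_plus)
  also have "2 * t powr (\<delta> - 1) * ((1/l) powr \<delta> / \<delta> + (1/l) powr \<delta> / \<delta>
      + 2 * (1/l) powr (\<delta> - 1) * (1 / l)) = kernel_const \<delta> * l powr (- \<delta>) * t powr (\<delta> - 1)"
  proof -
    have "(1/l) powr (\<delta> - 1) * (1 / l) = (1/l) powr \<delta>"
      using l powr_mult_base[of "1/l" "\<delta> - 1"] by (simp add: mult.commute)
    moreover have "(1/l) powr \<delta> = l powr (- \<delta>)"
      using l by (simp add: powr_divide powr_minus_divide)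
    ultimately show ?thesis by (simp add: kernel_const_def algebra_simps)
  qed
  finally show ?thesis .
qed

lemma kernel_halving_rate_exists:
  assumes d: "0 < \<delta>"
  shows "\<exists>l>0. K * (kernel_const \<delta> * l powr (- \<delta>)) \<le> 1/2"
proof -
  have "((\<lambda>l. K * (kernel_const \<delta> * l powr (- \<delta>))) \<longlongrightarrow> K * (kernel_const \<delta> * 0)) at_top"
    using d by (intro tendsto_intros tendsto_neg_powr filterlim_ident) auto
  then have "eventually (\<lambda>l. K * (kernel_const \<delta> * l powr (- \<delta>)) < 1/2) at_top"
    by (intro order_tendstoD(2)) auto
  then obtain N where N: "\<And>l. l \<ge> N \<Longrightarrow> K * (kernel_const \<delta> * l powr (- \<delta>)) < 1/2"
    by (auto simp: eventually_at_top_linorder)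
  show ?thesis
    using N[of "max N 1"] by (intro exI[of _ "max N 1"]) auto
qed

lemma integrable_powr:
  fixes \<delta> c :: real
  assumes "0 < \<delta>" "0 \<le> c"
  shows "integrable lborel (\<lambda>s. s powr (\<delta> - 1) * indicator {0<..<c} s)"
    and "(\<integral>s. s powr (\<delta> - 1) * indicator {0<..<c} s \<partial>lborel) = c powr \<delta> / \<delta>"
  using nn_integral_powr[OF assms] assms
  by (auto intro!: integrableI_nn_integral_finite simp: integral_eq_nn_integral)

lemma kernel_const_pos: "0 < \<delta> \<Longrightarrow> 0 < kernel_const \<delta>"
  by (simp add: kernel_const_def add_pos_pos)

text \<open>The case \<open>l = 1\<close> of the weighted estimate; the weight is at least \<open>e\<^sup>-\<^sup>1\<close> for times up to one.\<close>

lemma integrable_kernel: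
  assumes d: "0 < \<delta>" "\<delta> \<le> 1" and t: "0 < t" "t \<le> 1"
  shows "integrable lborel (\<lambda>s. (t - s) powr (\<delta> - 1) * s powr (\<delta> - 1) * indicator {0<..<t} s)" (is ?I)
    and "(\<integral>s. (t - s) powr (\<delta> - 1) * s powr (\<delta> - 1) * indicator {0<..<t} s \<partial>lborel)
      \<le> exp 1 * kernel_const \<delta> * t powr (\<delta> - 1)" (is ?B)
proof -
  let ?k = "\<lambda>s. (t - s) powr (\<delta> - 1) * s powr (\<delta> - 1) * indicator {0<..<t} s"
  have b: "(\<integral>\<^sup>+s. ennreal (?k s) \<partial>lborel) \<le> ennreal (exp 1 * kernel_const \<delta> * t powr (\<delta> - 1))"
  proof -
    have "(\<integral>\<^sup>+s. ennreal (?k s) \<partial>lborel) \<le> (\<integral>\<^sup>+s. ennreal (exp 1) * ennreal (exp (- 1 * (t - s)) *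
        ((t - s) powr (\<delta> - 1) * s powr (\<delta> - 1)) * indicator {0<..<t} s) \<partial>lborel)"
    proof (rule nn_integral_mono)
      fix s :: real
      have "?k s \<le> exp 1 * (exp (- 1 * (t - s)) * ((t - s) powr (\<delta> - 1) * s powr (\<delta> - 1)) * indicator {0<..<t} s)"
      proof (cases "s \<in> {0<..<t}")
        case True
        then have "1 \<le> exp 1 * exp (- 1 * (t - s))"
          using t by (simp flip: exp_add)
        from mult_right_mono[OF this, of "(t - s) powr (\<delta> - 1) * s powr (\<delta> - 1)"] True
        show ?thesis by (simp add: mult.assoc)
      qed simp
      then show "ennreal (?k s) \<le> ennreal (exp 1) * ennreal (exp (- 1 * (t - s)) *
        ((t - s) powr (\<delta> - 1) * s powr (\<delta> - 1)) * indicator {0<..<t} s)"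
        by (simp add: ennreal_leI flip: ennreal_mult')
    qed
    also have "\<dots> = ennreal (exp 1) * (\<integral>\<^sup>+s. ennreal (exp (- 1 * (t - s)) *
        ((t - s) powr (\<delta> - 1) * s powr (\<delta> - 1)) * indicator {0<..<t} s) \<partial>lborel)"
      by (rule nn_integral_cmult) measurable
    also have "\<dots> \<le> ennreal (exp 1) * ennreal (kernel_const \<delta> * 1 powr (- \<delta>) * t powr (\<delta> - 1))"
      by (intro mult_left_mono kernel_convolution d t) auto
    also have "\<dots> = ennreal (exp 1 * kernel_const \<delta> * t powr (\<delta> - 1))"
      by (simp add: mult.assoc flip: ennreal_mult')
    finally show ?thesis .
  qed
  show ?I
    using b by (intro integrableI_bounded) (auto intro: le_less_trans)
  then have "ennreal (\<integral>s. ?k s \<partial>lborel) = (\<integral>\<^sup>+s. ennreal (?k s) \<partial>lborel)"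
    by (intro nn_integral_eq_integral[symmetric]) auto
  with b have "ennreal (\<integral>s. ?k s \<partial>lborel) \<le> ennreal (exp 1 * kernel_const \<delta> * t powr (\<delta> - 1))"
    by simp
  then show ?B using kernel_const_pos[OF d(1)] by (subst (asm) ennreal_le_iff) auto
qed

section \<open>Bochner integrals of bounded Borel functions\<close>

lemma bounded_linear_bb_fun: "bounded_linear (\<lambda>f. bb_fun f x)"
  by (rule bounded_linear_intro[where K = 1])
    (simp_all add: plus_bborel.rep_eq scaleR_bborel.rep_eq abs_bb_fun_le_norm)

lemmas bb_fun_simps = plus_bborel.rep_eq minus_bborel.rep_eq scaleR_bborel.rep_eq
  uminus_bborel.rep_eq zero_bborel.rep_eq

lemma bb_fun_Bochner_integral:
  assumes "Bochner_integrable M F"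
  shows "integrable M (\<lambda>s. bb_fun (F s) x)"
    "bb_fun (Bochner_integral M F) x = (\<integral>s. bb_fun (F s) x \<partial>M)"
  using Bochner_integral_functional[OF assms bounded_linear_bb_fun] by auto

lemma Bochner_integral_bborel_diff:
  fixes F G :: "'a \<Rightarrow> 'b::topological_space bborel"
  assumes "Bochner_integrable M F" "Bochner_integrable M G"
  shows "Bochner_integral M (\<lambda>s. F s - G s) = Bochner_integral M F - Bochner_integral M G"
  using assms by (intro bborel_eqI)
    (simp add: bb_fun_Bochner_integral Bochner_integrable_diff minus_bborel.rep_eq)

lemma Bochner_integral_dominated_convergence:
  fixes F :: "nat \<Rightarrow> 'a \<Rightarrow> 'b::topological_space bborel"
  assumes F: "\<And>n. strongly_measurable M (F n)" and G: "strongly_measurable M G"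
    and w: "integrable M w"
    and bound: "\<And>n s. s \<in> space M \<Longrightarrow> norm (F n s) \<le> w s"
    and lim: "\<And>s. s \<in> space M \<Longrightarrow> (\<lambda>n. F n s) \<longlonglongrightarrow> G s"
  shows "(\<lambda>n. Bochner_integral M (F n)) \<longlonglongrightarrow> Bochner_integral M G"
proof -
  have Gw: "norm (G s) \<le> w s" if "s \<in> space M" for s
    by (rule LIMSEQ_le_const2[OF tendsto_norm[OF lim[OF that]]]) (use bound[OF that] in auto)
  have bF: "Bochner_integrable M (F n)" for n by (rule Bochner_integrableI[OF F w bound])
  have bG: "Bochner_integrable M G" by (rule Bochner_integrableI[OF G w Gw])
  have "(\<lambda>n. \<integral>s. norm (F n s - G s) \<partial>M) \<longlonglongrightarrow> (\<integral>s. 0 \<partial>M)"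
  proof (rule integral_dominated_convergence[where w = "\<lambda>s. 2 * w s"])
    show "AE s in M. (\<lambda>n. norm (F n s - G s)) \<longlonglongrightarrow> 0"
      using lim by (intro AE_I2) (simp add: LIM_zero tendsto_norm_zero)
    show "AE s in M. norm (norm (F n s - G s)) \<le> 2 * w s" for n
    proof (rule AE_I2)
      fix s assume s: "s \<in> space M"
      show "norm (norm (F n s - G s)) \<le> 2 * w s"
        using norm_triangle_ineq4[of "F n s" "G s"] bound[OF s, of n] Gw[OF s] by simp
    qed
    show "(\<lambda>s. norm (F n s - G s)) \<in> borel_measurable M" for n
      by (intro strongly_measurable_norm strongly_measurable_diff F G)
  qed (use w in auto)
  then have l: "(\<lambda>n. \<integral>s. norm (F n s - G s) \<partial>M) \<longlonglongrightarrow> 0" by simp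
  have "norm (Bochner_integral M (F n) - Bochner_integral M G) \<le> (\<integral>s. norm (F n s - G s) \<partial>M)" for n
    using norm_Bochner_integral_le[OF Bochner_integrable_diff[OF bF bG]]
    by (simp add: Bochner_integral_bborel_diff bF bG)
  then have "(\<lambda>n. Bochner_integral M (F n) - Bochner_integral M G) \<longlonglongrightarrow> 0"
    by (intro Lim_null_comparison[OF _ l]) auto
  then show ?thesis by (simp add: LIM_zero_iff)
qed

lemma strongly_measurable_compose:
  assumes f: "strongly_measurable N f" and g: "g \<in> measurable M N"
  shows "strongly_measurable M (\<lambda>x. f (g x))"
proof -
  obtain s where s: "\<And>i. simple_function N (s i)" "\<And>x. x \<in> space N \<Longrightarrow> (\<lambda>i. s i x) \<longlonglongrightarrow> f x"
    using f unfolding strongly_measurable_def by metis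
  have "simple_function M (\<lambda>x. s i (g x))" for i
  proof -
    have "finite (s i ` space N)" "s i \<in> measurable N (count_space UNIV)"
      using s(1)[of i] by (auto simp: simple_function_def intro: measurable_simple_function s)
    moreover have "(\<lambda>x. s i (g x)) ` space M \<subseteq> s i ` space N"
      using measurable_space[OF g] by auto
    ultimately show ?thesis
      using measurable_compose[OF g, of "s i" "count_space UNIV"]
      by (auto simp: simple_function_eq_measurable intro: finite_subset)
  qed
  then show ?thesis
    unfolding strongly_measurable_def using s(2) measurable_space[OF g]
    by (intro exI[of _ "\<lambda>i x. s i (g x)"]) auto
qed

lemma strongly_measurable_continuous:
  fixes W :: "real \<Rightarrow> 'b::real_normed_vector"
  assumes W: "continuous_on {0<..1} W" and S: "S \<in> sets borel" "S \<subseteq> {0<..1}"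
  shows "strongly_measurable lborel (\<lambda>s. indicator S s *\<^sub>R W s)"
proof -
  have "continuous_on ({0<..1} \<times> UNIV) (\<lambda>p::real \<times> real. W (fst p))"
    by (rule continuous_on_compose2[OF W]) (auto intro: continuous_intros)
  then show ?thesis
    using strongly_measurable_time_family[of "\<lambda>s. s" lborel "\<lambda>_. 0::real" "\<lambda>u _. W u" S] S by (auto simp: subset_iff)
qed

text \<open>Substituting \<open>s = t v\<close> moves the dependence on \<open>t\<close> from the domain of integration, and from the position
of the singularity at \<open>s = t\<close>, into the integrand.\<close>

lemma Bochner_integral_scale:
  fixes F :: "real \<Rightarrow> 'b::topological_space bborel"
  assumes t: "0 < t" and F: "Bochner_integrable lborel (\<lambda>s. indicator {0<..<t} s *\<^sub>R F s)"
    and G: "Bochner_integrable lborel (\<lambda>v. indicator {0<..<1} v *\<^sub>R (t *\<^sub>R F (t * v)))"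
  shows "set_Bochner_integral lborel {0<..<t} F = set_Bochner_integral lborel {0<..<1} (\<lambda>v. t *\<^sub>R F (t * v))"
proof (rule bborel_eqI)
  fix x
  have "bb_fun (set_Bochner_integral lborel {0<..<t} F) x
      = (\<integral>s. bb_fun (indicator {0<..<t} s *\<^sub>R F s) x \<partial>lborel)"
    unfolding set_Bochner_integral_def by (rule bb_fun_Bochner_integral[OF F])
  also have "\<dots> = \<bar>t\<bar> *\<^sub>R (\<integral>v. bb_fun (indicator {0<..<t} (0 + t * v) *\<^sub>R F (0 + t * v)) x \<partial>lborel)"
    using t by (intro lborel_integral_real_affine) auto
  also have "\<dots> = (\<integral>v. bb_fun (indicator {0<..<1} v *\<^sub>R (t *\<^sub>R F (t * v))) x \<partial>lborel)"
    unfolding integral_scaleR_right[symmetric]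
    using t by (intro Bochner_Integration.integral_cong refl)
      (auto simp: bb_fun_simps indicator_def zero_less_mult_iff split: if_splits)
  also have "\<dots> = bb_fun (set_Bochner_integral lborel {0<..<1} (\<lambda>v. t *\<^sub>R F (t * v))) x"
    unfolding set_Bochner_integral_def by (rule bb_fun_Bochner_integral(2)[OF G, symmetric])
  finally show "bb_fun (set_Bochner_integral lborel {0<..<t} F) x
    = bb_fun (set_Bochner_integral lborel {0<..<1} (\<lambda>v. t *\<^sub>R F (t * v))) x" .
qed

text \<open>Dominated convergence is not directly applicable to an integral over \<open>(0, t)\<close> whose integrand is singular at the moving
endpoint. After the substitution \<open>s = t v\<close> a single integrable majorant \<open>k\<close> serves locally all parameters. The first
component of the parameter is the time \<open>t\<close>.\<close>

lemma continuous_on_set_Bochner_integral: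
  fixes F :: "real \<Rightarrow> real \<times> real \<Rightarrow> 'b::topological_space bborel"
  assumes R: "\<And>p. p \<in> R \<Longrightarrow> 0 < fst p"
    and F: "\<And>p. p \<in> R \<Longrightarrow> Bochner_integrable lborel (\<lambda>s. indicator {0<..<fst p} s *\<^sub>R F s p)"
    and cont: "\<And>v. 0 < v \<Longrightarrow> v < 1 \<Longrightarrow> continuous_on R (\<lambda>p. F (fst p * v) p)"
    and b: "continuous_on R b" and k: "integrable lborel (\<lambda>v. k v * indicator {0<..<1} v)"
    and bound: "\<And>p v. p \<in> R \<Longrightarrow> 0 < v \<Longrightarrow> v < 1 \<Longrightarrow> norm (fst p *\<^sub>R F (fst p * v) p) \<le> b p * k v"
  shows "continuous_on R (\<lambda>p. set_Bochner_integral lborel {0<..<fst p} (\<lambda>s. F s p))"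
proof -
  \<comment> \<open>\<open>H p\<close> is the integrand after the substitution \<open>s = fst p * v\<close>.\<close>
  define H where "H p v = indicat_real {0<..<1} v *\<^sub>R (fst p *\<^sub>R F (fst p * v) p)" for p v
  have sm: "strongly_measurable lborel (H p)" if p: "p \<in> R" for p
  proof -
    have "strongly_measurable lborel (\<lambda>v. indicat_real {0<..<fst p} (fst p * v) *\<^sub>R F (fst p * v) p)"
      using F[OF p] by (intro strongly_measurable_compose[where g = "\<lambda>v. fst p * v" and N = lborel])
        (auto simp: Bochner_integrable_def)
    then have "strongly_measurable lborel (\<lambda>v. fst p *\<^sub>R (indicat_real {0<..<fst p} (fst p * v) *\<^sub>R F (fst p * v) p))"
      by (rule strongly_measurable_scaleR[OF borel_measurable_const])
    also have "(\<lambda>v. fst p *\<^sub>R (indicat_real {0<..<fst p} (fst p * v) *\<^sub>R F (fst p * v) p)) = H p"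
      using R[OF p] by (auto simp: H_def indicator_def zero_less_mult_iff)
    finally show ?thesis .
  qed
  have bH: "norm (H p v) \<le> b p * (k v * indicator {0<..<1} v)" if "p \<in> R" for p v
    using bound[OF that, of v] by (auto simp: H_def indicator_def)
  have HI: "Bochner_integrable lborel (H p)" if "p \<in> R" for p
    using k by (intro Bochner_integrableI[OF sm[OF that] _ bH[OF that]]) auto
  have eq: "set_Bochner_integral lborel {0<..<fst p} (\<lambda>s. F s p) = Bochner_integral lborel (H p)"
    if p: "p \<in> R" for p
    using Bochner_integral_scale[OF R[OF p] F[OF p]] HI[OF p]
    by (simp add: set_Bochner_integral_def H_def[abs_def])
  have "continuous_on R (\<lambda>p. Bochner_integral lborel (H p))"
    unfolding continuous_on_sequentially
  proof (intro allI ballI impI)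
    fix X p assume p: "p \<in> R" and "(\<forall>n. X n \<in> R) \<and> X \<longlonglongrightarrow> p"
    then have X: "\<And>n. X n \<in> R" "X \<longlonglongrightarrow> p" by auto
    have "(\<lambda>n. b (X n)) \<longlonglongrightarrow> b p"
      using continuous_on_tendsto_compose[OF b X(2) p] X by simp
    then obtain B where B: "\<And>n. \<bar>b (X n)\<bar> \<le> B"
      using convergent_imp_Bseq[OF convergentI] by (metis BseqD real_norm_def)
    have "(\<lambda>n. Bochner_integral lborel (H (X n))) \<longlonglongrightarrow> Bochner_integral lborel (H p)"
    proof (rule Bochner_integral_dominated_convergence)
      show "integrable lborel (\<lambda>v. B * norm (k v * indicator {0<..<1} v))"
        using k by auto
      show "norm (H (X n) v) \<le> B * norm (k v * indicator {0<..<1} v)" for n v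
      proof -
        have "norm (H (X n) v) \<le> \<bar>b (X n) * (k v * indicator {0<..<1} v)\<bar>"
          using bH[OF X(1)[of n], of v] by linarith
        also have "\<dots> \<le> B * norm (k v * indicator {0<..<1} v)"
          using B[of n] by (subst abs_mult) (auto intro: mult_right_mono)
        finally show ?thesis .
      qed
      show "(\<lambda>n. H (X n) v) \<longlonglongrightarrow> H p v" for v
      proof (cases "v \<in> {0<..<1}")
        case True
        then have "continuous_on R (\<lambda>p. F (fst p * v) p)" by (intro cont) auto
        from continuous_on_tendsto_compose[OF this X(2) p]
        have "(\<lambda>n. F (fst (X n) * v) (X n)) \<longlonglongrightarrow> F (fst p * v) p" using X(1) by simp
        then show ?thesis unfolding H_def
          by (intro tendsto_scaleR tendsto_const tendsto_fst X(2))
      qed (simp add: H_def)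
    qed (use sm X p in auto)
    then show "((\<lambda>p. Bochner_integral lborel (H p)) \<circ> X) \<longlonglongrightarrow> Bochner_integral lborel (H p)"
      by (simp add: o_def)
  qed
  then show ?thesis by (rule continuous_on_eq) (simp add: eq)
qed

text \<open>The pairs \<open>(t, \<epsilon>)\<close> at which the regularized objects are considered; including \<open>\<epsilon> = 0\<close> turns the limit \<open>\<epsilon> \<rightarrow> 0\<close> into
a continuity statement.\<close>

section \<open>Convolution with a weakly singular operator family\<close>

definition time_region :: "(real \<times> real) set" where
  "time_region = {(t, e). 0 < t \<and> 0 \<le> e \<and> t + e \<le> 1}"

definition singular_curve :: "real \<Rightarrow> real \<Rightarrow> (real \<Rightarrow> 'b::real_normed_vector) \<Rightarrow> bool" where
  "singular_curve \<delta> C W \<longleftrightarrow> continuous_on {0<..1} W \<and> (\<forall>s\<in>{0<..1}. norm (W s) \<le> C * s powr (\<delta> - 1))"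

text \<open>Abstracts what the two given families have in common. Both are treated with the same singular bound,
since a bounded family satisfies it as well when \<open>\<delta> \<le> 1\<close>.\<close>

locale singular_family =
  fixes A :: "'a::topological_space op_family" and K \<delta> :: real
  assumes delta: "0 < \<delta>" "\<delta> \<le> 1" and K_nonneg: "0 \<le> K"
    and lin: "\<And>t. t \<in> {0<..1} \<Longrightarrow> linear (A t)"
    and bound: "\<And>t f. t \<in> {0<..1} \<Longrightarrow> norm (A t f) \<le> K * t powr (\<delta> - 1) * norm f"
    and cont: "\<And>f. continuous_on {0<..1} (\<lambda>t. A t f)"
begin

text \<open>Strong continuity together with the locally uniform bound of the operator norms.\<close>

lemma joint_continuous: "continuous_on ({0<..1} \<times> UNIV) (\<lambda>p. A (fst p) (snd p))"
  unfolding continuous_on_sequentially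
proof (intro allI ballI impI)
  fix X :: "nat \<Rightarrow> real \<times> 'a bborel" and p assume p: "p \<in> {0<..1} \<times> UNIV" and "(\<forall>n. X n \<in> {0<..1} \<times> UNIV) \<and> X \<longlonglongrightarrow> p"
  then have X: "\<And>n. fst (X n) \<in> {0<..1}" and l: "(\<lambda>n. fst (X n)) \<longlonglongrightarrow> fst p" "(\<lambda>n. snd (X n)) \<longlonglongrightarrow> snd p"
    by (auto simp: mem_Times_iff intro: tendsto_fst tendsto_snd)
  have p': "fst p \<in> {0<..1}" using p by auto
  have d: "A (fst (X n)) (snd (X n)) - A (fst (X n)) (snd p) = A (fst (X n)) (snd (X n) - snd p)" for n
    using linear_diff[OF lin[OF X]] by simp
  have "(\<lambda>n. A (fst (X n)) (snd (X n)) - A (fst (X n)) (snd p)) \<longlonglongrightarrow> 0"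
  proof (rule Lim_null_comparison)
    show "\<forall>\<^sub>F n in sequentially. norm (A (fst (X n)) (snd (X n)) - A (fst (X n)) (snd p))
      \<le> K * fst (X n) powr (\<delta> - 1) * norm (snd (X n) - snd p)"
      unfolding d using bound[OF X] by auto
    have "(\<lambda>n. K * fst (X n) powr (\<delta> - 1) * norm (snd (X n) - snd p)) \<longlonglongrightarrow> K * fst p powr (\<delta> - 1) * norm (snd p - snd p)"
      using p' by (intro tendsto_intros l) auto
    then show "(\<lambda>n. K * fst (X n) powr (\<delta> - 1) * norm (snd (X n) - snd p)) \<longlonglongrightarrow> 0" by simp
  qed
  moreover have "(\<lambda>n. A (fst (X n)) (snd p)) \<longlonglongrightarrow> A (fst p) (snd p)"
    using continuous_on_tendsto_compose[OF cont l(1) p'] X by simp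
  ultimately have "(\<lambda>n. (A (fst (X n)) (snd (X n)) - A (fst (X n)) (snd p)) + A (fst (X n)) (snd p)) \<longlonglongrightarrow> 0 + A (fst p) (snd p)"
    by (rule tendsto_add)
  then show "((\<lambda>p. A (fst p) (snd p)) \<circ> X) \<longlonglongrightarrow> A (fst p) (snd p)" by (simp add: o_def)
qed

lemma bounded_linear_family: "t \<in> {0<..1} \<Longrightarrow> bounded_linear (A t)"
  using bound[of t]
  by (intro bounded_linear_intro[where K = "K * t powr (\<delta> - 1)"])
    (simp_all add: linear_add[OF lin] linear_scale[OF lin] mult.commute)

definition conv :: "(real \<Rightarrow> 'a bborel) \<Rightarrow> real \<Rightarrow> real \<Rightarrow> 'a bborel" where
  "conv W t e = set_Bochner_integral lborel {0<..<t} (\<lambda>s. A (t - s + e) (W s))"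

context
  fixes C :: real and W :: "real \<Rightarrow> 'a bborel"
  assumes W: "singular_curve \<delta> C W"
begin

lemma singular_const_nonneg: "0 \<le> C"
proof -
  have "norm (W 1) \<le> C"
    using bspec[OF conjunct2[OF W[unfolded singular_curve_def]], of 1] by simp
  then show ?thesis using order_trans[OF norm_ge_zero] by blast
qed

text \<open>The shift \<open>e\<close> only helps, because the bound of the operator norms decreases in time.\<close>

lemma conv_integrand_bound:
  assumes te: "(t, e) \<in> time_region" and s: "0 < s" "s < t"
  shows "norm (A (t - s + e) (W s)) \<le> K * C * ((t - s) powr (\<delta> - 1) * s powr (\<delta> - 1))"
proof -
  have "norm (A (t - s + e) (W s)) \<le> K * (t - s + e) powr (\<delta> - 1) * norm (W s)"
    using te s by (intro bound) (auto simp: time_region_def)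
  also have "\<dots> \<le> K * (t - s) powr (\<delta> - 1) * (C * s powr (\<delta> - 1))"
  proof (intro mult_mono)
    show "(t - s + e) powr (\<delta> - 1) \<le> (t - s) powr (\<delta> - 1)"
      using te s delta by (intro powr_mono2') (auto simp: time_region_def)
    show "norm (W s) \<le> C * s powr (\<delta> - 1)"
      using W s te unfolding singular_curve_def time_region_def by auto
  qed (use K_nonneg singular_const_nonneg in auto)
  finally show ?thesis by (simp add: mult_ac)
qed

lemma conv_integrand_norm_le:
  assumes te: "(t, e) \<in> time_region"
  shows "norm (indicat_real {0<..<t} s *\<^sub>R A (t - s + e) (W s))
    \<le> K * C * ((t - s) powr (\<delta> - 1) * s powr (\<delta> - 1) * indicator {0<..<t} s)"
  using conv_integrand_bound[OF te, of s] by (auto simp: indicator_def)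

lemma conv_integrable:
  assumes te: "(t, e) \<in> time_region"
  shows "Bochner_integrable lborel (\<lambda>s. indicat_real {0<..<t} s *\<^sub>R A (t - s + e) (W s))"
proof (rule Bochner_integrableI[OF _ _ conv_integrand_norm_le[OF te]])
  have Wm: "strongly_measurable lborel (\<lambda>s. indicat_real {0<..<t} s *\<^sub>R W s)"
    using W te by (intro strongly_measurable_continuous) (auto simp: singular_curve_def time_region_def)
  have "strongly_measurable lborel (\<lambda>s. indicat_real {0<..<t} s *\<^sub>R A (t - s + e) (indicat_real {0<..<t} s *\<^sub>R W s))"
    using te by (intro strongly_measurable_time_family Wm joint_continuous) (auto simp: time_region_def)
  also have "(\<lambda>s. indicat_real {0<..<t} s *\<^sub>R A (t - s + e) (indicat_real {0<..<t} s *\<^sub>R W s))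
     = (\<lambda>s. indicat_real {0<..<t} s *\<^sub>R A (t - s + e) (W s))"
    by (auto simp: indicator_def)
  finally show "strongly_measurable lborel (\<lambda>s. indicat_real {0<..<t} s *\<^sub>R A (t - s + e) (W s))" .
  show "integrable lborel (\<lambda>s. K * C * ((t - s) powr (\<delta> - 1) * s powr (\<delta> - 1) * indicator {0<..<t} s))"
    using te by (intro integrable_mult_right integrable_kernel delta) (auto simp: time_region_def)
qed

lemma bb_fun_conv:
  assumes te: "(t, e) \<in> time_region"
  shows "set_integrable lborel {0<..<t} (\<lambda>s. bb_fun (A (t - s + e) (W s)) x)"
    "bb_fun (conv W t e) x = (LBINT s:{0<..<t}. bb_fun (A (t - s + e) (W s)) x)"
  using bb_fun_Bochner_integral[OF conv_integrable[OF te], of x]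
  by (auto simp: conv_def set_Bochner_integral_def set_integrable_def set_lebesgue_integral_def bb_fun_simps)

text \<open>Convolution preserves the order \<open>t\<^sup>\<delta>\<^sup>-\<^sup>1\<close> of the singularity at time zero, so it can be iterated.\<close>

lemma norm_conv_le:
  assumes te: "(t, e) \<in> time_region"
  shows "norm (conv W t e) \<le> K * C * (exp 1 * kernel_const \<delta>) * t powr (\<delta> - 1)"
proof -
  have t: "0 < t" "t \<le> 1" using te by (auto simp: time_region_def)
  have "norm (conv W t e) \<le> (\<integral>s. norm (indicat_real {0<..<t} s *\<^sub>R A (t - s + e) (W s)) \<partial>lborel)"
    unfolding conv_def set_Bochner_integral_def by (rule norm_Bochner_integral_le[OF conv_integrable[OF te]])
  also have "\<dots> \<le> (\<integral>s. K * C * ((t - s) powr (\<delta> - 1) * s powr (\<delta> - 1) * indicator {0<..<t} s) \<partial>lborel)"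
    using conv_integrand_norm_le[OF te] integrable_kernel[OF delta t]
    by (intro integral_mono Bochner_integrable_norm conv_integrable[OF te]) auto
  also have "\<dots> \<le> K * C * (exp 1 * kernel_const \<delta> * t powr (\<delta> - 1))"
    using integrable_kernel(2)[OF delta t] K_nonneg singular_const_nonneg by (simp add: mult_left_mono)
  finally show ?thesis by (simp add: mult.assoc)
qed

lemma continuous_on_conv: "continuous_on time_region (\<lambda>p. conv W (fst p) (snd p))"
  unfolding conv_def
proof (rule continuous_on_set_Bochner_integral[where
      b = "\<lambda>p. K * C * (fst p * (fst p powr (\<delta> - 1) * fst p powr (\<delta> - 1)))"
      and k = "\<lambda>v. (1 - v) powr (\<delta> - 1) * v powr (\<delta> - 1)"])
  fix p assume p: "p \<in> time_region"
  then show p0: "0 < fst p" by (auto simp: time_region_def)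
  have p': "(fst p, snd p) \<in> time_region" using p by simp
  show "Bochner_integrable lborel (\<lambda>s. indicator {0<..<fst p} s *\<^sub>R A (fst p - s + snd p) (W s))"
    by (rule conv_integrable[OF p'])
  fix v :: real assume v: "0 < v" "v < 1"
  have "norm (fst p *\<^sub>R A (fst p - fst p * v + snd p) (W (fst p * v)))
     = fst p * norm (A (fst p - fst p * v + snd p) (W (fst p * v)))" using p0 by simp
  also have "\<dots> \<le> fst p * (K * C * ((fst p - fst p * v) powr (\<delta> - 1) * (fst p * v) powr (\<delta> - 1)))"
    using p0 v by (intro mult_left_mono conv_integrand_bound p') auto
  also have "(fst p - fst p * v) powr (\<delta> - 1) = fst p powr (\<delta> - 1) * (1 - v) powr (\<delta> - 1)"
    using p0 v by (subst powr_mult[symmetric]) (auto simp: algebra_simps)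
  finally show "norm (fst p *\<^sub>R A (fst p - fst p * v + snd p) (W (fst p * v)))
    \<le> K * C * (fst p * (fst p powr (\<delta> - 1) * fst p powr (\<delta> - 1))) * ((1 - v) powr (\<delta> - 1) * v powr (\<delta> - 1))"
    using p0 v by (simp add: powr_mult mult_ac)
next
  fix v :: real assume v: "0 < v" "v < 1"
  have r: "fst p * v \<in> {0<..1}" "fst p - fst p * v + snd p \<in> {0<..1}" if "p \<in> time_region" for p
  proof -
    have *: "0 < fst p" "0 \<le> snd p" "fst p + snd p \<le> 1" using that by (auto simp: time_region_def)
    have "0 < fst p * v" "fst p * v < fst p" using * v by simp_all
    with * have "0 < fst p * v \<and> fst p * v \<le> 1" "0 < fst p - fst p * v + snd p \<and> fst p - fst p * v + snd p \<le> 1"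
      by linarith+
    then show "fst p * v \<in> {0<..1}" "fst p - fst p * v + snd p \<in> {0<..1}" by simp_all
  qed
  have "continuous_on time_region (\<lambda>p. W (fst p * v))"
  proof (rule continuous_on_compose2[of "{0<..1}" W])
    show "continuous_on {0<..1} W" using W by (simp add: singular_curve_def)
    show "continuous_on time_region (\<lambda>p. fst p * v)" by (intro continuous_intros)
    show "(\<lambda>p. fst p * v) ` time_region \<subseteq> {0<..1}" using r(1) by blast
  qed
  then have "continuous_on time_region (\<lambda>p. (fst p - fst p * v + snd p, W (fst p * v)))"
    by (intro continuous_intros)
  from continuous_on_compose2[OF joint_continuous this]
  show "continuous_on time_region (\<lambda>p. A (fst p - fst p * v + snd p) (W (fst p * v)))"
    using r(2) by (simp add: image_subset_iff mem_Times_iff)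
next
  show "continuous_on time_region (\<lambda>p. K * C * (fst p * (fst p powr (\<delta> - 1) * fst p powr (\<delta> - 1))))"
    by (intro continuous_intros) (auto simp: time_region_def)
  show "integrable lborel (\<lambda>v. (1 - v) powr (\<delta> - 1) * v powr (\<delta> - 1) * indicator {0<..<1} v)"
    using integrable_kernel(1)[OF delta, of 1] by simp
qed

end

lemma singular_curve_family: "singular_curve \<delta> (K * norm f) (\<lambda>t. A t f)"
  using cont bound by (auto simp: singular_curve_def mult_ac)

lemma singular_curve_conv:
  assumes W: "singular_curve \<delta> C W"
  shows "singular_curve \<delta> (K * C * (exp 1 * kernel_const \<delta>)) (\<lambda>t. conv W t 0)"
proof -
  have "continuous_on {0<..1} (\<lambda>t::real. (t, 0::real))" by (intro continuous_intros)
  from continuous_on_compose2[OF continuous_on_conv[OF W] this]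
  have "continuous_on {0<..1} (\<lambda>t. conv W t 0)" by (simp add: time_region_def image_subset_iff)
  then show ?thesis using norm_conv_le[OF W]
    by (auto simp: singular_curve_def time_region_def)
qed

end

text \<open>The time simplex in recursive form, by its last coordinate; at \<open>n = 0\<close> it requires \<open>t\<close> to be positive.\<close>

section \<open>The parametrix series and its Volterra equation\<close>

primrec ordered_times :: "nat \<Rightarrow> real \<Rightarrow> (nat \<Rightarrow> real) \<Rightarrow> bool" where
  "ordered_times 0 t s \<longleftrightarrow> 0 < t"
| "ordered_times (Suc n) t s \<longleftrightarrow> s (Suc n) < t \<and> ordered_times n (s (Suc n)) s"

lemma ordered_times_pos: "ordered_times n t s \<Longrightarrow> 0 < t"
  by (induction n arbitrary: t) force+

lemma ordered_times_iff: "ordered_times (Suc n) t s \<longleftrightarrow> s \<in> time_simplex (Suc n) t"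
proof (induction n arbitrary: t)
  case (Suc n)
  have "{1..<Suc (Suc n)} = insert (Suc n) {1..<Suc n}" by auto
  then show ?case
    using Suc.IH[of "s (Suc (Suc n))"] by (auto simp: time_simplex_def)
qed (auto simp: time_simplex_def)

lemma singular_curve_cong:
  assumes "\<And>t. t \<in> {0<..1} \<Longrightarrow> W t = V t"
  shows "singular_curve \<delta> C W \<longleftrightarrow> singular_curve \<delta> C V"
  using continuous_on_cong[OF refl, of "{0<..1}" W V] assms unfolding singular_curve_def by auto

lemma singular_curve_add:
  assumes "singular_curve \<delta> C W" "singular_curve \<delta> D V"
  shows "singular_curve \<delta> (C + D) (\<lambda>t. W t + V t)"
  using assms unfolding singular_curve_def
  by (auto intro!: continuous_intros simp: distrib_right intro: order_trans[OF norm_triangle_ineq add_mono])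

text \<open>The product over no factors is a one-point probability space.\<close>

lemma measure_PiM_empty: "measure (PiM {} M) (space (PiM {} M)) = 1"
  by (simp add: measure_def space_PiM)

context singular_family
begin

text \<open>The integrand of the \<open>n\<close>-th simplex integral, cut off to the ordered times and written recursively in the
last time variable. The indicators keep every operator at a time in \<open>(0, 1]\<close>, where the hypotheses apply.\<close>

primrec simplex_integrand :: "'a bborel \<Rightarrow> nat \<Rightarrow> real \<Rightarrow> (nat \<Rightarrow> real) \<Rightarrow> 'a bborel" where
  "simplex_integrand f 0 t s = indicat_real {0<..1} t *\<^sub>R A t f"
| "simplex_integrand f (Suc n) t s = indicat_real {y. 0 < y \<and> y < t \<and> t \<le> 1} (s (Suc n)) *\<^sub>R
     A (t - s (Suc n)) (simplex_integrand f n (s (Suc n)) s)"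

lemma simplex_integrand_eq:
  assumes "t \<le> 1"
  shows "simplex_integrand f n t s =
    (if ordered_times n t s then A (t - (if n = 0 then 0 else s n)) (Q_chain A s n f) else 0)"
  using assms
proof (induction n arbitrary: t)
  case (Suc n)
  show ?case
  proof (cases "0 < s (Suc n) \<and> s (Suc n) < t")
    case True
    then show ?thesis using Suc.IH[of "s (Suc n)"] Suc.prems linear_0[OF lin[of "t - s (Suc n)"]]
      by auto
  next
    case False
    then show ?thesis using ordered_times_pos[of n "s (Suc n)" s] by auto
  qed
qed (auto simp: indicator_def)

lemma simplex_integrand_cong: "(\<And>i. i \<in> {1..n} \<Longrightarrow> s i = s' i) \<Longrightarrow> simplex_integrand f n t s = simplex_integrand f n t s'"
  by (induction n arbitrary: t) simp_all

text \<open>Stated for an arbitrary measure space and a variable terminal time \<open>u\<close>, because the induction replaces the terminal time by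
the next smaller time variable.\<close>

lemma strongly_measurable_simplex_integrand:
  assumes "u \<in> borel_measurable M" "\<And>i. i \<in> {1..n} \<Longrightarrow> (\<lambda>w. \<sigma> w i) \<in> borel_measurable M"
  shows "strongly_measurable M (\<lambda>w. simplex_integrand f n (u w) (\<sigma> w))"
  using assms
proof (induction n arbitrary: u)
  case 0
  then have [measurable]: "u \<in> borel_measurable M" by simp
  have "strongly_measurable M (\<lambda>w. indicat_real {w. u w \<in> {0<..1}} w *\<^sub>R A (u w) f)"
    by (rule strongly_measurable_time_family[OF _ _ joint_continuous]) auto
  then show ?case by (simp add: indicator_def)
next
  case (Suc n)
  have m [measurable]: "(\<lambda>w. \<sigma> w (Suc n)) \<in> borel_measurable M" "u \<in> borel_measurable M"
    using Suc.prems by auto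
  have "strongly_measurable M (\<lambda>w. simplex_integrand f n (\<sigma> w (Suc n)) (\<sigma> w))"
    using Suc.prems by (intro Suc.IH m) auto
  then have "strongly_measurable M (\<lambda>w. indicat_real {w. 0 < \<sigma> w (Suc n) \<and> \<sigma> w (Suc n) < u w \<and> u w \<le> 1} w *\<^sub>R
      A (u w - \<sigma> w (Suc n)) (simplex_integrand f n (\<sigma> w (Suc n)) (\<sigma> w)))"
    by (intro strongly_measurable_time_family[OF _ _ joint_continuous]) auto
  then show ?case by (simp add: indicator_def)
qed

abbreviation "cube n \<equiv> PiM {1..n} (\<lambda>_::nat. lborel :: real measure)"

lemma strongly_measurable_simplex_integrand_cube: "strongly_measurable (cube n) (simplex_integrand f n t)"
  using strongly_measurable_simplex_integrand[of "\<lambda>_. t" "cube n" n "\<lambda>s. s" f] by simp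

text \<open>Rates of the exponential weight for which convolution with the bound of the family at least halves \<open>t\<^sup>\<delta>\<^sup>-\<^sup>1\<close>.\<close>

definition halving_rate :: "real \<Rightarrow> bool" where
  "halving_rate l \<longleftrightarrow> 0 < l \<and> K * (kernel_const \<delta> * l powr (- \<delta>)) \<le> 1/2"

lemma halving_rate_exists: "\<exists>l. halving_rate l"
  using kernel_halving_rate_exists[OF delta(1), of K] by (auto simp: halving_rate_def)

lemma simplex_integrand_Suc_upd:
  "simplex_integrand f (Suc n) t (s(Suc n := y)) = indicat_real {y. 0 < y \<and> y < t \<and> t \<le> 1} y *\<^sub>R A (t - y) (simplex_integrand f n y s)"
  using simplex_integrand_cong[of n "s(Suc n := y)" s f y] by simp

text \<open>By Tonelli the integral over the last time is outermost, so the induction hypothesis bounds the inner integral.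
What remains is the weighted kernel convolution, and the choice of \<open>l\<close> makes each step gain
a factor one half.\<close>

lemma nn_integral_simplex_integrand_le:
  assumes l: "halving_rate l" and t: "t \<in> {0<..1}"
  shows "(\<integral>\<^sup>+s. norm (simplex_integrand f n t s) \<partial>cube n) \<le> ennreal (K * norm f * (1/2)^n * exp (l * t) * t powr (\<delta> - 1))"
  using t
proof (induction n arbitrary: t)
  case 0
  have "norm (A t f) \<le> K * norm f * 1 * t powr (\<delta> - 1)"
    using bound[OF 0, of f] by (simp add: mult_ac)
  also have "\<dots> \<le> K * norm f * exp (l * t) * t powr (\<delta> - 1)"
    using 0 l K_nonneg by (intro mult_mono) (auto simp: halving_rate_def)
  finally show ?case using 0
    by (simp add: nn_integral_const space_PiM ennreal_leI)
next
  case (Suc n)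
  interpret product_sigma_finite "\<lambda>_::nat. lborel :: real measure" ..
  let ?c = "K * norm f * (1/2)^n"
  have c: "0 \<le> ?c" using K_nonneg by simp
  have e: "{1..Suc n} = insert (Suc n) {1..n}" by auto
  have "(\<integral>\<^sup>+s. norm (simplex_integrand f (Suc n) t s) \<partial>cube (Suc n))
      = (\<integral>\<^sup>+y. (\<integral>\<^sup>+s. norm (simplex_integrand f (Suc n) t (s(Suc n := y))) \<partial>cube n) \<partial>lborel)"
    unfolding e
    by (intro product_nn_integral_insert_rev measurable_compose[OF _ measurable_ennreal]
        strongly_measurable_norm[OF strongly_measurable_simplex_integrand_cube[of "Suc n" f t, unfolded e]]) auto
  also have "\<dots> \<le> (\<integral>\<^sup>+y. ennreal (K * ?c * exp (l * t)) * ennreal (exp (- l * (t - y)) * ((t - y) powr (\<delta> - 1) * y powr (\<delta> - 1)) * indicator {0<..<t} y) \<partial>lborel)"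
  proof (rule nn_integral_mono)
    fix y :: real
    show "(\<integral>\<^sup>+s. norm (simplex_integrand f (Suc n) t (s(Suc n := y))) \<partial>cube n) \<le> ennreal (K * ?c * exp (l * t)) * ennreal (exp (- l * (t - y)) * ((t - y) powr (\<delta> - 1) * y powr (\<delta> - 1)) * indicator {0<..<t} y)"
    proof (cases "0 < y \<and> y < t")
      case True
      then have y: "y \<in> {0<..1}" "t - y \<in> {0<..1}" using Suc.prems by auto
      have "(\<integral>\<^sup>+s. norm (simplex_integrand f (Suc n) t (s(Suc n := y))) \<partial>cube n)
          \<le> (\<integral>\<^sup>+s. ennreal (K * (t - y) powr (\<delta> - 1)) * ennreal (norm (simplex_integrand f n y s)) \<partial>cube n)"
        unfolding simplex_integrand_Suc_upd using True Suc.prems bound[OF y(2)] K_nonneg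
        by (intro nn_integral_mono) (simp add: ennreal_leI flip: ennreal_mult)
      also have "\<dots> = ennreal (K * (t - y) powr (\<delta> - 1)) * (\<integral>\<^sup>+s. norm (simplex_integrand f n y s) \<partial>cube n)"
        using strongly_measurable_norm[OF strongly_measurable_simplex_integrand_cube]
        by (intro nn_integral_cmult) auto
      also have "\<dots> \<le> ennreal (K * (t - y) powr (\<delta> - 1)) * ennreal (?c * exp (l * y) * y powr (\<delta> - 1))"
        by (intro mult_left_mono Suc.IH y) auto
      also have "\<dots> = ennreal (K * (t - y) powr (\<delta> - 1) * (?c * exp (l * y) * y powr (\<delta> - 1)))"
        using K_nonneg c by (simp flip: ennreal_mult)
      also have "exp (l * y) = exp (l * t) * exp (- l * (t - y))"
        by (simp add: algebra_simps flip: exp_add)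
      also have "K * (t - y) powr (\<delta> - 1) * (?c * (exp (l * t) * exp (- l * (t - y))) * y powr (\<delta> - 1))
        = K * ?c * exp (l * t) * (exp (- l * (t - y)) * ((t - y) powr (\<delta> - 1) * y powr (\<delta> - 1)) * indicator {0<..<t} y)"
        using True by (simp add: mult_ac)
      finally show ?thesis
        using K_nonneg c by (simp del: simplex_integrand.simps fun_upd_apply add: fun_upd_def flip: ennreal_mult)
    next
      case False
      have "(\<integral>\<^sup>+s. norm (simplex_integrand f (Suc n) t (s(Suc n := y))) \<partial>cube n) = (\<integral>\<^sup>+s. 0 \<partial>cube n)"
        unfolding simplex_integrand_Suc_upd using False by (intro nn_integral_cong) auto
      then show ?thesis by simp
    qed
  qed
  also have "\<dots> = ennreal (K * ?c * exp (l * t)) * (\<integral>\<^sup>+y. ennreal (exp (- l * (t - y)) * ((t - y) powr (\<delta> - 1) * y powr (\<delta> - 1)) * indicator {0<..<t} y) \<partial>lborel)"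
    by (rule nn_integral_cmult) measurable
  also have "\<dots> \<le> ennreal (K * ?c * exp (l * t)) * ennreal (kernel_const \<delta> * l powr (- \<delta>) * t powr (\<delta> - 1))"
    using l Suc.prems by (intro mult_left_mono kernel_convolution delta) (auto simp: halving_rate_def)
  also have "\<dots> = ennreal ((K * (kernel_const \<delta> * l powr (- \<delta>))) * (?c * exp (l * t) * t powr (\<delta> - 1)))"
    using K_nonneg c kernel_const_pos[OF delta(1)] by (simp add: mult_ac flip: ennreal_mult)
  also have "\<dots> \<le> ennreal ((1/2) * (?c * exp (l * t) * t powr (\<delta> - 1)))"
    using l c by (intro ennreal_leI mult_right_mono) (auto simp: halving_rate_def)
  finally show ?case by (simp add: mult_ac)
qed

definition iterate :: "'a bborel \<Rightarrow> nat \<Rightarrow> real \<Rightarrow> 'a bborel" where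
  "iterate f n t = Bochner_integral (cube n) (simplex_integrand f n t)"

lemma Bochner_integrable_simplex_integrand:
  assumes "t \<in> {0<..1}"
  shows "Bochner_integrable (cube n) (simplex_integrand f n t)"
proof -
  obtain l where l: "halving_rate l" using halving_rate_exists by blast
  show ?thesis
    using le_less_trans[OF nn_integral_simplex_integrand_le[OF l assms, of n f]] strongly_measurable_simplex_integrand_cube
    by (auto simp: Bochner_integrable_def)
qed

lemma norm_iterate_le:
  assumes l: "halving_rate l" and t: "t \<in> {0<..1}"
  shows "norm (iterate f n t) \<le> K * norm f * (1/2)^n * exp (l * t) * t powr (\<delta> - 1)"
proof -
  have "ennreal (norm (iterate f n t)) \<le> ennreal (\<integral>s. norm (simplex_integrand f n t s) \<partial>cube n)"
    unfolding iterate_def by (intro ennreal_leI norm_Bochner_integral_le Bochner_integrable_simplex_integrand t)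
  also have "\<dots> = (\<integral>\<^sup>+s. norm (simplex_integrand f n t s) \<partial>cube n)"
    by (intro nn_integral_eq_integral[symmetric] Bochner_integrable_norm Bochner_integrable_simplex_integrand t) auto
  also have "\<dots> \<le> ennreal (K * norm f * (1/2)^n * exp (l * t) * t powr (\<delta> - 1))"
    by (rule nn_integral_simplex_integrand_le[OF l t])
  finally show ?thesis using K_nonneg by (simp add: ennreal_le_iff)
qed

lemma iterate_0: "t \<in> {0<..1} \<Longrightarrow> iterate f 0 t = A t f"
  using bb_fun_Bochner_integral(2)[OF Bochner_integrable_simplex_integrand[of t 0 f]]
  by (intro bborel_eqI) (auto simp: iterate_def measure_PiM_empty)

lemma Q_iter_eq_iterate:
  assumes "t \<in> {0<..1}"
  shows "Q_iter A (Suc n) t f = iterate f (Suc n) t"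
proof -
  have "(\<lambda>s. indicat_real (time_simplex (Suc n) t) s *\<^sub>R A (t - s (Suc n)) (Q_chain A s (Suc n) f)) = simplex_integrand f (Suc n) t"
    using assms by (intro ext, subst simplex_integrand_eq)
      (auto simp: ordered_times_iff simp del: Q_chain.simps simplex_integrand.simps ordered_times.simps)
  then show ?thesis
    unfolding Q_iter_def set_Bochner_integral_def iterate_def by simp
qed

text \<open>The recursion \<open>Q\<^sup>n\<^sup>+\<^sup>1\<^sub>t = \<integral>\<^sub>0\<^sup>t Q0\<^sub>t\<^sub>-\<^sub>s Q\<^sup>n\<^sub>s ds\<close>. Evaluated at a point, it is Fubini for a real integrand: the operator applied
last, followed by evaluation, is a bounded linear functional and so commutes with the inner Bochner integral.
The hypothesis on \<open>iterate f n\<close> makes the right-hand side a convergent integral; it is discharged by induction afterwards.\<close>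

lemma iterate_Suc:
  assumes t: "t \<in> {0<..1}" and n: "singular_curve \<delta> C (iterate f n)"
  shows "iterate f (Suc n) t = conv (iterate f n) t 0"
proof (rule bborel_eqI)
  fix x
  interpret product_sigma_finite "\<lambda>_::nat. lborel :: real measure" ..
  have tr: "(t, 0) \<in> time_region" using t by (simp add: time_region_def)
  let ?g = "\<lambda>y. indicat_real {0<..<t} y *\<^sub>R bb_fun (A (t - y + 0) (iterate f n y)) x"
  have g: "?g \<in> borel_measurable lborel"
    using bb_fun_conv(1)[OF n tr, of x] unfolding set_integrable_def by (rule borel_measurable_integrable)
  have e: "{1..Suc n} = {Suc n} \<union> {1..n}" by auto
  have m: "simplex_integrand f (Suc n) t (merge {Suc n} {1..n} (z, s)) = indicat_real {y. 0 < y \<and> y < t \<and> t \<le> 1} (z (Suc n)) *\<^sub>R A (t - z (Suc n)) (simplex_integrand f n (z (Suc n)) s)" for z s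
    using simplex_integrand_cong[of n "merge {Suc n} {1..n} (z, s)" s f "z (Suc n)"]
    by (simp add: merge_def)
  have "bb_fun (iterate f (Suc n) t) x = (\<integral>s. bb_fun (simplex_integrand f (Suc n) t s) x \<partial>cube (Suc n))"
    unfolding iterate_def by (rule bb_fun_Bochner_integral[OF Bochner_integrable_simplex_integrand[OF t]])
  also have "\<dots> = (\<integral>z. (\<integral>s. bb_fun (simplex_integrand f (Suc n) t (merge {Suc n} {1..n} (z, s))) x \<partial>cube n) \<partial>PiM {Suc n} (\<lambda>_. lborel))"
    unfolding e
    by (intro product_integral_fold
        bb_fun_Bochner_integral(1)[OF Bochner_integrable_simplex_integrand[OF t, of "Suc n" f, unfolded e]]) auto
  also have "\<dots> = (\<integral>z. ?g (z (Suc n)) \<partial>PiM {Suc n} (\<lambda>_. lborel))"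
  proof (intro Bochner_Integration.integral_cong refl)
    fix z :: "nat \<Rightarrow> real"
    show "(\<integral>s. bb_fun (simplex_integrand f (Suc n) t (merge {Suc n} {1..n} (z, s))) x \<partial>cube n) = ?g (z (Suc n))"
    proof (cases "0 < z (Suc n) \<and> z (Suc n) < t")
      case True
      then have y: "z (Suc n) \<in> {0<..1}" "t - z (Suc n) \<in> {0<..1}" using t by auto
      have "bounded_linear (\<lambda>g. bb_fun (A (t - z (Suc n)) g) x)"
        using bounded_linear_compose[OF bounded_linear_bb_fun bounded_linear_family[OF y(2)]] .
      from Bochner_integral_functional(2)[OF Bochner_integrable_simplex_integrand[OF y(1), of n f] this]
      show ?thesis using True t unfolding m by (simp add: bb_fun_simps iterate_def)
    next
      case False
      then show ?thesis unfolding m by (auto simp: bb_fun_simps)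
    qed
  qed
  also have "\<dots> = (\<integral>y. ?g y \<partial>lborel)"
    by (rule product_integral_singleton[OF g])
  also have "\<dots> = bb_fun (conv (iterate f n) t 0) x"
    using bb_fun_conv(2)[OF n tr, of x] by (simp add: set_lebesgue_integral_def)
  finally show "bb_fun (iterate f (Suc n) t) x = bb_fun (conv (iterate f n) t 0) x" .
qed

lemma singular_curve_iterate:
  assumes l: "halving_rate l"
  shows "singular_curve \<delta> (K * norm f * exp l * (1/2)^n) (iterate f n)"
proof -
  have "\<exists>C. singular_curve \<delta> C (iterate f n)"
  proof (induction n)
    case 0
    show ?case using singular_curve_family[of f] iterate_0[of _ f]
      by (subst singular_curve_cong[where V = "\<lambda>t. A t f"]) auto
  next
    case (Suc n)
    then obtain C where C: "singular_curve \<delta> C (iterate f n)" by blast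
    show ?case using singular_curve_conv[OF C] iterate_Suc[OF _ C]
      by (subst singular_curve_cong[where V = "\<lambda>t. conv (iterate f n) t 0"]) auto
  qed
  moreover have "norm (iterate f n t) \<le> K * norm f * exp l * (1/2)^n * t powr (\<delta> - 1)"
    if t: "t \<in> {0<..1}" for t
  proof -
    have "norm (iterate f n t) \<le> K * norm f * (1/2)^n * exp (l * t) * t powr (\<delta> - 1)"
      by (rule norm_iterate_le[OF l t])
    also have "\<dots> \<le> K * norm f * (1/2)^n * exp l * t powr (\<delta> - 1)"
      using t l K_nonneg by (intro mult_right_mono mult_left_mono) (auto simp: halving_rate_def)
    finally show ?thesis by (simp add: mult_ac)
  qed
  ultimately show ?thesis by (auto simp: singular_curve_def)
qed

lemma iterate_Suc_conv: "t \<in> {0<..1} \<Longrightarrow> iterate f (Suc n) t = conv (iterate f n) t 0"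
  using iterate_Suc singular_curve_iterate halving_rate_exists by blast

lemma iterate_sums:
  assumes t: "t \<in> {0<..1}"
  shows "(\<lambda>n. iterate f n t) sums Q_sum A t f"
proof -
  obtain l where l: "halving_rate l" using halving_rate_exists by blast
  have "summable (\<lambda>n. K * norm f * exp l * (1/2)^n * t powr (\<delta> - 1))"
    by (intro summable_mult summable_mult2 summable_geometric) simp
  then have s: "summable (\<lambda>n. iterate f n t)"
    by (rule summable_comparison_test'[where N = 0])
      (use singular_curve_iterate[OF l, of f] t in \<open>simp add: singular_curve_def\<close>)
  from suminf_split_head[OF s] have "(\<Sum>n. iterate f n t) = Q_sum A t f"
    using t by (simp add: Q_sum_def Q_iter_eq_iterate iterate_0)
  with s show ?thesis by (simp add: sums_iff)
qed

text \<open>The factor two is the sum of the geometric series with ratio one half.\<close>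

definition Q_const :: "'a bborel \<Rightarrow> real" where
  "Q_const f = 2 * (K * norm f * exp (SOME l. halving_rate l))"

lemma partial_sums_le:
  assumes t: "t \<in> {0<..1}"
  shows "norm (\<Sum>n<N. iterate f n t) \<le> Q_const f * t powr (\<delta> - 1)"
proof -
  have l: "halving_rate (SOME l. halving_rate l)" using halving_rate_exists by (rule someI_ex)
  let ?c = "K * norm f * exp (SOME l. halving_rate l)"
  have "norm (\<Sum>n<N. iterate f n t) \<le> (\<Sum>n<N. ?c * (1/2)^n * t powr (\<delta> - 1))"
    using singular_curve_iterate[OF l] t by (intro sum_norm_le) (auto simp: singular_curve_def)
  also have "\<dots> = ?c * (\<Sum>n<N. (1/2)^n) * t powr (\<delta> - 1)"
    by (simp add: sum_distrib_left sum_distrib_right)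
  also have "\<dots> \<le> ?c * 2 * t powr (\<delta> - 1)"
    using K_nonneg by (intro mult_right_mono mult_left_mono) (auto simp: geometric_sum)
  finally show ?thesis by (simp add: Q_const_def mult_ac)
qed

lemma singular_curve_partial_sums: "singular_curve \<delta> (Q_const f) (\<lambda>t. \<Sum>n<N. iterate f n t)"
  using partial_sums_le singular_curve_iterate halving_rate_exists
  by (auto simp: singular_curve_def intro!: continuous_on_sum)

text \<open>The series need not converge uniformly near time zero, but after multiplication by \<open>t\<^sup>1\<^sup>-\<^sup>\<delta>\<close> it
does, by the Weierstrass test.\<close>

lemma singular_curve_Q_sum: "singular_curve \<delta> (Q_const f) (\<lambda>t. Q_sum A t f)"
proof -
  obtain l where l: "halving_rate l" using halving_rate_exists by blast
  have b: "norm (Q_sum A t f) \<le> Q_const f * t powr (\<delta> - 1)" if "t \<in> {0<..1}" for t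
    using partial_sums_le[OF that] iterate_sums[OF that, of f]
    by (intro LIMSEQ_le_const2[OF tendsto_norm]) (auto simp: sums_def)
  have u: "uniform_limit {0<..1} (\<lambda>N t. \<Sum>n<N. t powr (1 - \<delta>) *\<^sub>R iterate f n t)
      (\<lambda>t. \<Sum>n. t powr (1 - \<delta>) *\<^sub>R iterate f n t) sequentially"
  proof (rule Weierstrass_m_test)
    fix n and t :: real assume t: "t \<in> {0<..1}"
    have "norm (t powr (1 - \<delta>) *\<^sub>R iterate f n t) \<le> t powr (1 - \<delta>) * (K * norm f * exp l * (1/2)^n * t powr (\<delta> - 1))"
      unfolding norm_scaleR abs_of_nonneg[OF powr_ge_zero]
      using bspec[OF conjunct2[OF singular_curve_iterate[OF l, of f n, unfolded singular_curve_def]] t]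
      by (rule mult_left_mono) simp
    also have "\<dots> = K * norm f * exp l * (1/2)^n * (t powr (1 - \<delta>) * t powr (\<delta> - 1))"
      by (simp add: mult_ac)
    also have "t powr (1 - \<delta>) * t powr (\<delta> - 1) = 1"
      using t by (simp flip: powr_add)
    finally show "norm (t powr (1 - \<delta>) *\<^sub>R iterate f n t) \<le> K * norm f * exp l * (1/2)^n" by simp
  qed (intro summable_mult summable_geometric, simp)
  have "continuous_on {0<..1} (\<lambda>t. \<Sum>n. t powr (1 - \<delta>) *\<^sub>R iterate f n t)"
    using singular_curve_iterate[OF l, of f]
    by (intro uniform_limit_theorem[OF _ u] always_eventually allI continuous_on_sum continuous_on_scaleR
        continuous_on_powr continuous_on_id continuous_on_const)
      (auto simp: singular_curve_def)
  then have "continuous_on {0<..1} (\<lambda>t. t powr (\<delta> - 1) *\<^sub>R (\<Sum>n. t powr (1 - \<delta>) *\<^sub>R iterate f n t))"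
    by (intro continuous_intros) auto
  moreover have "t powr (\<delta> - 1) *\<^sub>R (\<Sum>n. t powr (1 - \<delta>) *\<^sub>R iterate f n t) = Q_sum A t f"
    if t: "t \<in> {0<..1}" for t
    using sums_unique[OF sums_scaleR_right[OF iterate_sums[OF t, of f], of "t powr (1 - \<delta>)"], symmetric] t
    by (simp flip: powr_add)
  ultimately have "continuous_on {0<..1} (\<lambda>t. Q_sum A t f)"
    by (subst (asm) continuous_on_cong[OF refl]) auto
  with b show ?thesis by (auto simp: singular_curve_def)
qed

lemma conv_add:
  assumes W: "singular_curve \<delta> C W" and V: "singular_curve \<delta> D V" and te: "(t, e) \<in> time_region"
  shows "conv (\<lambda>s. W s + V s) t e = conv W t e + conv V t e"
proof (rule bborel_eqI)
  fix x
  have "(LBINT s:{0<..<t}. bb_fun (A (t - s + e) (W s + V s)) x)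
     = (LBINT s:{0<..<t}. bb_fun (A (t - s + e) (W s)) x + bb_fun (A (t - s + e) (V s)) x)"
    using te by (intro set_lebesgue_integral_cong)
      (auto simp: linear_add[OF lin] bb_fun_simps time_region_def)
  also have "\<dots> = (LBINT s:{0<..<t}. bb_fun (A (t - s + e) (W s)) x) + (LBINT s:{0<..<t}. bb_fun (A (t - s + e) (V s)) x)"
    by (intro set_integral_add bb_fun_conv[OF W te] bb_fun_conv[OF V te])
  finally show "bb_fun (conv (\<lambda>s. W s + V s) t e) x = bb_fun (conv W t e + conv V t e) x"
    using te by (simp add: bb_fun_simps bb_fun_conv[OF W te] bb_fun_conv[OF V te]
        bb_fun_conv[OF singular_curve_add[OF W V] te])
qed

lemma conv_partial_sums:
  assumes t: "t \<in> {0<..1}"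
  shows "conv (\<lambda>s. \<Sum>n<N. iterate f n s) t 0 = (\<Sum>n<N. iterate f (Suc n) t)"
proof (induction N)
  have tr: "(t, 0) \<in> time_region" using t by (simp add: time_region_def)
  case 0
  have "norm (conv (\<lambda>s. 0) t 0) \<le> K * 0 * (exp 1 * kernel_const \<delta>) * t powr (\<delta> - 1)"
    by (rule norm_conv_le[OF _ tr]) (simp add: singular_curve_def)
  then show ?case by simp
next
  have tr: "(t, 0) \<in> time_region" using t by (simp add: time_region_def)
  case (Suc N)
  obtain l where l: "halving_rate l" using halving_rate_exists by blast
  have "conv (\<lambda>s. (\<Sum>n<N. iterate f n s) + iterate f N s) t 0 = conv (\<lambda>s. \<Sum>n<N. iterate f n s) t 0 + conv (iterate f N) t 0"
    by (rule conv_add[OF singular_curve_partial_sums singular_curve_iterate[OF l] tr])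
  with Suc show ?case by (simp add: iterate_Suc_conv[OF t])
qed

text \<open>Convolving the partial sums shifts them by one, and dominated convergence passes to the limit.\<close>

lemma Volterra_equation:
  assumes t: "t \<in> {0<..1}"
  shows "Q_sum A t f = A t f + conv (\<lambda>s. Q_sum A s f) t 0"
proof -
  have tr: "(t, 0) \<in> time_region" using t by (simp add: time_region_def)
  note ps = singular_curve_partial_sums[of f]
  have "(\<lambda>N. conv (\<lambda>s. \<Sum>n<N. iterate f n s) t 0) \<longlonglongrightarrow> conv (\<lambda>s. Q_sum A s f) t 0"
    unfolding conv_def set_Bochner_integral_def
  proof (rule Bochner_integral_dominated_convergence)
    show "integrable lborel (\<lambda>s. K * Q_const f * ((t - s) powr (\<delta> - 1) * s powr (\<delta> - 1) * indicator {0<..<t} s))"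
      using t by (intro integrable_mult_right integrable_kernel delta) auto
    fix s :: real
    show "norm (indicat_real {0<..<t} s *\<^sub>R A (t - s + 0) (\<Sum>n<N. iterate f n s))
      \<le> K * Q_const f * ((t - s) powr (\<delta> - 1) * s powr (\<delta> - 1) * indicator {0<..<t} s)" for N
      by (rule conv_integrand_norm_le[OF ps tr])
    show "(\<lambda>N. indicat_real {0<..<t} s *\<^sub>R A (t - s + 0) (\<Sum>n<N. iterate f n s))
      \<longlonglongrightarrow> indicat_real {0<..<t} s *\<^sub>R A (t - s + 0) (Q_sum A s f)"
    proof (cases "s \<in> {0<..<t}")
      case True
      then have s: "s \<in> {0<..1}" "t - s + 0 \<in> {0<..1}" using t by auto
      show ?thesis
        using iterate_sums[OF s(1), of f] unfolding sums_def
        by (intro tendsto_scaleR tendsto_const bounded_linear.tendsto[OF bounded_linear_family[OF s(2)]])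
    qed simp
  qed (use conv_integrable[OF ps tr] conv_integrable[OF singular_curve_Q_sum tr] in \<open>auto simp: Bochner_integrable_def\<close>)
  then have "(\<lambda>n. iterate f (Suc n) t) sums conv (\<lambda>s. Q_sum A s f) t 0"
    by (simp add: conv_partial_sums[OF t] sums_def)
  from sums_Suc[OF this] have "(\<lambda>n. iterate f n t) sums (conv (\<lambda>s. Q_sum A s f) t 0 + iterate f 0 t)" .
  from sums_unique2[OF this iterate_sums[OF t]] show ?thesis
    by (simp add: iterate_0[OF t] add.commute)
qed

end

section \<open>Functions vanishing at infinity\<close>

lemma tendsto_at_infinity_sequentially:
  fixes f :: "'a::real_normed_vector \<Rightarrow> real"
  assumes "\<And>X. filterlim X at_infinity sequentially \<Longrightarrow> (\<lambda>n. f (X n)) \<longlonglongrightarrow> c"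
  shows "(f \<longlongrightarrow> c) at_infinity"
proof (rule ccontr)
  assume "\<not> ?thesis"
  then obtain e where e: "e > 0" "\<not> eventually (\<lambda>x. dist (f x) c < e) at_infinity"
    by (auto simp: tendsto_iff)
  then have "\<forall>n::nat. \<exists>x. norm x \<ge> real n \<and> \<not> dist (f x) c < e"
    by (auto simp: eventually_at_infinity)
  then obtain X where X: "\<And>n. norm (X n) \<ge> real n" "\<And>n. \<not> dist (f (X n)) c < e" by metis
  have "filterlim X at_infinity sequentially"
    by (rule filterlim_norm_at_top_imp_at_infinity,
        rule filterlim_at_top_mono[OF filterlim_real_sequentially]) (use X in auto)
  from assms[OF this] have "eventually (\<lambda>n. dist (f (X n)) c < e) sequentially"
    using e(1) by (rule tendstoD)
  then show False using X(2) by simp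
qed

text \<open>Both defining properties are limits along sequences of points, hence follow by dominated convergence with the norm of the
integrand as majorant.\<close>

lemma C0_Bochner_integral:
  fixes F :: "'s \<Rightarrow> 'a::real_normed_vector bborel"
  assumes F: "Bochner_integrable M F" and C0: "\<And>s. s \<in> space M \<Longrightarrow> bb_fun (F s) \<in> C0"
  shows "bb_fun (Bochner_integral M F) \<in> C0"
proof -
  have lim: "(\<lambda>n. bb_fun (Bochner_integral M F) (X n)) \<longlonglongrightarrow> (\<integral>s. g s \<partial>M)"
    if g: "g \<in> borel_measurable M" "\<And>s. s \<in> space M \<Longrightarrow> (\<lambda>n. bb_fun (F s) (X n)) \<longlonglongrightarrow> g s" for X g
    unfolding bb_fun_Bochner_integral(2)[OF F]
    by (rule integral_dominated_convergence[where w = "\<lambda>s. norm (F s)"])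
      (use g Bochner_integrable_norm[OF F] bb_fun_Bochner_integral(1)[OF F] in
        \<open>auto intro: borel_measurable_integrable abs_bb_fun_le_norm\<close>)
  have "continuous_on UNIV (bb_fun (Bochner_integral M F))"
    unfolding continuous_on_sequentially
  proof (intro allI ballI impI)
    fix X and x :: 'a assume "(\<forall>n. X n \<in> UNIV) \<and> X \<longlonglongrightarrow> x"
    then have X: "X \<longlonglongrightarrow> x" by simp
    have "(\<lambda>n. bb_fun (Bochner_integral M F) (X n)) \<longlonglongrightarrow> (\<integral>s. bb_fun (F s) x \<partial>M)"
    proof (rule lim)
      fix s assume "s \<in> space M"
      then have "continuous_on UNIV (bb_fun (F s))" using C0 by (auto simp: C0_def)
      from continuous_on_tendsto_compose[OF this X] show "(\<lambda>n. bb_fun (F s) (X n)) \<longlonglongrightarrow> bb_fun (F s) x"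
        by simp
    qed (use bb_fun_Bochner_integral(1)[OF F] in auto)
    then show "(bb_fun (Bochner_integral M F) \<circ> X) \<longlonglongrightarrow> bb_fun (Bochner_integral M F) x"
      by (simp add: bb_fun_Bochner_integral(2)[OF F] o_def)
  qed
  moreover have "(bb_fun (Bochner_integral M F) \<longlongrightarrow> 0) at_infinity"
  proof (rule tendsto_at_infinity_sequentially)
    fix X :: "nat \<Rightarrow> 'a" assume X: "filterlim X at_infinity sequentially"
    have "(\<lambda>n. bb_fun (Bochner_integral M F) (X n)) \<longlonglongrightarrow> (\<integral>s. 0 \<partial>M)"
      by (rule lim) (use C0 X in \<open>auto simp: C0_def intro: filterlim_compose\<close>)
    then show "(\<lambda>n. bb_fun (Bochner_integral M F) (X n)) \<longlonglongrightarrow> 0" by simp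
  qed
  ultimately show ?thesis by (simp add: C0_def)
qed

lemma C0_bounded_borel:
  fixes h :: "'a::euclidean_space \<Rightarrow> real"
  assumes h: "h \<in> C0"
  shows "bb_fun (Bborel h) = h"
proof -
  have c: "continuous_on UNIV h" using h by (simp add: C0_def)
  have "eventually (\<lambda>z. dist (h z) 0 < 1) at_infinity"
    using h by (intro tendstoD) (auto simp: C0_def)
  then obtain r where r: "\<And>z. norm z \<ge> r \<Longrightarrow> \<bar>h z\<bar> < 1"
    by (auto simp: eventually_at_infinity dist_real_def)
  have "bounded (h ` cball 0 r)"
    by (intro compact_imp_bounded compact_continuous_image continuous_on_subset[OF c]) auto
  then obtain B where B: "\<And>z. norm z \<le> r \<Longrightarrow> \<bar>h z\<bar> \<le> B"
    unfolding bounded_iff by force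
  have "\<bar>h z\<bar> \<le> max B 1" for z
    using r[of z] B[of z] by (cases "norm z \<le> r") auto
  then have "bounded (range h)" by (auto simp: bounded_iff)
  moreover have "h \<in> borel_measurable borel" by (rule borel_measurable_continuous_onI[OF c])
  ultimately show ?thesis by (intro Bborel_inverse) simp
qed

lemma C0_LIMSEQ:
  fixes F :: "nat \<Rightarrow> 'a::real_normed_vector bborel"
  assumes F: "\<And>n. bb_fun (F n) \<in> C0" and l: "F \<longlonglongrightarrow> G"
  shows "bb_fun G \<in> C0"
proof -
  have d: "\<bar>bb_fun (F n) x - bb_fun G x\<bar> \<le> dist (F n) G" for n x
    using abs_bb_fun_le_norm[of "F n - G" x] by (simp add: dist_norm bb_fun_simps)
  have N: "\<exists>N. \<forall>n\<ge>N. \<forall>x. \<bar>bb_fun (F n) x - bb_fun G x\<bar> < e" if "e > 0" for e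
    using LIMSEQ_D[OF l that] d by (metis dist_norm le_less_trans)
  have "uniform_limit UNIV (\<lambda>n. bb_fun (F n)) (bb_fun G) sequentially"
    using N by (auto simp: uniform_limit_iff eventually_sequentially dist_real_def)
  then have "continuous_on UNIV (bb_fun G)"
    by (rule uniform_limit_theorem[rotated]) (use F in \<open>auto simp: C0_def\<close>)
  moreover have "(bb_fun G \<longlongrightarrow> 0) at_infinity"
  proof (rule tendstoI)
    fix e :: real assume e: "e > 0"
    obtain n where n: "\<And>x. \<bar>bb_fun (F n) x - bb_fun G x\<bar> < e / 2" using N[of "e/2"] e by auto
    have "(bb_fun (F n) \<longlongrightarrow> 0) at_infinity" using F by (simp add: C0_def)
    then have "eventually (\<lambda>x. dist (bb_fun (F n) x) 0 < e / 2) at_infinity"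
      using e by (intro tendstoD) auto
    then show "eventually (\<lambda>x. dist (bb_fun G x) 0 < e) at_infinity"
    proof eventually_elim
      case (elim x)
      then show ?case using n[of x] unfolding dist_real_def by linarith
    qed
  qed
  ultimately show ?thesis by (simp add: C0_def)
qed

lemma C0_zero: "bb_fun 0 \<in> C0" by (simp add: C0_def bb_fun_simps)

lemma C0_add: "bb_fun f \<in> C0 \<Longrightarrow> bb_fun g \<in> C0 \<Longrightarrow> bb_fun (f + g) \<in> C0"
  using tendsto_add_zero[of "bb_fun f" at_infinity "bb_fun g"]
  by (simp add: C0_def plus_bborel.rep_eq[abs_def] continuous_on_add)

lemma C0_scaleR: "bb_fun f \<in> C0 \<Longrightarrow> bb_fun (c *\<^sub>R f) \<in> C0"
  using tendsto_mult_right_zero[of "bb_fun f" at_infinity c]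
  by (simp add: C0_def scaleR_bborel.rep_eq[abs_def] continuous_on_mult_left)

lemma C0_diff: "bb_fun f \<in> C0 \<Longrightarrow> bb_fun g \<in> C0 \<Longrightarrow> bb_fun (f - g) \<in> C0"
  using C0_add[of f "(-1) *\<^sub>R g"] C0_scaleR[of g "-1"] by simp

lemma C0_sum: "(\<And>i. i \<in> I \<Longrightarrow> bb_fun (F i) \<in> C0) \<Longrightarrow> bb_fun (sum F I) \<in> C0"
  by (induction I rule: infinite_finite_induct) (auto simp: C0_zero C0_add)

lemma C0_set_Bochner_integral:
  fixes F :: "real \<Rightarrow> 'a::real_normed_vector bborel"
  assumes "Bochner_integrable lborel (\<lambda>s. indicat_real S s *\<^sub>R F s)" "\<And>s. s \<in> S \<Longrightarrow> bb_fun (F s) \<in> C0"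
  shows "bb_fun (set_Bochner_integral lborel S F) \<in> C0"
  unfolding set_Bochner_integral_def
  by (rule C0_Bochner_integral[OF assms(1)]) (use assms(2) in \<open>auto simp: indicator_def C0_zero\<close>)

locale C0_singular_family = singular_family A K \<delta>
  for A :: "'a::real_normed_vector op_family" and K \<delta> +
  assumes C0_invariant: "\<And>t f. t \<in> {0<..1} \<Longrightarrow> bb_fun f \<in> C0 \<Longrightarrow> bb_fun (A t f) \<in> C0"
begin

lemma C0_conv:
  assumes W: "singular_curve \<delta> C W" and te: "(t, e) \<in> time_region"
    and C0: "\<And>s. s \<in> {0<..1} \<Longrightarrow> bb_fun (W s) \<in> C0"
  shows "bb_fun (conv W t e) \<in> C0"
  unfolding conv_def
  by (rule C0_set_Bochner_integral[OF conv_integrable[OF W te]])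
    (use te in \<open>auto intro!: C0_invariant C0 simp: time_region_def\<close>)

lemma C0_Q_sum:
  assumes t: "t \<in> {0<..1}" and f: "bb_fun f \<in> C0"
  shows "bb_fun (Q_sum A t f) \<in> C0"
proof -
  obtain l where l: "halving_rate l" using halving_rate_exists by blast
  have it: "bb_fun (iterate f n t) \<in> C0" if "t \<in> {0<..1}" for n t
    using that
  proof (induction n arbitrary: t)
    case (Suc n)
    then show ?case using C0_conv[OF singular_curve_iterate[OF l], of t 0 f n]
      by (simp add: iterate_Suc_conv time_region_def)
  qed (simp add: iterate_0 C0_invariant f)
  show ?thesis
  proof (rule C0_LIMSEQ)
    show "(\<lambda>N. \<Sum>n<N. iterate f n t) \<longlonglongrightarrow> Q_sum A t f"
      using iterate_sums[OF t, of f] by (simp add: sums_def)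
    show "bb_fun (\<Sum>n<N. iterate f n t) \<in> C0" for N by (intro C0_sum it t)
  qed
qed

end

section \<open>A parabolic maximum principle\<close>

lemma C0_attains_max:
  fixes h :: "'a::euclidean_space \<Rightarrow> real"
  assumes h: "h \<in> C0" and y: "0 < h y"
  obtains x where "\<And>z. h z \<le> h x"
proof -
  have "eventually (\<lambda>z. dist (h z) 0 < h y) at_infinity"
    using h y by (intro tendstoD) (auto simp: C0_def)
  then obtain r where r: "\<And>z. norm z \<ge> r \<Longrightarrow> \<bar>h z\<bar> < h y"
    by (auto simp: eventually_at_infinity dist_real_def)
  have yr: "y \<in> cball 0 r" using r[of y] by (cases "norm y \<ge> r") auto
  have "continuous_on (cball 0 r) h"
    using h by (auto simp: C0_def intro: continuous_on_subset)
  then obtain x where x: "\<And>z. z \<in> cball 0 r \<Longrightarrow> h z \<le> h x"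
    using continuous_attains_sup[OF compact_cball _ \<open>continuous_on (cball 0 r) h\<close>] yr by blast
  have "h z \<le> h x" for z
    using x[of z] x[OF yr] r[of z] by (cases "norm z \<ge> r") auto
  then show ?thesis by (rule that)
qed

text \<open>The derivative is taken from the left only, because the maximum may lie at the final time.\<close>

lemma left_derivative_nonneg_at_max:
  fixes \<psi> :: "real \<Rightarrow> real"
  assumes "a < b" and D: "(\<psi> has_vector_derivative D) (at b within {a..b})"
    and max: "\<And>s. s \<in> {a..b} \<Longrightarrow> \<psi> s \<le> \<psi> b"
  shows "0 \<le> D"
proof (rule tendsto_lowerbound)
  show "((\<lambda>s. (\<psi> s - \<psi> b) / (s - b)) \<longlongrightarrow> D) (at b within {a..b})"
    using D by (simp add: has_real_derivative_iff_has_vector_derivative[symmetric] has_field_derivative_iff)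
  show "at b within {a..b} \<noteq> bot"
    using assms(1) by (simp add: at_within_Icc_at_left trivial_limit_at_left_real)
  show "\<forall>\<^sub>F s in at b within {a..b}. 0 \<le> (\<psi> s - \<psi> b) / (s - b)"
    using max by (auto simp: eventually_at_filter intro!: always_eventually divide_nonpos_nonpos)
qed

lemma continuous_on_SUP_bb_fun: "continuous_on S (\<lambda>f. SUP x. bb_fun f x)"
proof -
  have bdd: "bdd_above (range (bb_fun f))" for f :: "'a bborel"
    using abs_bb_fun_le_norm[of f] by (intro bdd_aboveI2[where M = "norm f"]) (meson abs_le_D1)
  have le: "(SUP x. bb_fun f x) \<le> (SUP x. bb_fun g x) + norm (f - g)" for f g :: "'a bborel"
  proof (rule cSUP_least)
    fix x show "bb_fun f x \<le> (SUP x. bb_fun g x) + norm (f - g)"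
      using abs_bb_fun_le_norm[of "f - g" x] cSUP_upper[OF UNIV_I bdd, of g x]
      by (simp add: bb_fun_simps)
  qed simp
  have "\<bar>(SUP x. bb_fun f x) - (SUP x. bb_fun g x)\<bar> \<le> dist f g" for f g :: "'a bborel"
    using le[of f g] le[of g f] by (simp add: dist_norm norm_minus_commute abs_le_iff)
  then have "1-lipschitz_on S (\<lambda>f. SUP x. bb_fun f x)"
    by (intro lipschitz_onI) (auto simp: dist_real_def)
  then show ?thesis by (rule lipschitz_on_continuous_on)
qed

text \<open>If the bound fails, the function \<open>U t x - d (t - \<tau>)\<close> exceeds the norm of \<open>U \<tau>\<close> somewhere and attains a maximum
at some \<open>(t\<^sub>0, x\<^sub>0)\<close> with \<open>t\<^sub>0 > \<tau>\<close>. There the time derivative of \<open>U\<close> is at least \<open>d\<close>, while the positive maximum principle gives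
\<open>L U \<le> 0\<close>, contradicting \<open>\<partial>\<^sub>t U - L U < d\<close>.\<close>

lemma parabolic_maximum_principle:
  fixes U :: "real \<Rightarrow> 'a::euclidean_space bborel"
  assumes pmp: "positive_maximum_principle DL L"
    and cont: "continuous_on {\<tau>..T} U"
    and C0: "\<And>t. t \<in> {\<tau>..T} \<Longrightarrow> bb_fun (U t) \<in> C0 \<inter> DL"
    and deriv: "\<And>t x. t \<in> {\<tau><..T} \<Longrightarrow> ((\<lambda>s. bb_fun (U s) x) has_vector_derivative U' t x) (at t within {\<tau>..t})"
    and ineq: "\<And>t x. t \<in> {\<tau><..T} \<Longrightarrow> U' t x - L (bb_fun (U t)) x < d"
    and d: "0 \<le> d" and t: "t \<in> {\<tau>..T}"
  shows "bb_fun (U t) x \<le> norm (U \<tau>) + d * (t - \<tau>)"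
proof (rule ccontr)
  assume neg: "\<not> ?thesis"
  define S where "S s = (SUP x. bb_fun (U s) x)" for s
  have bdd: "bdd_above (range (bb_fun (U s)))" for s
    using abs_bb_fun_le_norm[of "U s"] by (intro bdd_aboveI2[where M = "norm (U s)"]) (meson abs_le_D1)
  have S_upper: "bb_fun (U s) z \<le> S s" for s z unfolding S_def by (rule cSUP_upper[OF UNIV_I bdd])
  have "continuous_on {\<tau>..T} (\<lambda>s. S s - d * (s - \<tau>))"
    unfolding S_def
    by (intro continuous_intros continuous_on_compose2[OF continuous_on_SUP_bb_fun cont]) auto
  then obtain t0 where t0: "t0 \<in> {\<tau>..T}" and t0max: "\<And>s. s \<in> {\<tau>..T} \<Longrightarrow> S s - d * (s - \<tau>) \<le> S t0 - d * (t0 - \<tau>)"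
    using continuous_attains_sup[of "{\<tau>..T}" "\<lambda>s. S s - d * (s - \<tau>)"] t by auto
  \<comment> \<open>The maximizing time has a value strictly above the initial one, so it is not \<open>\<tau>\<close>.\<close>
  have big: "norm (U \<tau>) < S t0 - d * (t0 - \<tau>)"
    using neg S_upper[of t x] t0max[OF t] by linarith
  have "S \<tau> \<le> norm (U \<tau>)" unfolding S_def
    using abs_bb_fun_le_norm[of "U \<tau>"] by (intro cSUP_least) (auto intro: abs_le_D1)
  with big have "t0 \<noteq> \<tau>" by auto
  with t0 have t0': "t0 \<in> {\<tau><..T}" "\<tau> < t0" by auto
  have "0 \<le> d * (t0 - \<tau>)" using d t0' by simp
  with big have S0: "0 < S t0" using norm_ge_zero[of "U \<tau>"] by linarith
  have "\<exists>y. 0 < bb_fun (U t0) y"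
  proof (rule ccontr)
    assume "\<nexists>y. 0 < bb_fun (U t0) y"
    then have "S t0 \<le> 0" unfolding S_def by (intro cSUP_least) (auto simp: not_less)
    with S0 show False by simp
  qed
  then obtain x0 where x0: "\<And>z. bb_fun (U t0) z \<le> bb_fun (U t0) x0"
    using C0_attains_max C0[OF t0] by (metis IntD1)
  then have Sx0: "bb_fun (U t0) x0 = S t0"
    using S_upper[of t0 x0] unfolding S_def by (intro antisym cSUP_least) auto
  have "L (bb_fun (U t0)) x0 \<le> 0"
    using pmp C0[OF t0] bdd[of t0] Sx0 S0 unfolding positive_maximum_principle_def S_def by auto
  moreover have "0 \<le> U' t0 x0 - d"
  proof (rule left_derivative_nonneg_at_max[OF t0'(2), of "\<lambda>s. bb_fun (U s) x0 - d * (s - \<tau>)"])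
    show "((\<lambda>s. bb_fun (U s) x0 - d * (s - \<tau>)) has_vector_derivative U' t0 x0 - d) (at t0 within {\<tau>..t0})"
      by (auto intro!: derivative_eq_intros deriv t0'(1))
    fix s assume "s \<in> {\<tau>..t0}"
    then have "s \<in> {\<tau>..T}" using t0 by auto
    from t0max[OF this] S_upper[of s x0] Sx0
    show "bb_fun (U s) x0 - d * (s - \<tau>) \<le> bb_fun (U t0) x0 - d * (t0 - \<tau>)" by linarith
  qed
  ultimately show False using ineq[OF t0'(1), of x0] by linarith
qed

lemma bb_fun_uminus_eq: "bb_fun (- f) = (\<lambda>x. - 1 * bb_fun f x)"
  by (simp add: fun_eq_iff bb_fun_simps)

lemma parabolic_norm_estimate:
  fixes U :: "real \<Rightarrow> 'a::euclidean_space bborel"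
  assumes pmp: "positive_maximum_principle DL L" and L: "linear_operator_on DL L"
    and cont: "continuous_on {\<tau>..T} U"
    and C0: "\<And>t. t \<in> {\<tau>..T} \<Longrightarrow> bb_fun (U t) \<in> C0 \<inter> DL"
    and deriv: "\<And>t x. t \<in> {\<tau><..T} \<Longrightarrow> ((\<lambda>s. bb_fun (U s) x) has_vector_derivative U' t x) (at t within {\<tau>..t})"
    and ineq: "\<And>t x. t \<in> {\<tau><..T} \<Longrightarrow> \<bar>U' t x - L (bb_fun (U t)) x\<bar> < d"
    and d: "0 \<le> d" and t: "t \<in> {\<tau>..T}"
  shows "norm (U t) \<le> norm (U \<tau>) + d * (t - \<tau>)"
proof (rule norm_bborel_le)
  fix x
  have Lm: "L (bb_fun (- U t)) = (\<lambda>x. - 1 * L (bb_fun (U t)) x)" "bb_fun (- U t) \<in> DL"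
    if "t \<in> {\<tau>..T}" for t
    using L C0[OF that] unfolding linear_operator_on_def function_subspace_def bb_fun_uminus_eq by blast+
  have "bb_fun (- U t) x \<le> norm (- U \<tau>) + d * (t - \<tau>)"
  proof (rule parabolic_maximum_principle[OF pmp _ _ _ _ d t, where U = "\<lambda>t. - U t" and U' = "\<lambda>t x. - U' t x"])
    show "continuous_on {\<tau>..T} (\<lambda>t. - U t)" by (intro continuous_intros cont)
    show "bb_fun (- U t) \<in> C0 \<inter> DL" if "t \<in> {\<tau>..T}" for t
      using Lm(2)[OF that] C0[OF that] C0_scaleR[of "U t" "-1"] by auto
    show "((\<lambda>s. bb_fun (- U s) x) has_vector_derivative - U' t x) (at t within {\<tau>..t})"
      if "t \<in> {\<tau><..T}" for t x
      unfolding uminus_bborel.rep_eq by (rule has_vector_derivative_minus[OF deriv[OF that]])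
    show "- U' t x - L (bb_fun (- U t)) x < d" if "t \<in> {\<tau><..T}" for t x
      using ineq[OF that, of x] Lm(1)[of t] that by (auto simp: abs_less_iff)
  qed
  moreover have "bb_fun (U t) x \<le> norm (U \<tau>) + d * (t - \<tau>)"
    by (rule parabolic_maximum_principle[OF pmp cont C0 deriv _ d t])
      (use ineq in \<open>auto simp: abs_less_iff\<close>)
  ultimately show "\<bar>bb_fun (U t) x\<bar> \<le> norm (U \<tau>) + d * (t - \<tau>)"
    by (simp add: bb_fun_simps abs_le_iff)
qed

section \<open>The regularized parametrix and its residual\<close>

lemma tendsto_powr_at_right_zero:
  assumes "0 < (a::real)"
  shows "((\<lambda>s. s powr a) \<longlongrightarrow> 0) (at_right 0)"
proof -
  have "\<forall>\<^sub>F s::real in at_right 0. 0 \<le> s" by (auto simp: eventually_at_filter)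
  then have "((\<lambda>s. s powr a) \<longlongrightarrow> 0 powr a) (at_right 0)"
    using assms by (intro tendsto_powr' tendsto_const tendsto_ident_at) auto
  then show ?thesis by simp
qed

text \<open>The constant \<open>K\<close> bounds the family \<open>P0\<close> uniformly, and at the same time serves as the constant in the singular bounds of both families.\<close>

locale parametrix = Q: C0_singular_family Q0 K \<delta> + P: C0_singular_family P0 K \<delta>
  for P0 Q0 :: "'a::euclidean_space op_family" and K \<delta> +
  assumes P_bound: "\<And>t f. t \<in> {0<..1} \<Longrightarrow> norm (P0 t f) \<le> K * norm f"
    and P_zero: "\<And>f. bb_fun f \<in> C0 \<Longrightarrow> ((\<lambda>t. P0 t f) \<longlongrightarrow> f) (at_right 0)"
begin

abbreviation "Qs f s \<equiv> Q_sum Q0 s f"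
abbreviation "Pe t e f \<equiv> P_eps P0 Q0 t e f"

lemmas Qs_curve = Q.singular_curve_Q_sum

lemma Qs_bound: "t \<in> {0<..1} \<Longrightarrow> norm (Qs f t) \<le> Q.Q_const f * t powr (\<delta> - 1)"
  using Qs_curve[of f] by (auto simp: singular_curve_def)

lemma Q_const_nonneg: "0 \<le> Q.Q_const f" by (rule Q.singular_const_nonneg[OF Qs_curve])

lemma Pe_eq: "Pe t e f = P0 (t + e) f + P.conv (Qs f) t e"
  by (simp add: P_eps_def P.conv_def)

lemma P_op_eq_Pe: "P_op P0 Q0 t f = Pe t 0 f"
  by (simp add: P_eps_def P_op_def)

lemma continuous_on_family_sum:
  assumes "\<And>f. continuous_on {0<..1} (\<lambda>t. A t f)"
  shows "continuous_on time_region (\<lambda>p. A (fst p + snd p) f)"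
  by (rule continuous_on_compose2[OF assms]) (auto intro!: continuous_intros simp: time_region_def)

lemma continuous_on_Pe: "continuous_on time_region (\<lambda>p. Pe (fst p) (snd p) f)"
  unfolding Pe_eq
  by (intro continuous_on_add P.continuous_on_conv[OF Qs_curve] continuous_on_family_sum P.cont)

text \<open>Uses the uniform bound of \<open>P0\<close>, so that only the singularity of \<open>Q_sum\<close> at time zero is integrated and the
result vanishes as \<open>t\<close> tends to zero.\<close>

lemma norm_Pe_diff_le:
  assumes te: "(t, e) \<in> time_region"
  shows "norm (Pe t e f - P0 (t + e) f) \<le> K * Q.Q_const f * (t powr \<delta> / \<delta>)"
proof -
  have t: "0 < t" "0 \<le> e" "t + e \<le> 1" using te by (auto simp: time_region_def)
  note I = P.conv_integrable[OF Qs_curve te, of f]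
  have "norm (P.conv (Qs f) t e) \<le> (\<integral>s. norm (indicat_real {0<..<t} s *\<^sub>R P0 (t - s + e) (Qs f s)) \<partial>lborel)"
    unfolding P.conv_def set_Bochner_integral_def by (rule norm_Bochner_integral_le[OF I])
  also have "\<dots> \<le> (\<integral>s. K * Q.Q_const f * (s powr (\<delta> - 1) * indicator {0<..<t} s) \<partial>lborel)"
  proof (rule integral_mono)
    fix s :: real
    show "norm (indicat_real {0<..<t} s *\<^sub>R P0 (t - s + e) (Qs f s)) \<le> K * Q.Q_const f * (s powr (\<delta> - 1) * indicator {0<..<t} s)"
    proof (cases "s \<in> {0<..<t}")
      case True
      then have s: "s \<in> {0<..1}" "t - s + e \<in> {0<..1}" using t by auto
      have "norm (P0 (t - s + e) (Qs f s)) \<le> K * norm (Qs f s)" by (rule P_bound[OF s(2)])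
      also have "\<dots> \<le> K * (Q.Q_const f * s powr (\<delta> - 1))"
        by (intro mult_left_mono Qs_bound s P.K_nonneg)
      finally show ?thesis using True by (simp add: mult.assoc)
    qed simp
  next
    show "integrable lborel (\<lambda>s. K * Q.Q_const f * (s powr (\<delta> - 1) * indicator {0<..<t} s))"
      using t by (intro integrable_mult_right integrable_powr P.delta) auto
  qed (rule Bochner_integrable_norm[OF I])
  also have "\<dots> = K * Q.Q_const f * (t powr \<delta> / \<delta>)"
    using integrable_powr[OF P.delta(1), of t] t by simp
  finally show ?thesis by (simp add: Pe_eq)
qed

definition Pe_const :: "'a bborel \<Rightarrow> real" where
  "Pe_const f = K * norm f + K * Q.Q_const f * (1 / \<delta>)"

lemma norm_Pe_le:
  assumes te: "(t, e) \<in> time_region"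
  shows "norm (Pe t e f) \<le> Pe_const f"
proof -
  have t: "0 < t" "0 \<le> e" "t + e \<le> 1" using te by (auto simp: time_region_def)
  have "t powr \<delta> / \<delta> \<le> 1 / \<delta>"
    using t P.delta powr_mono2[of \<delta> t 1] by (intro divide_right_mono) auto
  then have "K * Q.Q_const f * (t powr \<delta> / \<delta>) \<le> K * Q.Q_const f * (1 / \<delta>)"
    using P.K_nonneg Q_const_nonneg by (intro mult_left_mono) auto
  moreover have "norm (P0 (t + e) f) \<le> K * norm f" using t by (intro P_bound) auto
  ultimately show ?thesis
    using norm_Pe_diff_le[OF te, of f] norm_triangle_sub[of "Pe t e f" "P0 (t + e) f"]
    unfolding Pe_const_def by linarith
qed

lemma C0_Pe:
  assumes "(t, e) \<in> time_region" "bb_fun f \<in> C0"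
  shows "bb_fun (Pe t e f) \<in> C0"
  unfolding Pe_eq using assms
  by (intro C0_add P.C0_invariant P.C0_conv[OF Qs_curve] Q.C0_Q_sum) (auto simp: time_region_def)

text \<open>Strong continuity at time zero makes \<open>P0\<close>, extended by the identity, continuous on \<open>[0, 1]\<close> when applied
to a function vanishing at infinity.\<close>

definition P0_ext :: "real \<Rightarrow> 'a bborel \<Rightarrow> 'a bborel" where
  "P0_ext e f = (if e = 0 then f else P0 e f)"

lemma norm_P0_ext_diff_le:
  assumes "e \<in> {0..1}"
  shows "norm (P0_ext e f - P0_ext e g) \<le> (K + 1) * norm (f - g)"
proof (cases "e = 0")
  case False
  then have e: "e \<in> {0<..1}" using assms by auto
  have "norm (P0 e f - P0 e g) = norm (P0 e (f - g))" by (simp add: linear_diff[OF P.lin[OF e]])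
  also have "\<dots> \<le> K * norm (f - g)" by (rule P_bound[OF e])
  also have "\<dots> \<le> (K + 1) * norm (f - g)" by (intro mult_right_mono) auto
  finally show ?thesis using False by (simp add: P0_ext_def)
qed (use P.K_nonneg in \<open>auto simp: P0_ext_def distrib_right\<close>)

lemma norm_P0_ext_le: "e \<in> {0..1} \<Longrightarrow> norm (P0_ext e f) \<le> (K + 1) * norm f"
  using norm_P0_ext_diff_le[of e f 0] linear_0[OF P.lin[of e]] by (auto simp: P0_ext_def split: if_splits)

lemma continuous_on_P0_ext:
  assumes f: "bb_fun f \<in> C0"
  shows "continuous_on {0..1} (\<lambda>e. P0_ext e f)"
  unfolding continuous_on_eq_continuous_within
proof
  fix e :: real assume e: "e \<in> {0..1}"
  show "continuous (at e within {0..1}) (\<lambda>e. P0_ext e f)"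
  proof (cases "e = 0")
    case True
    have "((\<lambda>t. P0 t f) \<longlongrightarrow> f) (at 0 within {0..1})"
      using P_zero[OF f] by (simp add: at_within_Icc_at_right)
    then have "((\<lambda>t. P0_ext t f) \<longlongrightarrow> f) (at 0 within {0..1})"
      by (rule Lim_transform_eventually) (auto simp: eventually_at_filter P0_ext_def)
    with True show ?thesis by (simp add: continuous_within P0_ext_def)
  next
    case False
    then have e': "e \<in> {0<..1}" using e by auto
    have "at e within {0..1} = at e within {0<..1}"
      using e' by (intro at_within_nhd[of _ "{0<..}"]) auto
    moreover have "continuous_on {0<..1} (\<lambda>e. P0_ext e f)"
      using P.cont[of f] by (rule continuous_on_eq) (auto simp: P0_ext_def)
    ultimately show ?thesis using e' by (auto simp: continuous_on_eq_continuous_within)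
  qed
qed

text \<open>The right-hand side of the equation for the regularized parametrix, extended to \<open>e = 0\<close>.\<close>

definition residual :: "'a bborel \<Rightarrow> real \<Rightarrow> real \<Rightarrow> 'a bborel" where
  "residual f t e = P0_ext e (Qs f t) - Q0 (t + e) f - Q.conv (Qs f) t e"

text \<open>A reformulation of the Volterra equation: without regularization the parametrix is an exact formal solution.\<close>

lemma residual_zero: "t \<in> {0<..1} \<Longrightarrow> residual f t 0 = 0"
  using Q.Volterra_equation[of t f] by (simp add: residual_def P0_ext_def)

definition residual_const :: "'a bborel \<Rightarrow> real" where
  "residual_const f = (K + 1) * Q.Q_const f + K * norm f + K * Q.Q_const f * (exp 1 * kernel_const \<delta>)"

lemma norm_residual_le:
  assumes te: "(t, e) \<in> time_region"
  shows "norm (residual f t e) \<le> residual_const f * t powr (\<delta> - 1)"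
proof -
  have t: "0 < t" "0 \<le> e" "t + e \<le> 1" using te by (auto simp: time_region_def)
  have "norm (P0_ext e (Qs f t)) \<le> (K + 1) * norm (Qs f t)" using t by (intro norm_P0_ext_le) auto
  also have "\<dots> \<le> (K + 1) * (Q.Q_const f * t powr (\<delta> - 1))"
    using t P.K_nonneg by (intro mult_left_mono Qs_bound) auto
  finally have 1: "norm (P0_ext e (Qs f t)) \<le> (K + 1) * Q.Q_const f * t powr (\<delta> - 1)" by (simp add: mult.assoc)
  have "norm (Q0 (t + e) f) \<le> K * (t + e) powr (\<delta> - 1) * norm f" using t by (intro Q.bound) auto
  also have "\<dots> \<le> K * t powr (\<delta> - 1) * norm f"
    using t P.K_nonneg P.delta by (intro mult_right_mono mult_left_mono powr_mono2') auto
  finally have 2: "norm (Q0 (t + e) f) \<le> K * norm f * t powr (\<delta> - 1)" by (simp add: mult_ac)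
  have "norm (residual f t e) \<le> norm (P0_ext e (Qs f t)) + norm (Q0 (t + e) f) + norm (Q.conv (Qs f) t e)"
    unfolding residual_def by (intro order_trans[OF norm_triangle_ineq4] add_mono norm_triangle_ineq4 order_refl)
  also have "\<dots> \<le> (K + 1) * Q.Q_const f * t powr (\<delta> - 1) + K * norm f * t powr (\<delta> - 1)
      + K * Q.Q_const f * (exp 1 * kernel_const \<delta>) * t powr (\<delta> - 1)"
    by (intro add_mono 1 2 Q.norm_conv_le[OF Qs_curve te])
  finally show ?thesis by (simp add: residual_const_def distrib_right)
qed

lemma continuous_on_residual:
  assumes f: "bb_fun f \<in> C0"
  shows "continuous_on time_region (\<lambda>p. residual f (fst p) (snd p))"
proof -
  have "continuous_on time_region (\<lambda>p. P0_ext (snd p) (Qs f (fst p)))"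
    unfolding continuous_on_sequentially
  proof (intro allI ballI impI)
    fix X :: "nat \<Rightarrow> real \<times> real" and p
    assume p: "p \<in> time_region" and "(\<forall>n. X n \<in> time_region) \<and> X \<longlonglongrightarrow> p"
    then have X: "\<And>n. X n \<in> time_region" and l: "(\<lambda>n. fst (X n)) \<longlonglongrightarrow> fst p" "(\<lambda>n. snd (X n)) \<longlonglongrightarrow> snd p"
      by (auto intro: tendsto_fst tendsto_snd)
    have r: "fst q \<in> {0<..1}" "snd q \<in> {0..1}" if "q \<in> time_region" for q
      using that by (auto simp: time_region_def)
    have "(\<lambda>n. Qs f (fst (X n))) \<longlonglongrightarrow> Qs f (fst p)"
      using Qs_curve[of f] continuous_on_tendsto_compose[of "{0<..1}" "Qs f", OF _ l(1) r(1)[OF p]] r(1)[OF X]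
      by (simp add: singular_curve_def)
    then have "(\<lambda>n. (K + 1) * norm (Qs f (fst (X n)) - Qs f (fst p))) \<longlonglongrightarrow> 0"
      by (intro tendsto_mult_right_zero tendsto_norm_zero) (simp add: LIM_zero)
    then have "(\<lambda>n. P0_ext (snd (X n)) (Qs f (fst (X n))) - P0_ext (snd (X n)) (Qs f (fst p))) \<longlonglongrightarrow> 0"
      by (rule Lim_null_comparison[rotated]) (intro always_eventually allI norm_P0_ext_diff_le r X)
    moreover have "(\<lambda>n. P0_ext (snd (X n)) (Qs f (fst p))) \<longlonglongrightarrow> P0_ext (snd p) (Qs f (fst p))"
      using continuous_on_tendsto_compose[OF continuous_on_P0_ext[OF Q.C0_Q_sum[OF r(1)[OF p] f]] l(2) r(2)[OF p]] r(2)[OF X]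
      by simp
    ultimately have "(\<lambda>n. (P0_ext (snd (X n)) (Qs f (fst (X n))) - P0_ext (snd (X n)) (Qs f (fst p)))
        + P0_ext (snd (X n)) (Qs f (fst p))) \<longlonglongrightarrow> 0 + P0_ext (snd p) (Qs f (fst p))"
      by (rule tendsto_add)
    then show "((\<lambda>p. P0_ext (snd p) (Qs f (fst p))) \<circ> X) \<longlonglongrightarrow> P0_ext (snd p) (Qs f (fst p))"
      by (simp add: o_def)
  qed
  then show ?thesis
    unfolding residual_def
    by (intro continuous_on_diff Q.continuous_on_conv[OF Qs_curve] continuous_on_family_sum Q.cont)
qed

definition Pe_integral :: "'a bborel \<Rightarrow> real \<Rightarrow> real \<Rightarrow> 'a bborel" where
  "Pe_integral g t e = set_Bochner_integral lborel {0<..<t} (\<lambda>s. Pe s e g)"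

lemma Pe_integral_integrable:
  assumes te: "(t, e) \<in> time_region"
  shows "Bochner_integrable lborel (\<lambda>s. indicat_real {0<..<t} s *\<^sub>R Pe s e g)"
proof (rule Bochner_integrableI)
  have t: "0 < t" "0 \<le> e" "t + e \<le> 1" using te by (auto simp: time_region_def)
  have "continuous_on {0<..1} (\<lambda>s. (min s t, e))" by (intro continuous_intros)
  from continuous_on_compose2[OF continuous_on_Pe[of g] this] t
  have "continuous_on {0<..1} (\<lambda>s. Pe (min s t) e g)"
    by (auto simp: time_region_def image_subset_iff min_def)
  then have "strongly_measurable lborel (\<lambda>s. indicat_real {0<..<t} s *\<^sub>R Pe (min s t) e g)"
    using t by (intro strongly_measurable_continuous) auto
  also have "(\<lambda>s. indicat_real {0<..<t} s *\<^sub>R Pe (min s t) e g) = (\<lambda>s. indicat_real {0<..<t} s *\<^sub>R Pe s e g)"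
  proof
    fix s show "indicat_real {0<..<t} s *\<^sub>R Pe (min s t) e g = indicat_real {0<..<t} s *\<^sub>R Pe s e g"
      by (cases "s \<in> {0<..<t}") auto
  qed
  finally show "strongly_measurable lborel (\<lambda>s. indicat_real {0<..<t} s *\<^sub>R Pe s e g)" .
  show "integrable lborel (\<lambda>s. Pe_const g * indicat_real {0<..<t} s)"
    using t by (intro integrable_mult_right integrable_real_indicator) auto
  show "norm (indicat_real {0<..<t} s *\<^sub>R Pe s e g) \<le> Pe_const g * indicat_real {0<..<t} s" for s
    using t norm_Pe_le[of s e g] by (auto simp: indicator_def time_region_def)
qed

lemma continuous_on_Pe_integral: "continuous_on time_region (\<lambda>p. Pe_integral g (fst p) (snd p))"
  unfolding Pe_integral_def
proof (rule continuous_on_set_Bochner_integral[where b = "\<lambda>p. fst p * Pe_const g" and k = "\<lambda>_. 1"])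
  have r: "(fst p * v, snd p) \<in> time_region" if "p \<in> time_region" "0 < v" "v < 1" for p and v :: real
  proof -
    have *: "0 < fst p" "0 \<le> snd p" "fst p + snd p \<le> 1" using that by (auto simp: time_region_def)
    have "0 < fst p * v" "fst p * v < fst p" using * that by simp_all
    with * show ?thesis by (simp add: time_region_def) 
  qed
  show "continuous_on time_region (\<lambda>p. Pe (fst p * v) (snd p) g)" if v: "0 < v" "v < 1" for v
  proof -
    have "continuous_on time_region (\<lambda>p. (fst p * v, snd p))" by (intro continuous_intros)
    from continuous_on_compose2[OF continuous_on_Pe[of g] this] r[OF _ v] show ?thesis
      by (simp add: image_subset_iff)
  qed
  show "norm (fst p *\<^sub>R Pe (fst p * v) (snd p) g) \<le> fst p * Pe_const g * 1"
    if "p \<in> time_region" "0 < v" "v < 1" for p v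
    using norm_Pe_le[OF r[OF that], of g] that by (auto simp: time_region_def intro: mult_left_mono)
  show "Bochner_integrable lborel (\<lambda>s. indicat_real {0<..<fst p} s *\<^sub>R Pe s (snd p) g)"
    if "p \<in> time_region" for p
    using that by (intro Pe_integral_integrable) simp
qed (auto intro!: continuous_intros simp: time_region_def)

lemma bb_fun_Pe_integral:
  assumes te: "(t, e) \<in> time_region"
  shows "set_integrable lborel {0<..<t} (\<lambda>s. bb_fun (Pe s e g) x)"
    "bb_fun (Pe_integral g t e) x = (LBINT s:{0<..<t}. bb_fun (Pe s e g) x)"
  using bb_fun_Bochner_integral[OF Pe_integral_integrable[OF te], of g x]
  by (auto simp: Pe_integral_def set_Bochner_integral_def set_integrable_def set_lebesgue_integral_def bb_fun_simps)

lemma norm_Pe_integral_le: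
  assumes te: "(t, e) \<in> time_region"
  shows "norm (Pe_integral g t e) \<le> Pe_const g * t"
proof -
  have t: "0 < t" "0 \<le> e" "t + e \<le> 1" using te by (auto simp: time_region_def)
  have "norm (Pe_integral g t e) \<le> (\<integral>s. norm (indicat_real {0<..<t} s *\<^sub>R Pe s e g) \<partial>lborel)"
    unfolding Pe_integral_def set_Bochner_integral_def by (rule norm_Bochner_integral_le[OF Pe_integral_integrable[OF te]])
  also have "\<dots> \<le> (\<integral>s. Pe_const g * indicat_real {0<..<t} s \<partial>lborel)"
  proof (rule integral_mono[OF Bochner_integrable_norm[OF Pe_integral_integrable[OF te]]])
    show "integrable lborel (\<lambda>s. Pe_const g * indicat_real {0<..<t} s)"
      using t by (intro integrable_mult_right integrable_real_indicator) auto
    show "norm (indicat_real {0<..<t} s *\<^sub>R Pe s e g) \<le> Pe_const g * indicat_real {0<..<t} s" for s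
      using t norm_Pe_le[of s e g] by (auto simp: indicator_def time_region_def)
  qed
  also have "\<dots> = Pe_const g * t" using t by simp
  finally show ?thesis .
qed

lemma C0_Pe_integral: "(t, e) \<in> time_region \<Longrightarrow> bb_fun g \<in> C0 \<Longrightarrow> bb_fun (Pe_integral g t e) \<in> C0"
  unfolding Pe_integral_def
  by (rule C0_set_Bochner_integral[OF Pe_integral_integrable]) (auto intro!: C0_Pe simp: time_region_def)

lemma Pe_at_zero: "Pe 0 e f = P0 e f"
proof -
  have "Bochner_integrable lborel (\<lambda>s::real. 0 :: 'a bborel)"
    by (rule Bochner_integrableI[where g = "\<lambda>_. 0"]) auto
  from norm_Bochner_integral_le[OF this] have "Bochner_integral lborel (\<lambda>s::real. 0 :: 'a bborel) = 0" by simp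
  then show ?thesis by (simp add: P_eps_def set_Bochner_integral_def)
qed

lemma continuous_on_Pe_from_zero:
  assumes e: "0 < e" "e < 1"
  shows "continuous_on {0..1 - e} (\<lambda>s. Pe s e g)"
  unfolding continuous_on_eq_continuous_within
proof
  fix s assume s: "s \<in> {0..1 - e}"
  show "continuous (at s within {0..1 - e}) (\<lambda>s. Pe s e g)"
  proof (cases "s = 0")
    case True
    have "continuous_on {0..1 - e} (\<lambda>s. P0 (s + e) g)"
      by (rule continuous_on_compose2[OF P.cont]) (use e in \<open>auto intro!: continuous_intros\<close>)
    then have "((\<lambda>s. P0 (s + e) g) \<longlongrightarrow> P0 (0 + e) g) (at 0 within {0..1 - e})"
      unfolding continuous_on_def using e by (elim bspec) auto
    moreover have "((\<lambda>s. Pe s e g - P0 (s + e) g) \<longlongrightarrow> 0) (at 0 within {0..1 - e})"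
    proof (rule Lim_null_comparison)
      show "\<forall>\<^sub>F s in at 0 within {0..1 - e}. norm (Pe s e g - P0 (s + e) g) \<le> K * Q.Q_const g * (s powr \<delta> / \<delta>)"
        unfolding eventually_at_filter
        by (intro always_eventually allI impI norm_Pe_diff_le) (use e in \<open>auto simp: time_region_def\<close>)
      have "((\<lambda>s. K * Q.Q_const g * (s powr \<delta> / \<delta>)) \<longlongrightarrow> K * Q.Q_const g * (0 / \<delta>)) (at_right 0)"
        using P.delta by (intro tendsto_intros tendsto_powr_at_right_zero) auto
      then show "((\<lambda>s. K * Q.Q_const g * (s powr \<delta> / \<delta>)) \<longlongrightarrow> 0) (at 0 within {0..1 - e})"
        using e by (simp add: at_within_Icc_at_right)
    qed
    ultimately have "((\<lambda>s. P0 (s + e) g + (Pe s e g - P0 (s + e) g)) \<longlongrightarrow> P0 (0 + e) g + 0) (at 0 within {0..1 - e})"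
      by (rule tendsto_add)
    with True show ?thesis by (simp add: continuous_within Pe_at_zero)
  next
    case False
    then have s': "s \<in> {0<..1 - e}" using s by auto
    have "continuous_on {0<..1 - e} (\<lambda>s. (s, e))" by (intro continuous_intros)
    from continuous_on_compose2[OF continuous_on_Pe[of g] this] e
    have "continuous_on {0<..1 - e} (\<lambda>s. Pe s e g)" by (simp add: time_region_def image_subset_iff)
    moreover have "at s within {0..1 - e} = at s within {0<..1 - e}"
      using s' by (intro at_within_nhd[of _ "{0<..}"]) auto
    ultimately show ?thesis using s' by (auto simp: continuous_on_eq_continuous_within)
  qed
qed

lemma bb_fun_continuous_on: "continuous_on S F \<Longrightarrow> continuous_on S (\<lambda>s. bb_fun (F s) x)"
  by (rule bounded_linear.continuous_on[OF bounded_linear_bb_fun])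

text \<open>The fundamental theorem of calculus for the continuous integrand; for \<open>e > 0\<close> it is continuous up to time zero.\<close>

lemma Pe_integral_has_derivative:
  assumes e: "0 < e" "e < 1" and t: "t \<in> {0<..1 - e}"
  shows "((\<lambda>u. bb_fun (Pe_integral g u e) x) has_vector_derivative bb_fun (Pe t e g) x) (at t within {0<..1 - e})"
proof -
  let ?h = "\<lambda>s. bb_fun (Pe s e g) x"
  have c: "continuous_on {0..1 - e} ?h"
    by (rule bb_fun_continuous_on[OF continuous_on_Pe_from_zero[OF e]])
  have "((\<lambda>u. integral {0..u} ?h) has_vector_derivative ?h t) (at t within {0..1 - e})"
    by (rule integral_has_vector_derivative[OF c]) (use t in auto)
  then have "((\<lambda>u. integral {0..u} ?h) has_vector_derivative ?h t) (at t within {0<..1 - e})"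
    by (rule has_vector_derivative_within_subset) auto
  then show ?thesis
  proof (rule has_vector_derivative_transform[OF t, rotated])
    fix u assume u: "u \<in> {0<..1 - e}"
    then have ue: "(u, e) \<in> time_region" using e by (auto simp: time_region_def)
    show "bb_fun (Pe_integral g u e) x = integral {0..u} ?h"
      unfolding bb_fun_Pe_integral(2)[OF ue] set_borel_integral_eq_integral(2)[OF bb_fun_Pe_integral(1)[OF ue]]
      using integral_open_interval[of 0 u ?h] by (simp add: box_real)
  qed
qed

lemma residual_integrable:
  assumes te: "(t, e) \<in> time_region" and g: "bb_fun g \<in> C0"
  shows "Bochner_integrable lborel (\<lambda>s. indicat_real {0<..<t} s *\<^sub>R residual g s e)"
proof (rule Bochner_integrableI)
  have t: "0 < t" "0 \<le> e" "t + e \<le> 1" using te by (auto simp: time_region_def)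
  have "continuous_on {0<..1} (\<lambda>s. (min s t, e))" by (intro continuous_intros)
  from continuous_on_compose2[OF continuous_on_residual[OF g] this] t
  have "continuous_on {0<..1} (\<lambda>s. residual g (min s t) e)"
    by (auto simp: time_region_def image_subset_iff min_def)
  then have "strongly_measurable lborel (\<lambda>s. indicat_real {0<..<t} s *\<^sub>R residual g (min s t) e)"
    using t by (intro strongly_measurable_continuous) auto
  also have "(\<lambda>s. indicat_real {0<..<t} s *\<^sub>R residual g (min s t) e) = (\<lambda>s. indicat_real {0<..<t} s *\<^sub>R residual g s e)"
  proof
    fix s show "indicat_real {0<..<t} s *\<^sub>R residual g (min s t) e = indicat_real {0<..<t} s *\<^sub>R residual g s e"
      by (cases "s \<in> {0<..<t}") auto
  qed
  finally show "strongly_measurable lborel (\<lambda>s. indicat_real {0<..<t} s *\<^sub>R residual g s e)" .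
  show "integrable lborel (\<lambda>s. residual_const g * (s powr (\<delta> - 1) * indicat_real {0<..<t} s))"
    using t by (intro integrable_mult_right integrable_powr P.delta) auto
  show "norm (indicat_real {0<..<t} s *\<^sub>R residual g s e) \<le> residual_const g * (s powr (\<delta> - 1) * indicat_real {0<..<t} s)" for s
    using t norm_residual_le[of s e g] by (cases "s \<in> {0<..<t}") (auto simp: time_region_def)
qed

text \<open>Bounds the time integral of the residual at every point simultaneously.\<close>

definition residual_mass :: "'a bborel \<Rightarrow> real \<Rightarrow> real \<Rightarrow> real" where
  "residual_mass g t e = (\<integral>s. norm (indicat_real {0<..<t} s *\<^sub>R residual g s e) \<partial>lborel)"

lemma residual_mass_mono:
  assumes T: "(T, e) \<in> time_region" and g: "bb_fun g \<in> C0" and t: "0 < t" "t \<le> T"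
  shows "residual_mass g t e \<le> residual_mass g T e"
proof -
  have te: "(t, e) \<in> time_region" using T t by (auto simp: time_region_def)
  show ?thesis
    unfolding residual_mass_def
    by (rule integral_mono[OF Bochner_integrable_norm[OF residual_integrable[OF te g]]
          Bochner_integrable_norm[OF residual_integrable[OF T g]]])
      (use t in \<open>auto simp: indicator_def\<close>)
qed

lemma integral_residual_le:
  assumes te: "(t, e) \<in> time_region" and g: "bb_fun g \<in> C0"
  shows "set_integrable lborel {0<..<t} (\<lambda>s. bb_fun (residual g s e) x)"
    "\<bar>LBINT s:{0<..<t}. bb_fun (residual g s e) x\<bar> \<le> residual_mass g t e"
proof -
  note I = residual_integrable[OF te g]
  show "set_integrable lborel {0<..<t} (\<lambda>s. bb_fun (residual g s e) x)"
    using bb_fun_Bochner_integral(1)[OF I, of x] by (simp add: set_integrable_def bb_fun_simps)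
  have "(LBINT s:{0<..<t}. bb_fun (residual g s e) x) = bb_fun (Bochner_integral lborel (\<lambda>s. indicat_real {0<..<t} s *\<^sub>R residual g s e)) x"
    using bb_fun_Bochner_integral(2)[OF I, of x] by (simp add: set_lebesgue_integral_def bb_fun_simps)
  also have "\<bar>\<dots>\<bar> \<le> residual_mass g t e"
    unfolding residual_mass_def by (rule order_trans[OF abs_bb_fun_le_norm norm_Bochner_integral_le[OF I]])
  finally show "\<bar>LBINT s:{0<..<t}. bb_fun (residual g s e) x\<bar> \<le> residual_mass g t e" .
qed

lemma residual_mass_tendsto_0:
  assumes g: "bb_fun g \<in> C0" and T: "0 < T" and e: "\<And>n. 0 \<le> e n" "\<And>n. T + e n \<le> 1" "e \<longlonglongrightarrow> 0"
  shows "(\<lambda>n. residual_mass g T (e n)) \<longlonglongrightarrow> 0"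
proof -
  have tr: "(T, e n) \<in> time_region" for n using T e by (auto simp: time_region_def)
  have "(\<lambda>n. residual_mass g T (e n)) \<longlonglongrightarrow> (\<integral>s. (\<lambda>_::real. 0) s \<partial>lborel)"
    unfolding residual_mass_def
  proof (rule integral_dominated_convergence[where w = "\<lambda>s. residual_const g * (s powr (\<delta> - 1) * indicat_real {0<..<T} s)"])
    show "integrable lborel (\<lambda>s. residual_const g * (s powr (\<delta> - 1) * indicat_real {0<..<T} s))"
      using T by (intro integrable_mult_right integrable_powr P.delta) auto
    show "AE s in lborel. norm (norm (indicat_real {0<..<T} s *\<^sub>R residual g s (e n)))
        \<le> residual_const g * (s powr (\<delta> - 1) * indicat_real {0<..<T} s)" for n
    proof (rule AE_I2)
      fix s :: real
      show "norm (norm (indicat_real {0<..<T} s *\<^sub>R residual g s (e n)))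
        \<le> residual_const g * (s powr (\<delta> - 1) * indicat_real {0<..<T} s)"
        using tr[of n] norm_residual_le[of s "e n" g] by (cases "s \<in> {0<..<T}") (auto simp: time_region_def)
    qed
    show "AE s in lborel. (\<lambda>n. norm (indicat_real {0<..<T} s *\<^sub>R residual g s (e n))) \<longlonglongrightarrow> 0"
    proof (rule AE_I2)
      fix s :: real
      show "(\<lambda>n. norm (indicat_real {0<..<T} s *\<^sub>R residual g s (e n))) \<longlonglongrightarrow> 0"
      proof (cases "s \<in> {0<..<T}")
        case True
        have s1: "s + e n \<le> 1" "s \<le> 1" for n using True e(1,2)[of n] by auto
        have "(\<lambda>n. residual g (fst (s, e n)) (snd (s, e n))) \<longlonglongrightarrow> residual g (fst (s, 0::real)) (snd (s, 0::real))"
          using True s1 e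
          by (intro continuous_on_tendsto_compose[OF continuous_on_residual[OF g], of "\<lambda>n. (s, e n)"] tendsto_Pair tendsto_const)
            (auto simp: time_region_def)
        then have "(\<lambda>n. residual g s (e n)) \<longlonglongrightarrow> 0"
          using True s1 residual_zero[of s g] by simp
        then show ?thesis using True by (simp add: tendsto_norm_zero)
      qed simp
    qed
    show "(\<lambda>s. norm (indicat_real {0<..<T} s *\<^sub>R residual g s (e n))) \<in> borel_measurable lborel" for n
      using Bochner_integrable_norm[OF residual_integrable[OF tr g]] by (rule borel_measurable_integrable)
  qed simp
  then show ?thesis by simp
qed

text \<open>The residual is uniformly continuous on a compact set of pairs \<open>(t, e)\<close> and vanishes at \<open>e = 0\<close>.\<close>

lemma residual_uniformly_small:
  assumes f: "bb_fun f \<in> C0" and T: "0 < \<tau>" "T < 1"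
    and e: "\<And>n. 0 \<le> e n" "\<And>n. T + e n \<le> 1" "e \<longlonglongrightarrow> 0" and d: "0 < d"
  shows "\<forall>\<^sub>F n in sequentially. \<forall>t\<in>{\<tau>..T}. norm (residual f t (e n)) < d"
proof -
  have "{\<tau>..T} \<times> {0..1-T} \<subseteq> time_region" using T by (auto simp: time_region_def)
  from continuous_on_subset[OF continuous_on_residual[OF f] this]
  have "uniformly_continuous_on ({\<tau>..T} \<times> {0..1-T}) (\<lambda>p. residual f (fst p) (snd p))"
    by (intro compact_uniformly_continuous compact_Times) auto
  then obtain \<eta> where eta: "\<eta> > 0" "\<And>p q. p \<in> {\<tau>..T} \<times> {0..1-T} \<Longrightarrow> q \<in> {\<tau>..T} \<times> {0..1-T} \<Longrightarrow>
      dist q p < \<eta> \<Longrightarrow> dist (residual f (fst q) (snd q)) (residual f (fst p) (snd p)) < d"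
    using d unfolding uniformly_continuous_on_def by meson
  have "\<forall>\<^sub>F n in sequentially. e n < \<eta>" using e(3) eta(1) by (rule order_tendstoD(2))
  then show ?thesis
  proof eventually_elim
    case (elim n)
    show ?case
    proof
      fix t assume t: "t \<in> {\<tau>..T}"
      have "dist (residual f t (e n)) (residual f t 0) < d"
        using eta(2)[of "(t, 0)" "(t, e n)"] t T elim e(1)[of n] e(2)[of n] by (simp add: dist_Pair_Pair)
      then show "norm (residual f t (e n)) < d" using residual_zero[of t f] t T by simp
    qed
  qed
qed

text \<open>The amount by which the regularized parametrix fails to satisfy the claimed identity.\<close>

definition defect :: "'a bborel \<Rightarrow> 'a bborel \<Rightarrow> real \<Rightarrow> real \<Rightarrow> 'a bborel" where
  "defect f g t e = Pe t e f - f - Pe_integral g t e"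

lemma continuous_on_defect: "continuous_on time_region (\<lambda>p. defect f g (fst p) (snd p))"
  unfolding defect_def by (intro continuous_intros continuous_on_Pe continuous_on_Pe_integral)

lemma defect_tendsto:
  assumes T: "0 < T" and e: "\<And>n. 0 \<le> e n" "\<And>n. T + e n \<le> 1" "e \<longlonglongrightarrow> 0"
  shows "(\<lambda>n. defect f g T (e n)) \<longlonglongrightarrow> defect f g T 0"
proof -
  have "T \<le> 1" using e(1,2)[of 0] by simp
  moreover have "(\<lambda>n. (T, e n)) \<longlonglongrightarrow> (T, 0)" by (intro tendsto_Pair tendsto_const e)
  from continuous_on_tendsto_compose[OF continuous_on_defect[of f g] this]
  have "T \<le> 1 \<Longrightarrow> (\<lambda>n. defect f g T (e n)) \<longlonglongrightarrow> defect f g T 0"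
    using T e by (simp add: time_region_def)
  ultimately show ?thesis by blast
qed

lemma defect_at_zero:
  assumes f: "bb_fun f \<in> C0"
  shows "((\<lambda>t. defect f g t 0) \<longlongrightarrow> 0) (at_right 0)"
proof (rule Lim_null_comparison)
  have "((\<lambda>t. norm (P0 t f - f) + K * Q.Q_const f * (t powr \<delta> / \<delta>) + Pe_const g * t)
    \<longlongrightarrow> norm (f - f) + K * Q.Q_const f * (0 / \<delta>) + Pe_const g * 0) (at_right 0)"
    using P.delta
    by (intro tendsto_intros tendsto_powr_at_right_zero P_zero f) auto
  then show "((\<lambda>t. norm (P0 t f - f) + K * Q.Q_const f * (t powr \<delta> / \<delta>) + Pe_const g * t) \<longlongrightarrow> 0) (at_right 0)"
    by simp
  have "\<forall>\<^sub>F t::real in at_right 0. t \<in> {0<..<1}" by (rule eventually_at_right_real) simp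
  then show "\<forall>\<^sub>F t in at_right 0. norm (defect f g t 0) \<le> norm (P0 t f - f) + K * Q.Q_const f * (t powr \<delta> / \<delta>) + Pe_const g * t"
  proof eventually_elim
    case (elim t)
    then have t: "(t, 0) \<in> time_region" by (simp add: time_region_def)
    have "defect f g t 0 = (P0 t f - f) + (Pe t 0 f - P0 (t + 0) f) - Pe_integral g t 0" by (simp add: defect_def)
    then have "norm (defect f g t 0) \<le> norm (P0 t f - f) + norm (Pe t 0 f - P0 (t + 0) f) + norm (Pe_integral g t 0)"
      using norm_triangle_ineq4[of "(P0 t f - f) + (Pe t 0 f - P0 (t + 0) f)" "Pe_integral g t 0"]
        norm_triangle_ineq[of "P0 t f - f" "Pe t 0 f - P0 (t + 0) f"] by simp
    with norm_Pe_diff_le[OF t, of f] norm_Pe_integral_le[OF t, of g] show ?case by linarith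
  qed
qed

end

text \<open>The differential hypotheses on \<open>L\<close>, expressed in terms of the residual.\<close>

section \<open>The integrated Kolmogorov equation\<close>

locale parametrix_generator = parametrix +
  fixes DL :: "('a \<Rightarrow> real) set" and L :: "('a \<Rightarrow> real) \<Rightarrow> 'a \<Rightarrow> real"
  assumes linear_L: "linear_operator_on DL L"
    and pmp: "positive_maximum_principle DL L"
    and differentiable: "\<And>t e f x. 0 < t \<Longrightarrow> 0 < e \<Longrightarrow> t + e \<le> 1 \<Longrightarrow> bb_fun f \<in> C0 \<Longrightarrow>
      P_eps_differentiable P0 Q0 t e f x"
    and domain: "\<And>t e f. 0 < t \<Longrightarrow> 0 < e \<Longrightarrow> t + e \<le> 1 \<Longrightarrow> bb_fun f \<in> C0 \<Longrightarrow>
      bb_fun (Pe t e f) \<in> DL \<and> bb_fun (Pe_integral f t e) \<in> DL"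
    and evolution: "\<And>t e f x. 0 < t \<Longrightarrow> 0 < e \<Longrightarrow> t + e \<le> 1 \<Longrightarrow> bb_fun f \<in> C0 \<Longrightarrow>
      dt_P_eps P0 Q0 t e f x - L (bb_fun (Pe t e f)) x = bb_fun (residual f t e) x"
    and integrable_dt: "\<And>e f x. 0 < e \<Longrightarrow> e < 1 \<Longrightarrow> bb_fun f \<in> C0 \<Longrightarrow>
      set_integrable lborel {0<..<1-e} (\<lambda>s. dt_P_eps P0 Q0 s e f x)"
    and L_Pe_integral: "\<And>t e f x. 0 < t \<Longrightarrow> 0 < e \<Longrightarrow> t + e \<le> 1 \<Longrightarrow> bb_fun f \<in> C0 \<Longrightarrow>
      L (bb_fun (Pe_integral f t e)) x = (LBINT s:{0<..<t}. L (bb_fun (Pe s e f)) x)"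
begin

lemma Pe_has_derivative:
  assumes "0 < t" "0 < e" "t + e \<le> 1" "bb_fun f \<in> C0"
  shows "((\<lambda>u. bb_fun (Pe u e f) x) has_vector_derivative dt_P_eps P0 Q0 t e f x) (at t within {0<..1-e})"
  using differentiable[OF assms, of x]
  unfolding P_eps_differentiable_def dt_P_eps_def vector_derivative_works .

text \<open>The fundamental theorem of calculus for a derivative that exists everywhere and is Lebesgue integrable; the
derivative need not be continuous.\<close>

lemma integral_dt:
  assumes t: "0 < t" "0 < e" "t + e \<le> 1" and g: "bb_fun g \<in> C0"
  shows "set_integrable lborel {0<..<t} (\<lambda>s. dt_P_eps P0 Q0 s e g x)"
    "(LBINT s:{0<..<t}. dt_P_eps P0 Q0 s e g x) = bb_fun (Pe t e g) x - bb_fun (P0 e g) x"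
proof -
  let ?d = "\<lambda>s. dt_P_eps P0 Q0 s e g x"
  show I: "set_integrable lborel {0<..<t} ?d"
    by (rule set_integrable_subset[OF integrable_dt[OF _ _ g]]) (use t in auto)
  have "(?d has_integral bb_fun (Pe t e g) x - bb_fun (Pe 0 e g) x) {0..t}"
  proof (rule fundamental_theorem_of_calculus_interior)
    show "continuous_on {0..t} (\<lambda>s. bb_fun (Pe s e g) x)"
      by (rule continuous_on_subset[OF bb_fun_continuous_on[OF continuous_on_Pe_from_zero]]) (use t in auto)
    fix s assume s: "s \<in> {0<..<t}"
    have "((\<lambda>u. bb_fun (Pe u e g) x) has_vector_derivative ?d s) (at s within {0<..1-e})"
      using s t by (intro Pe_has_derivative g) auto
    moreover have "at s within {0<..1-e} = at s"
      using s t by (intro at_within_open_subset[of _ "{0<..<t}"]) auto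
    ultimately show "((\<lambda>u. bb_fun (Pe u e g) x) has_vector_derivative ?d s) (at s)" by simp
  qed (use t in auto)
  then have "integral {0..t} ?d = bb_fun (Pe t e g) x - bb_fun (P0 e g) x"
    by (simp add: integral_unique Pe_at_zero)
  then show "(LBINT s:{0<..<t}. ?d s) = bb_fun (Pe t e g) x - bb_fun (P0 e g) x"
    unfolding set_borel_integral_eq_integral(2)[OF I]
    using integral_open_interval[of 0 t ?d] by (simp add: box_real)
qed

context
  fixes f g :: "'a bborel"
  assumes f: "bb_fun f \<in> C0" "bb_fun f \<in> DL" and g: "bb_fun g \<in> C0" and fg: "L (bb_fun f) = bb_fun g"
begin

lemma defect_domain:
  assumes t: "0 < t" "0 < e" "t + e \<le> 1"
  shows "bb_fun (defect f g t e) \<in> C0 \<inter> DL"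
    and "L (bb_fun (defect f g t e)) x = L (bb_fun (Pe t e f)) x - bb_fun g x - L (bb_fun (Pe_integral g t e)) x"
proof -
  have te: "(t, e) \<in> time_region" using t by (simp add: time_region_def)
  have eq: "bb_fun (defect f g t e) = (\<lambda>x. (\<lambda>x. bb_fun (Pe t e f) x + (\<lambda>x. - 1 * bb_fun f x) x) x + (\<lambda>x. - 1 * bb_fun (Pe_integral g t e) x) x)"
    by (simp add: defect_def bb_fun_simps fun_eq_iff)
  have D: "bb_fun (Pe t e f) \<in> DL" "bb_fun (Pe_integral g t e) \<in> DL" using domain t f(1) g by auto
  have add: "(\<lambda>x. a x + b x) \<in> DL" "L (\<lambda>x. a x + b x) = (\<lambda>x. L a x + L b x)" if "a \<in> DL" "b \<in> DL" for a b
    using linear_L that unfolding linear_operator_on_def function_subspace_def by auto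
  have scale: "(\<lambda>x. c * a x) \<in> DL" "L (\<lambda>x. c * a x) = (\<lambda>x. c * L a x)" if "a \<in> DL" for a c
    using linear_L that unfolding linear_operator_on_def function_subspace_def by auto
  have "bb_fun (defect f g t e) \<in> DL"
    unfolding eq by (intro add(1) scale(1) D f(2))
  moreover have "bb_fun (defect f g t e) \<in> C0"
    unfolding defect_def by (intro C0_diff C0_Pe C0_Pe_integral te f g)
  ultimately show "bb_fun (defect f g t e) \<in> C0 \<inter> DL" by simp
  have "L (bb_fun (defect f g t e)) = (\<lambda>x. (L (bb_fun (Pe t e f)) x + (- 1) * L (bb_fun f) x) + (- 1) * L (bb_fun (Pe_integral g t e)) x)"
    unfolding eq
    by (subst add(2), intro add(1) scale(1) D f(2), rule scale(1)[OF D(2)],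
        subst add(2)[OF D(1) scale(1)[OF f(2)]], subst scale(2)[OF f(2)], subst scale(2)[OF D(2)], rule refl)
  then show "L (bb_fun (defect f g t e)) x = L (bb_fun (Pe t e f)) x - bb_fun g x - L (bb_fun (Pe_integral g t e)) x"
    by (simp add: fg)
qed

definition dt_defect :: "real \<Rightarrow> real \<Rightarrow> 'a \<Rightarrow> real" where
  "dt_defect t e x = dt_P_eps P0 Q0 t e f x - bb_fun (Pe t e g) x"

lemma defect_has_derivative:
  assumes t: "0 < t" "0 < e" "t + e \<le> 1"
  shows "((\<lambda>u. bb_fun (defect f g u e) x) has_vector_derivative dt_defect t e x) (at t within {0<..1-e})"
proof -
  have "((\<lambda>u. bb_fun (Pe u e f) x - bb_fun f x - bb_fun (Pe_integral g u e) x) has_vector_derivative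
      (dt_P_eps P0 Q0 t e f x - 0 - bb_fun (Pe t e g) x)) (at t within {0<..1-e})"
    by (intro has_vector_derivative_diff Pe_has_derivative Pe_integral_has_derivative has_vector_derivative_const f t)
      (use t in auto)
  then show ?thesis by (simp add: defect_def bb_fun_simps dt_defect_def)
qed

text \<open>The terms \<open>\<partial>\<^sub>t P\<^sub>t\<^sub>,\<^sub>e f - L P\<^sub>t\<^sub>,\<^sub>e f\<close> give the residual of \<open>f\<close>. In the time integral, \<open>L P\<^sub>s\<^sub>,\<^sub>e g\<close> is the time derivative minus
the residual of \<open>g\<close>; the derivative integrates to \<open>P\<^sub>t\<^sub>,\<^sub>e g - P0\<^sub>e g\<close>, whose first term cancels against the derivative of the
integral.\<close>

lemma defect_evolution:
  assumes t: "0 < t" "0 < e" "t + e \<le> 1"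
  shows "dt_defect t e x - L (bb_fun (defect f g t e)) x =
    bb_fun (residual f t e) x + bb_fun (g - P0 e g) x - (LBINT s:{0<..<t}. bb_fun (residual g s e) x)"
proof -
  have te: "(t, e) \<in> time_region" using t by (simp add: time_region_def)
  have "L (bb_fun (Pe_integral g t e)) x = (LBINT s:{0<..<t}. L (bb_fun (Pe s e g)) x)"
    by (rule L_Pe_integral[OF t g])
  also have "\<dots> = (LBINT s:{0<..<t}. dt_P_eps P0 Q0 s e g x - bb_fun (residual g s e) x)"
  proof (rule set_lebesgue_integral_cong)
    show "\<forall>s. s \<in> {0<..<t} \<longrightarrow> L (bb_fun (Pe s e g)) x = dt_P_eps P0 Q0 s e g x - bb_fun (residual g s e) x"
    proof (intro allI impI)
      fix s assume "s \<in> {0<..<t}"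
      then show "L (bb_fun (Pe s e g)) x = dt_P_eps P0 Q0 s e g x - bb_fun (residual g s e) x"
        using evolution[OF _ t(2) _ g, of s x] t by auto
    qed
  qed simp
  also have "\<dots> = bb_fun (Pe t e g) x - bb_fun (P0 e g) x - (LBINT s:{0<..<t}. bb_fun (residual g s e) x)"
    by (subst set_integral_diff(2)[OF integral_dt(1)[OF t g] integral_residual_le(1)[OF te g]])
      (simp add: integral_dt(2)[OF t g])
  finally show ?thesis
    using evolution[OF t f(1), of x] by (simp add: defect_domain(2)[OF t] dt_defect_def bb_fun_simps)
qed

lemma defect_evolution_le:
  assumes t: "0 < t" "0 < e" "t \<le> T" "T + e \<le> 1"
  shows "\<bar>dt_defect t e x - L (bb_fun (defect f g t e)) x\<bar> \<le> norm (residual f t e) + norm (g - P0 e g) + residual_mass g T e"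
proof -
  have te: "(t, e) \<in> time_region" "(T, e) \<in> time_region" using t by (auto simp: time_region_def)
  have "\<bar>LBINT s:{0<..<t}. bb_fun (residual g s e) x\<bar> \<le> residual_mass g T e"
    using integral_residual_le(2)[OF te(1) g, of x] residual_mass_mono[OF te(2) g t(1,3)] by linarith
  moreover have "dt_defect t e x - L (bb_fun (defect f g t e)) x =
    bb_fun (residual f t e) x + bb_fun (g - P0 e g) x - (LBINT s:{0<..<t}. bb_fun (residual g s e) x)"
    by (rule defect_evolution) (use t in auto)
  ultimately show ?thesis
    using abs_bb_fun_le_norm[of "residual f t e" x] abs_bb_fun_le_norm[of "g - P0 e g" x] by linarith
qed

text \<open>For \<open>e > 0\<close> small, the right-hand side of the equation for the defect is below any given \<open>d\<close> on the whole interval from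
\<open>\<tau>\<close> to \<open>T\<close>. The maximum principle bounds the growth of the norm by \<open>d (T - \<tau>)\<close>, and \<open>d\<close> is arbitrary.\<close>

lemma norm_defect_antimono:
  assumes T: "0 < \<tau>" "\<tau> \<le> T" "T < 1"
  shows "norm (defect f g T 0) \<le> norm (defect f g \<tau> 0)"
proof (rule field_le_epsilon)
  fix d :: real assume d: "0 < d"
  \<comment> \<open>Positive regularizations tending to zero with \<open>T + e n \<le> 1\<close>.\<close>
  define e where "e n = (1 - T) * inverse (real (Suc n))" for n
  have e0: "0 < e n" for n using T by (simp add: e_def)
  have e1: "e n \<le> 1 - T" for n
    unfolding e_def by (rule mult_left_le) (use T in \<open>auto simp: inverse_le_1_iff\<close>)
  have el: "e \<longlonglongrightarrow> 0"
    unfolding e_def using LIMSEQ_inverse_real_of_nat by (rule tendsto_mult_right_zero)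
  have e2: "0 \<le> e n" "T + e n \<le> 1" "\<tau> + e n \<le> 1" for n
    using e0[of n] e1[of n] T by linarith+
  have "filterlim e (at_right 0) sequentially"
    using el e0 by (intro tendsto_imp_filterlim_at_right) auto
  from filterlim_compose[OF P_zero[OF g] this]
  have "(\<lambda>n. norm (g - P0 (e n) g)) \<longlonglongrightarrow> norm (g - g)"
    by (intro tendsto_intros)
  then have "\<forall>\<^sub>F n in sequentially. norm (g - P0 (e n) g) < d / 3"
    using d by (intro order_tendstoD(2)) auto
  moreover have "\<forall>\<^sub>F n in sequentially. residual_mass g T (e n) < d / 3"
    using d T by (intro order_tendstoD(2)[OF residual_mass_tendsto_0[OF g _ e2(1,2) el]]) auto
  moreover have "\<forall>\<^sub>F n in sequentially. \<forall>t\<in>{\<tau>..T}. norm (residual f t (e n)) < d / 3"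
    using d by (intro residual_uniformly_small f T e2 el) auto
  ultimately have "\<forall>\<^sub>F n in sequentially. norm (defect f g T (e n)) \<le> norm (defect f g \<tau> (e n)) + d * (T - \<tau>)"
  proof eventually_elim
    case (elim n)
    show ?case
    proof (rule parabolic_norm_estimate[OF pmp linear_L, where T = T and U' = "\<lambda>t. dt_defect t (e n)"])
      have "continuous_on {\<tau>..T} (\<lambda>t. (t, e n))" by (intro continuous_intros)
      from continuous_on_compose2[OF continuous_on_defect[of f g] this]
      show "continuous_on {\<tau>..T} (\<lambda>t. defect f g t (e n))"
        using T e2[of n] by (simp add: time_region_def image_subset_iff)
      show "bb_fun (defect f g t (e n)) \<in> C0 \<inter> DL" if "t \<in> {\<tau>..T}" for t
        using that T e2(2)[of n] by (intro defect_domain e0) auto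
      fix t x assume t: "t \<in> {\<tau><..T}"
      have "((\<lambda>s. bb_fun (defect f g s (e n)) x) has_vector_derivative dt_defect t (e n) x) (at t within {0<..1 - e n})"
        using t T e2(2)[of n] by (intro defect_has_derivative e0) auto
      then show "((\<lambda>s. bb_fun (defect f g s (e n)) x) has_vector_derivative dt_defect t (e n) x) (at t within {\<tau>..t})"
        by (rule has_vector_derivative_within_subset) (use t T e2(2)[of n] in auto)
      have "\<bar>dt_defect t (e n) x - L (bb_fun (defect f g t (e n))) x\<bar>
          \<le> norm (residual f t (e n)) + norm (g - P0 (e n) g) + residual_mass g T (e n)"
        using t T e2(2)[of n] by (intro defect_evolution_le e0) auto
      moreover have "norm (residual f t (e n)) < d / 3" using elim(3) t by auto
      ultimately show "\<bar>dt_defect t (e n) x - L (bb_fun (defect f g t (e n))) x\<bar> < d"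
        using elim(1,2) by linarith
    qed (use T d in auto)
  qed
  moreover have "(\<lambda>n. norm (defect f g T (e n))) \<longlonglongrightarrow> norm (defect f g T 0)"
    using T e2 el by (intro tendsto_norm defect_tendsto) auto
  moreover have "(\<lambda>n. norm (defect f g \<tau> (e n)) + d * (T - \<tau>)) \<longlonglongrightarrow> norm (defect f g \<tau> 0) + d * (T - \<tau>)"
    using T e2 el by (intro tendsto_add tendsto_const tendsto_norm defect_tendsto) auto
  ultimately have "norm (defect f g T 0) \<le> norm (defect f g \<tau> 0) + d * (T - \<tau>)"
    by (intro tendsto_le[OF sequentially_bot])
  also have "d * (T - \<tau>) \<le> d * 1" using d T by (intro mult_left_mono) auto
  finally show "norm (defect f g T 0) \<le> norm (defect f g \<tau> 0) + d" by simp
qed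

text \<open>Letting \<open>\<tau>\<close> tend to zero in the monotonicity estimate settles times below one. At time one there is no room for a positive
regularization, and the claim follows by continuity.\<close>

lemma defect_eq_0:
  assumes t: "t \<in> {0<..1}"
  shows "defect f g t 0 = 0"
proof -
  have less: "defect f g T 0 = 0" if T: "0 < T" "T < 1" for T
  proof -
    have l: "((\<lambda>\<tau>. norm (defect f g \<tau> 0)) \<longlongrightarrow> 0) (at_right 0)"
      by (intro tendsto_norm_zero defect_at_zero f)
    have "\<forall>\<^sub>F \<tau> in at_right 0. \<tau> \<in> {0<..<T}" using T by (intro eventually_at_right_real) auto
    then have "\<forall>\<^sub>F \<tau> in at_right 0. norm (defect f g T 0) \<le> norm (defect f g \<tau> 0)"
      by eventually_elim (use T in \<open>auto intro: norm_defect_antimono\<close>)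
    from tendsto_lowerbound[OF l this] show ?thesis by simp
  qed
  show ?thesis
  proof (cases "t = 1")
    case True
    \<comment> \<open>The double successor makes the first time positive.\<close>
    define T where "T n = 1 - inverse (real (Suc (Suc n)))" for n
    have T: "0 < T n" "T n < 1" for n by (simp_all add: T_def field_simps)
    have "T \<longlonglongrightarrow> 1 - 0"
      unfolding T_def by (intro tendsto_intros LIMSEQ_Suc[OF LIMSEQ_inverse_real_of_nat])
    then have "(\<lambda>n. (T n, 0::real)) \<longlonglongrightarrow> (1, 0)" by (intro tendsto_Pair) auto
    from continuous_on_tendsto_compose[OF continuous_on_defect[of f g] this]
    have "(\<lambda>n. defect f g (T n) 0) \<longlonglongrightarrow> defect f g 1 0"
      using T by (simp add: time_region_def less_imp_le)
    then show ?thesis using less[OF T] True by (simp add: LIMSEQ_const_iff)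
  qed (use t less in auto)
qed

lemma Dynkin_formula:
  assumes t: "t \<in> {0<..1}"
  shows "set_integrable lborel {0<..<t} (\<lambda>s. bb_fun (P_op P0 Q0 s g) x)"
    "bb_fun (P_op P0 Q0 t f) x - bb_fun f x = (LBINT s:{0<..<t}. bb_fun (P_op P0 Q0 s g) x)"
proof -
  have te: "(t, 0) \<in> time_region" using t by (simp add: time_region_def)
  show "set_integrable lborel {0<..<t} (\<lambda>s. bb_fun (P_op P0 Q0 s g) x)"
    unfolding P_op_eq_Pe by (rule bb_fun_Pe_integral(1)[OF te])
  have "bb_fun (defect f g t 0) x = 0" by (simp add: defect_eq_0[OF t] bb_fun_simps)
  then show "bb_fun (P_op P0 Q0 t f) x - bb_fun f x = (LBINT s:{0<..<t}. bb_fun (P_op P0 Q0 s g) x)"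
    unfolding P_op_eq_Pe bb_fun_Pe_integral(2)[OF te, symmetric] by (simp add: defect_def bb_fun_simps)
qed

end

end

text \<open>Applying the scaling property at time one gives \<open>r t \<le> sqrt t * r 1\<close>. The exponent is capped so that the
singularity is a nonincreasing function of time.\<close>

lemma singular_bound_of_scale:
  fixes r :: "real \<Rightarrow> real"
  assumes r0: "\<forall>t\<in>{0<..1}. 0 \<le> r t" and r: "\<forall>t\<in>{0<..1}. \<forall>c\<in>{0<..1}. r (c * t) \<le> sqrt c * r t"
    and a: "0 < a" and t: "t \<in> {0<..1}"
  shows "inverse t * r t powr a \<le> r 1 powr a * t powr (min (a / 2) 1 - 1)"
proof -
  have "r t \<le> sqrt t * r 1" using r[rule_format, of 1 t] t by simp
  then have "r t powr a \<le> (sqrt t * r 1) powr a"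
    using r0 t a by (intro powr_mono2) auto
  also have "\<dots> = t powr (a / 2) * r 1 powr a"
    using t r0 by (simp add: powr_mult powr_half_sqrt[symmetric] powr_powr)
  also have "\<dots> \<le> t powr (min (a / 2) 1) * r 1 powr a"
    using t by (intro mult_right_mono powr_mono') auto
  finally have "inverse t * r t powr a \<le> inverse t * (t powr (min (a / 2) 1) * r 1 powr a)"
    using t by (intro mult_left_mono) auto
  also have "\<dots> = r 1 powr a * t powr (min (a / 2) 1 - 1)"
    using t by (simp add: powr_diff field_simps)
  finally show ?thesis .
qed


theorem proposition3p17:
  fixes r :: "real \<Rightarrow> real"
    and P0 Q0 :: "(real ^ 'd) op_family"
    and L :: "(real ^ 'd \<Rightarrow> real) \<Rightarrow> (real ^ 'd \<Rightarrow> real)"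
    and DL \<D> :: "(real ^ 'd \<Rightarrow> real) set"
  assumes R0: "\<forall>t\<in>{0<..1}. 0 \<le> r t" "mono_on {0<..1} r"
      "\<forall>t\<in>{0<..1}. \<forall>c\<in>{0<..1}. r (c * t) \<le> sqrt c * r t"
    and S1: "\<forall>t\<in>{0<..1}. linear (P0 t)" "\<forall>t\<in>{0<..1}. linear (Q0 t)"
    and S2: "\<forall>t\<in>{0<..1}. \<forall>f. bb_fun f \<in> C0 \<longrightarrow> bb_fun (P0 t f) \<in> C0"
      "\<forall>t\<in>{0<..1}. \<forall>f. bb_fun f \<in> C0 \<longrightarrow> bb_fun (Q0 t f) \<in> C0"
    and H0: "\<forall>f. bb_fun f \<in> C0 \<longrightarrow> ((\<lambda>t. norm (P0 t f - f)) \<longlongrightarrow> 0) (at_right 0)"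
    and H1: "\<exists>C1>0. \<forall>t\<in>{0<..1}. \<forall>f. norm (P0 t f) \<le> C1 * norm f"
    and H2: "\<forall>t\<in>{0<..1}. \<forall>f. ((\<lambda>s. norm (P0 s f - P0 t f)) \<longlongrightarrow> 0) (at t within {0<..1})"
    and H3: "\<exists>C3>0. \<exists>\<epsilon>\<^sub>0>0. \<forall>t\<in>{0<..1}. \<forall>f.
      norm (Q0 t f) \<le> C3 * inverse t * r t powr \<epsilon>\<^sub>0 * norm f"
    and H4: "\<forall>t\<in>{0<..1}. \<forall>f. ((\<lambda>s. norm (Q0 s f - Q0 t f)) \<longlongrightarrow> 0) (at t within {0<..1})"
    and L0: "linear_operator_on DL L"
    and L1: "positive_maximum_principle DL L"
    and L3: "\<D> \<subseteq> DL" "\<forall>f\<in>\<D>. L f \<in> C0"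
    and H5: "\<forall>t>0. \<forall>\<epsilon>>0. t + \<epsilon> \<le> 1 \<longrightarrow> (\<forall>x f. bb_fun f \<in> C0 \<longrightarrow>
      P_eps_differentiable P0 Q0 t \<epsilon> f x \<and>
      bb_fun (P_eps P0 Q0 t \<epsilon> f) \<in> DL \<and>
      dt_P_eps P0 Q0 t \<epsilon> f x - L (bb_fun (P_eps P0 Q0 t \<epsilon> f)) x =
        bb_fun (P0 \<epsilon> (Q_sum Q0 t f)) x - bb_fun (Q0 (t + \<epsilon>) f) x
        - (LBINT s:{0<..<t}. bb_fun (Q0 (t - s + \<epsilon>) (Q_sum Q0 s f)) x))"
    and H6: "\<forall>t>0. \<forall>\<epsilon>>0. t + \<epsilon> \<le> 1 \<longrightarrow> (\<forall>x f. bb_fun f \<in> C0 \<longrightarrow>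
      P_eps_differentiable P0 Q0 t \<epsilon> f x \<and>
      bb_fun (P_eps P0 Q0 t \<epsilon> f) \<in> DL \<and>
      bb_fun (set_Bochner_integral lborel {0<..<t} (\<lambda>s. P_eps P0 Q0 s \<epsilon> f)) \<in> DL \<and>
      set_integrable lborel {0<..<1-\<epsilon>} (\<lambda>s. dt_P_eps P0 Q0 s \<epsilon> f x) \<and>
      set_integrable lborel {0<..<1-\<epsilon>} (\<lambda>s. L (bb_fun (P_eps P0 Q0 s \<epsilon> f)) x) \<and>
      L (bb_fun (set_Bochner_integral lborel {0<..<t} (\<lambda>s. P_eps P0 Q0 s \<epsilon> f))) x =
        (LBINT s:{0<..<t}. L (bb_fun (P_eps P0 Q0 s \<epsilon> f)) x))"
  shows "\<forall>t\<in>{0<..1}. \<forall>f. bb_fun f \<in> \<D> \<inter> C0 \<longrightarrow> (\<forall>x.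
    set_integrable lborel {0<..<t} (\<lambda>s. bb_fun (P_op P0 Q0 s (Bborel (L (bb_fun f)))) x) \<and>
    bb_fun (P_op P0 Q0 t f) x - bb_fun f x =
      (LBINT s:{0<..<t}. bb_fun (P_op P0 Q0 s (Bborel (L (bb_fun f)))) x))"
proof (intro ballI allI impI)
  fix t f x assume t: "t \<in> {0<..1::real}" and f: "bb_fun f \<in> \<D> \<inter> C0"
  obtain C1 where C1: "C1 > 0" "\<And>t f. t \<in> {0<..1} \<Longrightarrow> norm (P0 t f) \<le> C1 * norm f" using H1 by blast
  obtain C3 a where C3: "C3 > 0" "a > 0"
    "\<And>t f. t \<in> {0<..1} \<Longrightarrow> norm (Q0 t f) \<le> C3 * inverse t * r t powr a * norm f" using H3 by blast
  \<comment> \<open>One exponent and one constant for both families.\<close>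
  define \<delta> where "\<delta> = min (a / 2) 1"
  define K where "K = max C1 (C3 * r 1 powr a)"
  have delta: "0 < \<delta>" "\<delta> \<le> 1" and K: "0 \<le> K" using C1 C3 by (auto simp: \<delta>_def K_def)
  have Q_le: "norm (Q0 t f) \<le> K * t powr (\<delta> - 1) * norm f" if s: "t \<in> {0<..1}" for t f
  proof -
    have "norm (Q0 t f) \<le> C3 * (inverse t * r t powr a) * norm f" using C3(3)[OF s] by (simp add: mult.assoc)
    also have "\<dots> \<le> C3 * (r 1 powr a * t powr (\<delta> - 1)) * norm f"
      unfolding \<delta>_def using C3 by (intro mult_right_mono mult_left_mono singular_bound_of_scale R0 s) auto
    also have "\<dots> \<le> K * t powr (\<delta> - 1) * norm f"
      unfolding mult.assoc[symmetric] by (intro mult_right_mono) (auto simp: K_def)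
    finally show ?thesis .
  qed
  have P_le: "norm (P0 t f) \<le> K * norm f" if s: "t \<in> {0<..1}" for t f
    using C1(2)[OF s, of f] by (rule order_trans) (auto simp: K_def intro: mult_right_mono)
  have P_le': "norm (P0 t f) \<le> K * t powr (\<delta> - 1) * norm f" if s: "t \<in> {0<..1}" for t f
  proof -
    have "1 powr (\<delta> - 1) \<le> t powr (\<delta> - 1)" using s delta by (intro powr_mono2') auto
    then have "K * 1 * norm f \<le> K * t powr (\<delta> - 1) * norm f"
      using K by (intro mult_right_mono mult_left_mono) auto
    with P_le[OF s, of f] show ?thesis by simp
  qed
  have cont: "continuous_on {0<..1} (\<lambda>t. A t f)"
    if "\<forall>t\<in>{0<..1}. \<forall>f. ((\<lambda>s. norm (A s f - A t f)) \<longlongrightarrow> 0) (at t within {0<..1})"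
    for A :: "(real ^ 'd) op_family" and f
    unfolding continuous_on_def using that by (auto intro: LIM_zero_cancel tendsto_norm_zero_cancel)
  interpret parametrix P0 Q0 K \<delta>
  proof
    show "((\<lambda>t. P0 t f) \<longlongrightarrow> f) (at_right 0)" if "bb_fun f \<in> C0" for f
      using H0 that by (auto intro: LIM_zero_cancel tendsto_norm_zero_cancel)
  qed (use delta K S2 linear_add[OF bspec[OF S1(1)]] linear_add[OF bspec[OF S1(2)]]
      linear_scale[OF bspec[OF S1(1)]] linear_scale[OF bspec[OF S1(2)]] Q_le P_le P_le' cont[OF H2] cont[OF H4] in auto)
  have P0_ext: "P0_ext e g = P0 e g" if "e > 0" for e g using that by (simp add: P0_ext_def)
  interpret parametrix_generator P0 Q0 K \<delta> DL L
  proof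
    show "linear_operator_on DL L" "positive_maximum_principle DL L" by (fact L0, fact L1)
  next
    fix t e :: real and f :: "(real ^ 'd) bborel" and x assume t: "0 < t" "0 < e" "t + e \<le> 1" and f: "bb_fun f \<in> C0"
    note h5 = H5[rule_format, OF t f, of x] and h6 = H6[rule_format, OF t f, of x]
    show "P_eps_differentiable P0 Q0 t e f x" using h5 by blast
    show "bb_fun (Pe t e f) \<in> DL \<and> bb_fun (Pe_integral f t e) \<in> DL" using h6 unfolding Pe_integral_def by blast
    show "L (bb_fun (Pe_integral f t e)) x = (LBINT s:{0<..<t}. L (bb_fun (Pe s e f)) x)"
      using h6 unfolding Pe_integral_def by blast
    have te: "(t, e) \<in> time_region" using t by (simp add: time_region_def)
    show "dt_P_eps P0 Q0 t e f x - L (bb_fun (Pe t e f)) x = bb_fun (residual f t e) x"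
      using h5 Q.bb_fun_conv(2)[OF Qs_curve te, of f x] t
      by (simp add: residual_def P0_ext bb_fun_simps)
  next
    fix e :: real and f :: "(real ^ 'd) bborel" and x assume e: "0 < e" "e < 1" and f: "bb_fun f \<in> C0"
    show "set_integrable lborel {0<..<1-e} (\<lambda>s. dt_P_eps P0 Q0 s e f x)"
      using H6[rule_format, of "1 - e" e f x] e f by simp
  qed
  have g: "L (bb_fun f) \<in> C0" and fD: "bb_fun f \<in> DL" "bb_fun f \<in> C0" using f L3 by auto
  have "bb_fun (Bborel (L (bb_fun f))) = L (bb_fun f)" by (rule C0_bounded_borel[OF g])
  then show "set_integrable lborel {0<..<t} (\<lambda>s. bb_fun (P_op P0 Q0 s (Bborel (L (bb_fun f)))) x) \<and>
    bb_fun (P_op P0 Q0 t f) x - bb_fun f x =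
      (LBINT s:{0<..<t}. bb_fun (P_op P0 Q0 s (Bborel (L (bb_fun f)))) x)"
    using Dynkin_formula[of f "Bborel (L (bb_fun f))" t x] fD g t by simp
qed

end
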